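(* Fix $r>0$ and let $f\in \mathbf{L}^2(\Omega)$, $g\in L^2(\Omega)$, $u_\Gamma\in\mathbf{H}^{1/2}(\Gamma)$, $r_\Gamma\in H^{-1/2}(\Gamma)$. Put $D:=\|g\|_{0,\Omega}+\|r_\Gamma\|_{-1/2,\Gamma}+\|u_\Gamma\|_{1/2,\Gamma}+\|f\|_{0,\Omega}$ and assume $$\kappa_2\,\gamma_1^*\,\gamma_1\,D\le\tfrac12,\qquad \frac{\gamma_1}{r}\max\{\gamma_1\kappa_2r,1\}\,D<1,\qquad \frac{\gamma_1^*}{r}\max\{\gamma_1^*\kappa_2r,1\}\,D<1 .$$ Let $((\underline{d},\sigma),u)\in(\mathbf{X}\times\mathbf{Y})\times\mathbf{Z}$ and $((\underline{d}_h,\sigma_h),u_h)\in(\mathbf{X}_h\times\mathbf{Y}_h)\times\mathbf{Z}_h$ be the unique solutions of (P) with $\underline{d}\in\mathbf{W}$ and of (P$_h$) with $\underline{d}_h\in\mathbf{W}_h$, respectively. Then there exists $C_{\text{Céa}}>0$ such that $$\|((\underline{d},\sigma),u)-((\underline{d}_h,\sigma_h),u_h)\|\le C_{\text{Céa}}\inf_{((\underline{e}_h,\tau_h),v_h)\in(\mathbf{X}_h\times\mathbf{Y}_h)\times\mathbf{Z}_h}\|((\underline{d},\sigma),u)-((\underline{e}_h,\tau_h),v_h)\|.$$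
   Context: Setting. $\Omega\subset\mathbb{R}^n$ with $n=2$ (the Arnold--Winther spaces below are for the 2D case) is an open bounded domain with Lipschitz boundary $\Gamma$ and unit outward normal $\boldsymbol{n}$, such that $\overline\Omega$ admits a regular partition $\mathcal{T}_h$ into triangles $K$ of diameter $h_K$, $h:=\max_K h_K$. Bold spaces $\mathbf{L}^2,\mathbf{H}^m$ are vector-valued, blackboard ones tensor-valued ($n\times n$); $\|\cdot\|_{m,\Omega}$ is the $H^m(\Omega)$ norm ($H^0=L^2$). $\mathbb{I}$ is the identity tensor; $\mathbf{div}$ of a tensor is the row-wise divergence; $\langle\cdot,\cdot\rangle_\Gamma$ is the duality between $H^{-1/2}(\Gamma)$ and $H^{1/2}(\Gamma)$ (also vector-valued). Parameters: constants $\lambda,\mu>0$, $0\le\alpha\le1$, $c_0>0$; $\mathcal{C}d:=\lambda(\operatorname{tr}d)\mathbb{I}+2\mu d$. Spaces: $\mathbf{X}:=\mathbb{L}^2_{\rm sym}(\Omega)\times H^1(\Omega)$, $\mathbf{Y}:=\{\tau\in\mathbb{L}^2_{\rm sym}(\Omega):\mathbf{div}\,\tau\in\mathbf{L}^2(\Omega)\}$, $\mathbf{Z}:=\mathbf{L}^2(\Omega)$, with $\mathbb{L}^2_{\rm sym}(\Omega)$ the symmetric tensors in $\mathbb{L}^2(\Omega)$. Elements of $\mathbf{X}$ are written $\underline{d}=(d,p)$, $\underline{e}=(e,q)$, $\underline{w}=(w,s)$. Norms: $\|\underline{e}\|_{\mathbf{X}}^2=\|e\|_{0,\Omega}^2+\|q\|_{1,\Omega}^2$,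 $\|\tau\|_{\mathbf{Y}}^2=\|\tau\|_{0,\Omega}^2+\|\mathbf{div}\,\tau\|_{0,\Omega}^2$, $\|v\|_{\mathbf{Z}}=\|v\|_{0,\Omega}$; product spaces carry the Euclidean combination of norms, so $\|((\underline{e},\tau),v)\|^2=\|\underline{e}\|_{\mathbf{X}}^2+\|\tau\|_{\mathbf{Y}}^2+\|v\|_{\mathbf{Z}}^2$. Permeability: $\kappa$ assigns to each $(d,p)$ an $n\times n$ tensor $\kappa(d,p)\in\mathbb{L}^\infty(\Omega)$, and there are constants $\kappa_1,\kappa_2>0$ with $\kappa_1|v|^2\le v^{t}\kappa(\cdot,\cdot)v$ for all $v\in\mathbb{R}^n\setminus\{0\}$ (for all arguments, a.e. in $\Omega$) and $\|\kappa(\cdot,p_1)-\kappa(\cdot,p_2)\|_{\mathbb{L}^\infty(\Omega)}\le\kappa_2\|p_1-p_2\|_{1,\Omega}$ for all $p_1,p_2\in H^1(\Omega)$, where each dot stands for an arbitrary (possibly different) first argument. Forms: $$a(\underline{d},\underline{e}):=\int_\Omega\mathcal{C}d:e+\int_\Omega\kappa(\underline{d})\nabla p\cdot\nabla q+c_0\int_\Omega pq+\alpha\int_\Omega q\operatorname{tr}d-\alpha\int_\Omega p\operatorname{tr}e,$$ $b_1(\underline{e},\tau):=-\int_\Omega\tau:e$, $b_2((\underline{e},\tau),v):=-\int_\Omega v\cdot\mathbf{div}\,\tau$. Functionals: $G(\underline{e}):=\int_\Omega gq+\langle r_\Gamma,q\rangle_\Gamma$, $H(\tau):=-\langle\tau\boldsymbol{n},u_\Gamma\rangle_\Gamma$,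 $F(v):=\int_\Omega f\cdot v$. Problem (P): find $((\underline{d},\sigma),u)\in(\mathbf{X}\times\mathbf{Y})\times\mathbf{Z}$ such that for all $((\underline{e},\tau),v)\in(\mathbf{X}\times\mathbf{Y})\times\mathbf{Z}$: $a(\underline{d},\underline{e})+b_1(\underline{e},\sigma)=G(\underline{e})$, $\;b_1(\underline{d},\tau)+b_2((\underline{e},\tau),u)=H(\tau)$, $\;b_2((\underline{d},\sigma),v)=F(v)$. Discrete spaces, for an integer $k\ge1$ ($\mathrm{P}_\ell(K)$, $\mathbf{P}_\ell(K)$, $\mathbb{P}_\ell(K)$: scalar, vector, tensor polynomials of degree $\le\ell$ on $K$): $\mathbf{X}_{1,h}:=\{e_h\in\mathbb{L}^2_{\rm sym}(\Omega):e_h|_K\in\mathbb{P}_{k+2}(K),\ \mathbf{div}\,e_h|_K\in\mathbf{P}_k(K)\ \forall K\in\mathcal{T}_h\}$; $\mathbf{X}_{2,h}:=\{q_h\in C(\overline\Omega):q_h|_K\in\mathrm{P}_{k+1}(K)\ \forall K\}$; $\mathbf{X}_h:=\mathbf{X}_{1,h}\times\mathbf{X}_{2,h}$; $\mathbf{Y}_h:=\{\tau_h\in\mathbf{Y}:\tau_h|_K\in\mathbb{P}_{k+2}(K),\ \mathbf{div}\,\tau_h|_K\in\mathbf{P}_k(K)\ \forall K\}$; $\mathbf{Z}_h:=\{v_h\in\mathbf{L}^2(\Omega):v_h|_K\in\mathbf{P}_k(K)\ \forall K\}$. Problem (P$_h$): the same equations as (P), with solution and test functions in $(\mathbf{X}_h\times\mathbf{Y}_h)\times\mathbf{Z}_h$.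 $\mathbf{W}:=\{\underline{w}\in\mathbf{X}:\|\underline{w}\|_{\mathbf{X}}\le r\}$, $\mathbf{W}_h:=\{\underline{w}_h\in\mathbf{X}_h:\|\underline{w}_h\|_{\mathbf{X}}\le r\}$. Constants: $\beta_2>0$ and $\beta_2^*>0$ are constants such that $\sup_{0\ne(\underline{e},\tau)\in\mathbf{X}\times\mathbf{Y}}\frac{b_2((\underline{e},\tau),v)}{\|(\underline{e},\tau)\|_{\mathbf{X}\times\mathbf{Y}}}\ge\beta_2\|v\|_{\mathbf{Z}}$ for all $v\in\mathbf{Z}$ and $\sup_{0\ne(\underline{e}_h,\tau_h)\in\mathbf{X}_h\times\mathbf{Y}_h}\frac{b_2((\underline{e}_h,\tau_h),v_h)}{\|(\underline{e}_h,\tau_h)\|_{\mathbf{X}\times\mathbf{Y}}}\ge\beta_2^*\|v_h\|_{\mathbf{Z}}$ for all $v_h\in\mathbf{Z}_h$; $C_a:=\max\{2\mu+n\lambda,c_0,n\alpha,\kappa_2r\}$, $c_a:=\min\{\kappa_1,2\mu,c_0\}$, $$\gamma_2:=\frac{(C_a+2)(c_a+1+C_a)}{c_a},\quad\gamma_1:=\frac{(C_a+1+\beta_2+\gamma_2)^2}{\beta_2^2\gamma_2},\quad\gamma_1^*:=\frac{(C_a+1+\beta_2^*+\gamma_2)^2}{(\beta_2^* )^2\gamma_2}.$$ *)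

theory Defs
  imports "HOL-Analysis.Analysis" "HOL-Probability.Essential_Supremum"
begin

text \<open>
  Elements of function spaces are represented by functions on the whole plane; only their values
  on the domain matter, and in Lebesgue and Sobolev spaces only up to null sets.
\<close>

type_synonym scalar_field = "real^2 \<Rightarrow> real"
type_synonym vector_field = "real^2 \<Rightarrow> real^2"
type_synonym tensor_field = "real^2 \<Rightarrow> real^2^2"

section \<open>Domain and partition\<close>

text \<open>Near each boundary point the domain is, after a rigid motion, the strict epigraph of a
  Lipschitz function; this forces the boundary to be the graph there.\<close>

definition lipschitz_domain :: "(real^2) set \<Rightarrow> bool" where
  "lipschitz_domain \<Omega> \<longleftrightarrow>
     open \<Omega> \<and> connected \<Omega> \<and> bounded \<Omega> \<and> \<Omega> \<noteq> {} \<and>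
     (\<forall>x\<in>frontier \<Omega>. \<exists>\<rho>>0. \<exists>(R :: real^2 \<Rightarrow> real^2) (\<phi> :: real \<Rightarrow> real) L.
        orthogonal_transformation R \<and> L-lipschitz_on UNIV \<phi> \<and>
        \<Omega> \<inter> ball x \<rho> = {y \<in> ball x \<rho>. R (y - x) $ 2 > \<phi> (R (y - x) $ 1)})"

definition regular_partition :: "(real^2) set \<Rightarrow> (real^2) set set \<Rightarrow> bool" where
  "regular_partition \<Omega> \<T> \<longleftrightarrow>
     triangulation \<T> \<and> (\<forall>K\<in>\<T>. 2 simplex K) \<and> \<Union>\<T> = closure \<Omega>"

section \<open>Lebesgue spaces\<close>

definition L2 :: "(real^2) set \<Rightarrow> (real^2 \<Rightarrow> 'a::euclidean_space) set" where
  "L2 \<Omega> = {f. f \<in> borel_measurable (lebesgue_on \<Omega>) \<and>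
               integrable (lebesgue_on \<Omega>) (\<lambda>x. (norm (f x))\<^sup>2)}"

definition L2_norm :: "(real^2) set \<Rightarrow> (real^2 \<Rightarrow> 'a::euclidean_space) \<Rightarrow> real" where
  "L2_norm \<Omega> f = sqrt (LINT x|lebesgue_on \<Omega>. (norm (f x))\<^sup>2)"

text \<open>On tensors the inner product of \<^typ>\<open>real^2^2\<close> is the Frobenius product.\<close>

definition L2_inner ::
  "(real^2) set \<Rightarrow> (real^2 \<Rightarrow> 'a::euclidean_space) \<Rightarrow> (real^2 \<Rightarrow> 'a) \<Rightarrow> real" where
  "L2_inner \<Omega> f g = (LINT x|lebesgue_on \<Omega>. f x \<bullet> g x)"

definition L2_sym :: "(real^2) set \<Rightarrow> tensor_field set" where
  "L2_sym \<Omega> = {\<tau> \<in> L2 \<Omega>. AE x in lebesgue_on \<Omega>. transpose (\<tau> x) = \<tau> x}"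

text \<open>Infinite for functions that are not measurable or not essentially bounded.\<close>

definition Linf_norm :: "(real^2) set \<Rightarrow> tensor_field \<Rightarrow> ereal" where
  "Linf_norm \<Omega> k = esssup (lebesgue_on \<Omega>) (\<lambda>x. ereal (norm (k x)))"

definition Linf :: "(real^2) set \<Rightarrow> tensor_field set" where
  "Linf \<Omega> = {k. k \<in> borel_measurable (lebesgue_on \<Omega>) \<and> Linf_norm \<Omega> k < \<infinity>}"

section \<open>Weak gradient and divergence\<close>

fun Ck :: "nat \<Rightarrow> scalar_field \<Rightarrow> bool" where
  "Ck 0 \<phi> \<longleftrightarrow> continuous_on UNIV \<phi>"
| "Ck (Suc m) \<phi> \<longleftrightarrow> (\<exists>D. (\<forall>x. GDERIV \<phi> x :> D x) \<and> (\<forall>i. Ck m (\<lambda>x. D x $ i)))"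

definition smooth :: "scalar_field \<Rightarrow> bool" where
  "smooth \<phi> \<longleftrightarrow> (\<forall>m. Ck m \<phi>)"

definition test_function :: "(real^2) set \<Rightarrow> scalar_field \<Rightarrow> bool" where
  "test_function \<Omega> \<phi> \<longleftrightarrow>
     smooth \<phi> \<and> (\<exists>S. compact S \<and> S \<subseteq> \<Omega> \<and> (\<forall>x. x \<notin> S \<longrightarrow> \<phi> x = 0))"

definition is_weak_grad :: "(real^2) set \<Rightarrow> scalar_field \<Rightarrow> vector_field \<Rightarrow> bool" where
  "is_weak_grad \<Omega> q G \<longleftrightarrow>
     (\<forall>\<phi> D. test_function \<Omega> \<phi> \<and> (\<forall>x. GDERIV \<phi> x :> D x) \<longrightarrow>
        (LINT x|lebesgue_on \<Omega>. q x *\<^sub>R D x) = - (LINT x|lebesgue_on \<Omega>. \<phi> x *\<^sub>R G x))"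

definition is_weak_div :: "(real^2) set \<Rightarrow> vector_field \<Rightarrow> scalar_field \<Rightarrow> bool" where
  "is_weak_div \<Omega> w s \<longleftrightarrow>
     (\<forall>\<phi> D. test_function \<Omega> \<phi> \<and> (\<forall>x. GDERIV \<phi> x :> D x) \<longrightarrow>
        (LINT x|lebesgue_on \<Omega>. w x \<bullet> D x) = - (LINT x|lebesgue_on \<Omega>. \<phi> x * s x))"

definition H1 :: "(real^2) set \<Rightarrow> scalar_field set" where
  "H1 \<Omega> = {q \<in> L2 \<Omega>. \<exists>G\<in>L2 \<Omega>. is_weak_grad \<Omega> q G}"

definition wgrad :: "(real^2) set \<Rightarrow> scalar_field \<Rightarrow> vector_field" where
  "wgrad \<Omega> q = (SOME G. G \<in> L2 \<Omega> \<and> is_weak_grad \<Omega> q G)"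

definition H1_norm :: "(real^2) set \<Rightarrow> scalar_field \<Rightarrow> real" where
  "H1_norm \<Omega> q = sqrt ((L2_norm \<Omega> q)\<^sup>2 + (L2_norm \<Omega> (wgrad \<Omega> q))\<^sup>2)"

text \<open>The divergence of a tensor field is taken row by row.\<close>

definition is_tensor_div :: "(real^2) set \<Rightarrow> tensor_field \<Rightarrow> vector_field \<Rightarrow> bool" where
  "is_tensor_div \<Omega> \<tau> w \<longleftrightarrow> (\<forall>i. is_weak_div \<Omega> (\<lambda>x. \<tau> x $ i) (\<lambda>x. w x $ i))"

definition tdiv :: "(real^2) set \<Rightarrow> tensor_field \<Rightarrow> vector_field" where
  "tdiv \<Omega> \<tau> = (SOME w. w \<in> L2 \<Omega> \<and> is_tensor_div \<Omega> \<tau> w)"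

section \<open>Traces\<close>

text \<open>One-dimensional Hausdorff measure, normalised so that it is arc length on curves.\<close>

definition hausdorff1_pre :: "real \<Rightarrow> (real^2) set \<Rightarrow> ennreal" where
  "hausdorff1_pre \<delta> A =
     (INF U \<in> {U :: nat \<Rightarrow> (real^2) set. A \<subseteq> (\<Union>i. U i) \<and> (\<forall>i. bounded (U i) \<and> diameter (U i) \<le> \<delta>)}.
        (\<Sum>i. ennreal (diameter (U i))))"

definition hausdorff1 :: "(real^2) measure" where
  "hausdorff1 = measure_of UNIV (sets borel) (\<lambda>A. SUP \<delta>\<in>{0<..}. hausdorff1_pre \<delta> A)"

definition boundary_measure :: "(real^2) set \<Rightarrow> (real^2) measure" where
  "boundary_measure \<Omega> = restrict_space hausdorff1 (frontier \<Omega>)"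

text \<open>\<open>\<xi>\<close> is the trace of \<open>q\<close> on the boundary: the trace operator is the continuous extension,
  from the H1-norm to the L2-norm on the boundary, of restriction of smooth functions.\<close>

definition is_trace :: "(real^2) set \<Rightarrow> scalar_field \<Rightarrow> scalar_field \<Rightarrow> bool" where
  "is_trace \<Omega> q \<xi> \<longleftrightarrow>
     q \<in> H1 \<Omega> \<and> \<xi> \<in> borel_measurable (boundary_measure \<Omega>) \<and>
     (\<exists>\<phi> D. (\<forall>n. smooth (\<phi> n) \<and> (\<forall>x. GDERIV (\<phi> n) x :> D n x)) \<and>
        (\<lambda>n. L2_norm \<Omega> (\<phi> n - q)) \<longlonglongrightarrow> 0 \<and>
        (\<lambda>n. L2_norm \<Omega> (D n - wgrad \<Omega> q)) \<longlonglongrightarrow> 0 \<and>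
        (\<lambda>n. \<integral>\<^sup>+x. ennreal ((\<phi> n x - \<xi> x)\<^sup>2) \<partial>boundary_measure \<Omega>) \<longlonglongrightarrow> 0)"

text \<open>\<open>H\<^sup>1\<^sup>/\<^sup>2\<close> of the boundary is the trace space of \<open>H\<^sup>1\<close> with its quotient norm, and
  \<open>H\<^sup>-\<^sup>1\<^sup>/\<^sup>2\<close> is its dual with the dual norm.\<close>

definition Hhalf :: "(real^2) set \<Rightarrow> scalar_field set" where
  "Hhalf \<Omega> = {\<xi>. \<exists>q. is_trace \<Omega> q \<xi>}"

definition Hhalf_norm :: "(real^2) set \<Rightarrow> scalar_field \<Rightarrow> real" where
  "Hhalf_norm \<Omega> \<xi> = (INF q \<in> {q. is_trace \<Omega> q \<xi>}. H1_norm \<Omega> q)"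

definition Hhalf_vec :: "(real^2) set \<Rightarrow> vector_field set" where
  "Hhalf_vec \<Omega> = {\<xi>. \<forall>i. (\<lambda>x. \<xi> x $ i) \<in> Hhalf \<Omega>}"

definition Hhalf_vec_norm :: "(real^2) set \<Rightarrow> vector_field \<Rightarrow> real" where
  "Hhalf_vec_norm \<Omega> \<xi> = sqrt (\<Sum>i\<in>UNIV. (Hhalf_norm \<Omega> (\<lambda>x. \<xi> x $ i))\<^sup>2)"

definition Hmhalf :: "(real^2) set \<Rightarrow> (scalar_field \<Rightarrow> real) set" where
  "Hmhalf \<Omega> = {\<rho>.
     (\<forall>\<xi>\<in>Hhalf \<Omega>. \<forall>\<zeta>\<in>Hhalf \<Omega>. \<forall>a b. \<rho> (\<lambda>x. a * \<xi> x + b * \<zeta> x) = a * \<rho> \<xi> + b * \<rho> \<zeta>) \<and>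
     (\<exists>C. \<forall>\<xi>\<in>Hhalf \<Omega>. \<bar>\<rho> \<xi>\<bar> \<le> C * Hhalf_norm \<Omega> \<xi>)}"

text \<open>Null elements contribute \<open>0\<close> to the supremum since division by zero yields zero.\<close>

definition Hmhalf_norm :: "(real^2) set \<Rightarrow> (scalar_field \<Rightarrow> real) \<Rightarrow> real" where
  "Hmhalf_norm \<Omega> \<rho> = (SUP \<xi>\<in>Hhalf \<Omega>. \<bar>\<rho> \<xi>\<bar> / Hhalf_norm \<Omega> \<xi>)"

text \<open>\<open>\<eta>\<close> is the normal trace \<open>\<tau>\<close>\<open>n\<close>, a pair of functionals on \<open>H\<^sup>1\<^sup>/\<^sup>2\<close>.  For a square-integrable
  tensor with square-integrable divergence it is the object defined by Green's formula; for
  tensors smooth up to the boundary it is integration against the product of the tensor with the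
  unit outward normal.\<close>

definition is_normal_trace ::
  "(real^2) set \<Rightarrow> tensor_field \<Rightarrow> (2 \<Rightarrow> scalar_field \<Rightarrow> real) \<Rightarrow> bool" where
  "is_normal_trace \<Omega> \<tau> \<eta> \<longleftrightarrow>
     (\<forall>i q \<xi>. is_trace \<Omega> q \<xi> \<longrightarrow>
        \<eta> i \<xi> = (LINT x|lebesgue_on \<Omega>. (\<tau> x $ i) \<bullet> wgrad \<Omega> q x)
               + (LINT x|lebesgue_on \<Omega>. (tdiv \<Omega> \<tau> x $ i) * q x))"

section \<open>The spaces of the continuous problem\<close>

definition space_X :: "(real^2) set \<Rightarrow> (tensor_field \<times> scalar_field) set" where
  "space_X \<Omega> = L2_sym \<Omega> \<times> H1 \<Omega>"

definition space_Y :: "(real^2) set \<Rightarrow> tensor_field set" where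
  "space_Y \<Omega> = {\<tau> \<in> L2_sym \<Omega>. \<exists>w\<in>L2 \<Omega>. is_tensor_div \<Omega> \<tau> w}"

definition space_Z :: "(real^2) set \<Rightarrow> vector_field set" where
  "space_Z \<Omega> = L2 \<Omega>"

definition norm_X :: "(real^2) set \<Rightarrow> tensor_field \<times> scalar_field \<Rightarrow> real" where
  "norm_X \<Omega> = (\<lambda>(e, q). sqrt ((L2_norm \<Omega> e)\<^sup>2 + (H1_norm \<Omega> q)\<^sup>2))"

definition norm_Y :: "(real^2) set \<Rightarrow> tensor_field \<Rightarrow> real" where
  "norm_Y \<Omega> \<tau> = sqrt ((L2_norm \<Omega> \<tau>)\<^sup>2 + (L2_norm \<Omega> (tdiv \<Omega> \<tau>))\<^sup>2)"

definition norm_Z :: "(real^2) set \<Rightarrow> vector_field \<Rightarrow> real" where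
  "norm_Z \<Omega> v = L2_norm \<Omega> v"

definition norm_XY ::
  "(real^2) set \<Rightarrow> (tensor_field \<times> scalar_field) \<times> tensor_field \<Rightarrow> real" where
  "norm_XY \<Omega> = (\<lambda>(\<epsilon>, \<tau>). sqrt ((norm_X \<Omega> \<epsilon>)\<^sup>2 + (norm_Y \<Omega> \<tau>)\<^sup>2))"

definition norm_XYZ ::
  "(real^2) set \<Rightarrow> ((tensor_field \<times> scalar_field) \<times> tensor_field) \<times> vector_field \<Rightarrow> real" where
  "norm_XYZ \<Omega> = (\<lambda>((\<epsilon>, \<tau>), v). sqrt ((norm_X \<Omega> \<epsilon>)\<^sup>2 + (norm_Y \<Omega> \<tau>)\<^sup>2 + (norm_Z \<Omega> v)\<^sup>2))"

definition ball_W ::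
  "(real^2) set \<Rightarrow> (tensor_field \<times> scalar_field) set \<Rightarrow> real \<Rightarrow> (tensor_field \<times> scalar_field) set"
  where "ball_W \<Omega> XX r = {\<epsilon> \<in> XX. norm_X \<Omega> \<epsilon> \<le> r}"

section \<open>Permeability, forms and functionals\<close>

type_synonym permeability_map = "tensor_field \<times> scalar_field \<Rightarrow> tensor_field"

definition permeability :: "(real^2) set \<Rightarrow> permeability_map \<Rightarrow> real \<Rightarrow> real \<Rightarrow> bool" where
  "permeability \<Omega> \<kappa> \<kappa>1 \<kappa>2 \<longleftrightarrow>
     (\<forall>\<epsilon>\<in>space_X \<Omega>. \<kappa> \<epsilon> \<in> Linf \<Omega> \<and>
        (AE x in lebesgue_on \<Omega>. \<forall>v. v \<noteq> 0 \<longrightarrow> \<kappa>1 * (norm v)\<^sup>2 \<le> v \<bullet> (\<kappa> \<epsilon> x *v v))) \<and>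
     (\<forall>d1\<in>L2_sym \<Omega>. \<forall>d2\<in>L2_sym \<Omega>. \<forall>p1\<in>H1 \<Omega>. \<forall>p2\<in>H1 \<Omega>.
        Linf_norm \<Omega> (\<kappa> (d1, p1) - \<kappa> (d2, p2)) \<le> ereal (\<kappa>2 * H1_norm \<Omega> (p1 - p2)))"

definition elasticity :: "real \<Rightarrow> real \<Rightarrow> real^2^2 \<Rightarrow> real^2^2" where
  "elasticity lam mu d = (lam * trace d) *\<^sub>R mat 1 + (2 * mu) *\<^sub>R d"

definition form_a ::
  "(real^2) set \<Rightarrow> permeability_map \<Rightarrow> real \<Rightarrow> real \<Rightarrow> real \<Rightarrow> real \<Rightarrow>
   tensor_field \<times> scalar_field \<Rightarrow> tensor_field \<times> scalar_field \<Rightarrow> real" where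
  "form_a \<Omega> \<kappa> lam mu \<alpha> c0 = (\<lambda>(d, p) (e, q).
     (LINT x|lebesgue_on \<Omega>. elasticity lam mu (d x) \<bullet> e x)
     + (LINT x|lebesgue_on \<Omega>. (\<kappa> (d, p) x *v wgrad \<Omega> p x) \<bullet> wgrad \<Omega> q x)
     + c0 * (LINT x|lebesgue_on \<Omega>. p x * q x)
     + \<alpha> * (LINT x|lebesgue_on \<Omega>. q x * trace (d x))
     - \<alpha> * (LINT x|lebesgue_on \<Omega>. p x * trace (e x)))"

definition form_b1 ::
  "(real^2) set \<Rightarrow> tensor_field \<times> scalar_field \<Rightarrow> tensor_field \<Rightarrow> real" where
  "form_b1 \<Omega> = (\<lambda>(e, q) \<tau>. - L2_inner \<Omega> \<tau> e)"

definition form_b2 ::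
  "(real^2) set \<Rightarrow> (tensor_field \<times> scalar_field) \<times> tensor_field \<Rightarrow> vector_field \<Rightarrow> real" where
  "form_b2 \<Omega> = (\<lambda>(\<epsilon>, \<tau>) v. - L2_inner \<Omega> v (tdiv \<Omega> \<tau>))"

text \<open>The boundary pairings in the functionals \<open>G\<close> and \<open>H\<close> involve the trace of \<open>q\<close> and the normal
  trace of \<open>\<tau>\<close>, which are relations above; so \<open>is_G \<dots> y\<close> reads ``\<open>G(e,q) = y\<close>'' and
  \<open>is_H \<dots> y\<close> reads ``\<open>H(\<tau>) = y\<close>''.  On a Lipschitz domain, trace
  theory gives exactly one such \<open>y\<close> for admissible arguments.\<close>

definition is_G ::
  "(real^2) set \<Rightarrow> scalar_field \<Rightarrow> (scalar_field \<Rightarrow> real) \<Rightarrow>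
   tensor_field \<times> scalar_field \<Rightarrow> real \<Rightarrow> bool" where
  "is_G \<Omega> g r\<Gamma> = (\<lambda>(e, q) y. \<exists>\<xi>. is_trace \<Omega> q \<xi> \<and> y = L2_inner \<Omega> g q + r\<Gamma> \<xi>)"

definition is_H :: "(real^2) set \<Rightarrow> vector_field \<Rightarrow> tensor_field \<Rightarrow> real \<Rightarrow> bool" where
  "is_H \<Omega> u\<Gamma> \<tau> y \<longleftrightarrow>
     (\<exists>\<eta>. is_normal_trace \<Omega> \<tau> \<eta> \<and> y = - (\<Sum>i\<in>UNIV. \<eta> i (\<lambda>x. u\<Gamma> x $ i)))"

definition form_F :: "(real^2) set \<Rightarrow> vector_field \<Rightarrow> vector_field \<Rightarrow> real" where
  "form_F \<Omega> f v = L2_inner \<Omega> f v"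

text \<open>The problem posed on the trial and test spaces \<open>XX\<close>, \<open>YY\<close>, \<open>ZZ\<close>, continuous or discrete.\<close>

definition solves_problem where
  "solves_problem \<Omega> \<kappa> lam mu \<alpha> c0 f g u\<Gamma> r\<Gamma> XX YY ZZ = (\<lambda>((\<delta>, \<sigma>), u).
     \<delta> \<in> XX \<and> \<sigma> \<in> YY \<and> u \<in> ZZ \<and>
     (\<forall>\<epsilon>\<in>XX. \<forall>\<tau>\<in>YY. \<forall>v\<in>ZZ.
        is_G \<Omega> g r\<Gamma> \<epsilon> (form_a \<Omega> \<kappa> lam mu \<alpha> c0 \<delta> \<epsilon> + form_b1 \<Omega> \<epsilon> \<sigma>) \<and>
        is_H \<Omega> u\<Gamma> \<tau> (form_b1 \<Omega> \<delta> \<tau> + form_b2 \<Omega> (\<epsilon>, \<tau>) u) \<and>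
        form_b2 \<Omega> (\<delta>, \<sigma>) v = form_F \<Omega> f v))"

text \<open>Uniqueness is in the space, that is, up to norm distance zero.\<close>

definition unique_solution_in_ball where
  "unique_solution_in_ball \<Omega> \<kappa> lam mu \<alpha> c0 f g u\<Gamma> r\<Gamma> XX YY ZZ r x \<longleftrightarrow>
     (let sol = (\<lambda>y. solves_problem \<Omega> \<kappa> lam mu \<alpha> c0 f g u\<Gamma> r\<Gamma> XX YY ZZ y \<and>
                     fst (fst y) \<in> ball_W \<Omega> XX r)
      in sol x \<and> (\<forall>y. sol y \<longrightarrow> norm_XYZ \<Omega> (x - y) = 0))"

section \<open>Discrete spaces\<close>

definition poly_deg_le :: "nat \<Rightarrow> scalar_field set" where
  "poly_deg_le l = {P. \<exists>c :: nat \<Rightarrow> nat \<Rightarrow> real. \<forall>x.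
     P x = (\<Sum>(i, j) \<in> {(i, j). i + j \<le> l}. c i j * (x $ 1) ^ i * (x $ 2) ^ j)}"

text \<open>All components of \<open>f\<close> coincide on \<open>K\<close> with polynomials of degree at most \<open>l\<close>.\<close>

definition poly_on :: "nat \<Rightarrow> (real^2) set \<Rightarrow> (real^2 \<Rightarrow> 'a::euclidean_space) \<Rightarrow> bool" where
  "poly_on l K f \<longleftrightarrow>
     (\<forall>b\<in>Basis. \<exists>P\<in>poly_deg_le l. AE x in lebesgue_on K. f x \<bullet> b = P x)"

text \<open>In \<open>space_X1h\<close> the divergence is taken triangle by triangle.\<close>

definition space_X1h :: "(real^2) set \<Rightarrow> (real^2) set set \<Rightarrow> nat \<Rightarrow> tensor_field set" where
  "space_X1h \<Omega> \<T> k = {e \<in> L2_sym \<Omega>.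
     \<forall>K\<in>\<T>. poly_on (k + 2) K e \<and> poly_on k K (tdiv (interior K) e)}"

definition space_X2h :: "(real^2) set \<Rightarrow> (real^2) set set \<Rightarrow> nat \<Rightarrow> scalar_field set" where
  "space_X2h \<Omega> \<T> k = {q. continuous_on (closure \<Omega>) q \<and> (\<forall>K\<in>\<T>. poly_on (k + 1) K q)}"

definition space_Xh ::
  "(real^2) set \<Rightarrow> (real^2) set set \<Rightarrow> nat \<Rightarrow> (tensor_field \<times> scalar_field) set" where
  "space_Xh \<Omega> \<T> k = space_X1h \<Omega> \<T> k \<times> space_X2h \<Omega> \<T> k"

definition space_Yh :: "(real^2) set \<Rightarrow> (real^2) set set \<Rightarrow> nat \<Rightarrow> tensor_field set" where
  "space_Yh \<Omega> \<T> k = {\<tau> \<in> space_Y \<Omega>.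
     \<forall>K\<in>\<T>. poly_on (k + 2) K \<tau> \<and> poly_on k K (tdiv \<Omega> \<tau>)}"

definition space_Zh :: "(real^2) set \<Rightarrow> (real^2) set set \<Rightarrow> nat \<Rightarrow> vector_field set" where
  "space_Zh \<Omega> \<T> k = {v \<in> L2 \<Omega>. \<forall>K\<in>\<T>. poly_on k K v}"

section \<open>Constants\<close>

definition inf_sup_b2 where
  "inf_sup_b2 \<Omega> XX YY ZZ \<beta> \<longleftrightarrow>
     (\<forall>v\<in>ZZ. \<beta> * norm_Z \<Omega> v \<le>
        (SUP w \<in> {w \<in> XX \<times> YY. norm_XY \<Omega> w \<noteq> 0}. form_b2 \<Omega> w v / norm_XY \<Omega> w))"

text \<open>The factors \<open>2\<close> in front of \<open>lam\<close> and \<open>\<alpha>\<close> are the space dimension.\<close>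

definition const_Ca :: "real \<Rightarrow> real \<Rightarrow> real \<Rightarrow> real \<Rightarrow> real \<Rightarrow> real \<Rightarrow> real" where
  "const_Ca lam mu \<alpha> c0 \<kappa>2 r = Max {2 * mu + 2 * lam, c0, 2 * \<alpha>, \<kappa>2 * r}"

definition const_ca :: "real \<Rightarrow> real \<Rightarrow> real \<Rightarrow> real" where
  "const_ca mu c0 \<kappa>1 = Min {\<kappa>1, 2 * mu, c0}"

definition const_gamma2 :: "real \<Rightarrow> real \<Rightarrow> real" where
  "const_gamma2 Ca ca = (Ca + 2) * (ca + 1 + Ca) / ca"

definition const_gamma1 :: "real \<Rightarrow> real \<Rightarrow> real \<Rightarrow> real" where
  "const_gamma1 Ca \<gamma>2 \<beta> = (Ca + 1 + \<beta> + \<gamma>2)\<^sup>2 / (\<beta>\<^sup>2 * \<gamma>2)"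

end

theory Submission
  imports Defs
begin

text \<open>
  The estimate is Cea's lemma for a saddle-point problem whose only nonlinearity is the permeability
  \<open>\<kappa>(d,p)\<close>.  Galerkin orthogonality holds up to the perturbation
  \<open>\<integral> (\<kappa>(d\<^sub>h,p\<^sub>h) - \<kappa>(d,p)) \<nabla>p \<cdot> \<nabla>q\<close>, whose size is at most
  \<open>\<kappa>\<^sub>2 \<parallel>p - p\<^sub>h\<parallel>\<^sub>1 \<parallel>\<nabla>p\<parallel> \<parallel>\<nabla>q\<parallel>\<close>.  It can be absorbed into the coercive part of the form once
  \<open>\<kappa>\<^sub>2 \<parallel>(d,p)\<parallel> \<le> c\<^sub>a / 2\<close>.  So there are two estimates to prove.

  The first is this bound on the solution.  The energy identity (\<open>energy_bound\<close>) bounds \<open>(d,p)\<close> by the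
  data, with constants depending on \<open>c\<^sub>a\<close>, \<open>C\<^sub>a\<close> and \<open>\<beta>\<^sub>2\<close>, and the smallness condition implies
  \<open>\<gamma>\<^sub>1\<^sup>2 \<kappa>\<^sub>2 D < 1\<close>.  Since \<open>\<beta>\<^sub>2 \<le> 1\<close> necessarily, \<open>\<gamma>\<^sub>1\<close> is so large compared with the constants of the
  energy estimate that the bound follows (\<open>smallness_arithmetic\<close>).

  The second is the error estimate (\<open>quasi_optimality\<close>).  Let \<open>E\<close> be the distance of the solution to an
  element of the discrete spaces and \<open>\<eta>\<close> the distance in strain and pressure of that element to the
  discrete solution.  The divergence of the discrete stress is a best approximation because
  \<open>div Y\<^sub>h \<subseteq> Z\<^sub>h\<close>.  The stress error is at most a multiple of \<open>E + \<eta>\<close> because \<open>Y\<^sub>h \<times> 0 \<subseteq> X\<^sub>h\<close> and because a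
  pure strain does not see the permeability (\<open>A_stress\<close>).  The displacement error is at most a multiple
  of \<open>E + \<eta>\<close> by the inf-sup condition.  Inserting these bounds into the coercivity estimate at the
  discrete permeability leaves a quadratic inequality for \<open>\<eta>\<close> in which, after absorption of the
  perturbation, every term except \<open>\<eta>\<^sup>2\<close> carries a factor \<open>E\<close>; hence \<open>\<eta> \<le> L E\<close>.  The constants involve an
  \<open>L\<^sup>\<infinity>\<close> bound of the permeability at the exact solution and the radius \<open>r\<close>, but no mesh.

  Weak gradients and divergences have to be linear for all this, which rests on the fundamental lemma
  of the calculus of variations (\<open>fundamental_lemma\<close>), proved with smooth bump functions.  On the
  discrete side, the inclusion of \<open>Y\<^sub>h\<close> in the strains compares the global divergence with the divergence
  on single triangles (\<open>space_Yh_subset_X1h\<close>); it uses that the interior of a triangle lies in the domain.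
\<close>

section \<open>Square-integrable fields\<close>

lemma L2_measurable: "f \<in> L2 \<Omega> \<Longrightarrow> f \<in> borel_measurable (lebesgue_on \<Omega>)"
  by (simp add: L2_def)

text \<open>Sums, continuous fields, linear images and products with bounded tensors are square integrable
  because such a field dominates them pointwise.\<close>

lemma L2_bounded_by:
  fixes f :: "real^2 \<Rightarrow> 'a::euclidean_space" and g :: "real^2 \<Rightarrow> 'b::euclidean_space"
  assumes f: "f \<in> borel_measurable (lebesgue_on \<Omega>)" and g: "g \<in> L2 \<Omega>"
    and bound: "AE x in lebesgue_on \<Omega>. norm (f x) \<le> C * norm (g x)"
  shows "f \<in> L2 \<Omega>" and "C \<ge> 0 \<Longrightarrow> L2_norm \<Omega> f \<le> C * L2_norm \<Omega> g"
proof -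
  have g2: "integrable (lebesgue_on \<Omega>) (\<lambda>x. C\<^sup>2 * (norm (g x))\<^sup>2)"
    using g by (simp add: L2_def)
  have le: "AE x in lebesgue_on \<Omega>. (norm (f x))\<^sup>2 \<le> C\<^sup>2 * (norm (g x))\<^sup>2"
    using bound by eventually_elim (metis norm_ge_zero power_mono power_mult_distrib)
  have int: "integrable (lebesgue_on \<Omega>) (\<lambda>x. (norm (f x))\<^sup>2)"
    by (rule Bochner_Integration.integrable_bound[OF g2]) (use f le in auto)
  then show "f \<in> L2 \<Omega>" using f by (simp add: L2_def)
  show "L2_norm \<Omega> f \<le> C * L2_norm \<Omega> g" if "C \<ge> 0"
  proof -
    have "(LINT x|lebesgue_on \<Omega>. (norm (f x))\<^sup>2) \<le> (LINT x|lebesgue_on \<Omega>. C\<^sup>2 * (norm (g x))\<^sup>2)"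
      by (rule integral_mono_AE[OF int g2 le])
    then have "L2_norm \<Omega> f \<le> sqrt (C\<^sup>2 * (LINT x|lebesgue_on \<Omega>. (norm (g x))\<^sup>2))"
      by (simp add: L2_norm_def)
    then show ?thesis
      using that by (simp add: L2_norm_def real_sqrt_mult)
  qed
qed

lemma integrable_L2_inner:
  assumes "f \<in> L2 \<Omega>" "g \<in> L2 \<Omega>"
  shows "integrable (lebesgue_on \<Omega>) (\<lambda>x. f x \<bullet> g x)"
proof (rule Bochner_Integration.integrable_bound)
  show "integrable (lebesgue_on \<Omega>) (\<lambda>x. (norm (f x))\<^sup>2 + (norm (g x))\<^sup>2)"
    using assms by (simp add: L2_def)
  show "(\<lambda>x. f x \<bullet> g x) \<in> borel_measurable (lebesgue_on \<Omega>)"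
    by (intro borel_measurable_inner L2_measurable assms)
  have "\<bar>f x \<bullet> g x\<bar> \<le> (norm (f x))\<^sup>2 + (norm (g x))\<^sup>2" for x
    using Cauchy_Schwarz_ineq2[of "f x" "g x"] sum_squares_bound[of "norm (f x)" "norm (g x)"]
      mult_nonneg_nonneg[of "norm (f x)" "norm (g x)"] by simp
  then show "AE x in lebesgue_on \<Omega>. norm (f x \<bullet> g x) \<le> norm ((norm (f x))\<^sup>2 + (norm (g x))\<^sup>2)"
    by simp
qed

lemma L2_add: 
  assumes f: "f \<in> L2 \<Omega>" and g: "g \<in> L2 \<Omega>"
  shows "(\<lambda>x. f x + g x) \<in> L2 \<Omega>"
proof -
  note [measurable] = L2_measurable[OF f] L2_measurable[OF g]
  have "(\<lambda>x. norm (f x) + norm (g x)) \<in> L2 \<Omega>"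
    using f g integrable_L2_inner[of "\<lambda>x. norm (f x)" \<Omega> "\<lambda>x. norm (g x)"]
    by (auto simp: L2_def power2_sum mult.assoc intro!: integrable_mult_right)
  then show ?thesis
  proof (rule L2_bounded_by(1)[where C=1, rotated])
    have "norm (f x + g x) \<le> 1 * norm (norm (f x) + norm (g x))" for x
      using norm_triangle_ineq[of "f x" "g x"] by simp
    then show "AE x in lebesgue_on \<Omega>. norm (f x + g x) \<le> 1 * norm (norm (f x) + norm (g x))"
      by simp
  qed measurable
qed

lemma L2_scale: "f \<in> L2 \<Omega> \<Longrightarrow> (\<lambda>x. c *\<^sub>R f x) \<in> L2 \<Omega>"
  by (rule L2_bounded_by(1)[where C="\<bar>c\<bar>"]) (auto simp: L2_def)

lemma L2_diff: "f \<in> L2 \<Omega> \<Longrightarrow> g \<in> L2 \<Omega> \<Longrightarrow> f - g \<in> L2 \<Omega>"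
  using L2_add[OF _ L2_scale[of g \<Omega> "-1"], of f] by (simp add: fun_diff_def)

lemma L2_zero: "(\<lambda>x. 0) \<in> L2 \<Omega>"
  by (simp add: L2_def)

lemma L2_inner_commute: "L2_inner \<Omega> f g = L2_inner \<Omega> g f"
  by (simp add: L2_inner_def inner_commute)

lemma L2_inner_diff_left:
  "f \<in> L2 \<Omega> \<Longrightarrow> g \<in> L2 \<Omega> \<Longrightarrow> h \<in> L2 \<Omega> \<Longrightarrow>
    L2_inner \<Omega> (f - g) h = L2_inner \<Omega> f h - L2_inner \<Omega> g h"
  by (simp add: L2_inner_def inner_diff_left integrable_L2_inner)

lemma L2_inner_add_left:
  "f \<in> L2 \<Omega> \<Longrightarrow> g \<in> L2 \<Omega> \<Longrightarrow> h \<in> L2 \<Omega> \<Longrightarrow>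
    L2_inner \<Omega> (\<lambda>x. f x + g x) h = L2_inner \<Omega> f h + L2_inner \<Omega> g h"
  by (simp add: L2_inner_def inner_add_left integrable_L2_inner)

lemma L2_inner_diff_right:
  "f \<in> L2 \<Omega> \<Longrightarrow> g \<in> L2 \<Omega> \<Longrightarrow> h \<in> L2 \<Omega> \<Longrightarrow>
    L2_inner \<Omega> h (f - g) = L2_inner \<Omega> h f - L2_inner \<Omega> h g"
  by (simp add: L2_inner_def inner_diff_right integrable_L2_inner)

lemma L2_inner_scale: "L2_inner \<Omega> (\<lambda>x. c *\<^sub>R f x) g = c * L2_inner \<Omega> f g"
  by (simp add: L2_inner_def)

lemma L2_inner_self: "L2_inner \<Omega> f f = (L2_norm \<Omega> f)\<^sup>2"
  by (simp add: L2_inner_def L2_norm_def power2_norm_eq_inner[symmetric])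

lemma L2_norm_nonneg: "L2_norm \<Omega> f \<ge> 0"
  by (simp add: L2_norm_def)

lemma L2_inner_cong_AE:
  assumes "f \<in> L2 \<Omega>" "f' \<in> L2 \<Omega>" "g \<in> L2 \<Omega>" "AE x in lebesgue_on \<Omega>. f x = f' x"
  shows "L2_inner \<Omega> f g = L2_inner \<Omega> f' g"
  unfolding L2_inner_def
proof (rule integral_cong_AE)
  show "AE x in lebesgue_on \<Omega>. f x \<bullet> g x = f' x \<bullet> g x"
    using assms(4) by eventually_elim simp
qed (intro borel_measurable_inner L2_measurable assms(1-3))+

lemma L2_norm_cong_AE:
  assumes "f \<in> L2 \<Omega>" "f' \<in> L2 \<Omega>" "AE x in lebesgue_on \<Omega>. f x = f' x"
  shows "L2_norm \<Omega> f = L2_norm \<Omega> f'"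
proof -
  have "(L2_norm \<Omega> f)\<^sup>2 = (L2_norm \<Omega> f')\<^sup>2"
    using L2_inner_cong_AE[OF assms(1,2,1,3)] L2_inner_cong_AE[OF assms(1,2,2,3)]
    by (simp add: L2_inner_self[symmetric] L2_inner_commute[of \<Omega> f' f])
  then show ?thesis by (simp add: L2_norm_nonneg power2_eq_iff_nonneg)
qed

lemma L2_inner_Cauchy_Schwarz:
  assumes f: "f \<in> L2 \<Omega>" and g: "g \<in> L2 \<Omega>"
  shows "\<bar>L2_inner \<Omega> f g\<bar> \<le> L2_norm \<Omega> f * L2_norm \<Omega> g"
proof -
  define a where "a = L2_norm \<Omega> f"
  define b where "b = L2_norm \<Omega> g"
  have a: "a \<ge> 0" "b \<ge> 0" by (auto simp: a_def b_def L2_norm_nonneg)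
  \<comment> \<open>The quadratic polynomial \<open>t \<mapsto> \<parallel>f - t g\<parallel>\<^sup>2\<close> is nonnegative.\<close>
  have "0 \<le> a\<^sup>2 - 2 * t * L2_inner \<Omega> f g + t\<^sup>2 * b\<^sup>2" for t
  proof -
    let ?h = "f - (\<lambda>x. t *\<^sub>R g x)"
    have tg: "(\<lambda>x. t *\<^sub>R g x) \<in> L2 \<Omega>" by (rule L2_scale[OF g])
    have h: "?h \<in> L2 \<Omega>" by (rule L2_diff[OF f tg])
    have "(L2_norm \<Omega> ?h)\<^sup>2 = L2_inner \<Omega> f ?h - t * L2_inner \<Omega> g ?h"
      unfolding L2_inner_self[symmetric] by (subst L2_inner_diff_left[OF f tg h]) (simp add: L2_inner_scale)
    also have "\<dots> = a\<^sup>2 - 2 * t * L2_inner \<Omega> f g + t\<^sup>2 * b\<^sup>2"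
      using L2_inner_scale[of \<Omega> t g f] L2_inner_scale[of \<Omega> t g g]
      by (simp add: L2_inner_diff_right f g tg L2_inner_commute[of _ _ "\<lambda>x. t *\<^sub>R g x"]
          L2_inner_commute[of _ g f] L2_inner_self a_def b_def algebra_simps power2_eq_square)
    finally show ?thesis by (metis zero_le_power2)
  qed
  note q = this
  have "(L2_inner \<Omega> f g)\<^sup>2 \<le> a\<^sup>2 * b\<^sup>2"
  proof (cases "b = 0")
    case True
    have "L2_inner \<Omega> f g = 0"
    proof (rule ccontr)
      assume n: "L2_inner \<Omega> f g \<noteq> 0"
      show False using q[of "(a\<^sup>2 + 1) / (2 * L2_inner \<Omega> f g)"] True n by (simp add: field_simps)
    qed
    then show ?thesis by simp
  next
    case False
    then have "0 < b\<^sup>2" by simp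
    with False show ?thesis using q[of "L2_inner \<Omega> f g / b\<^sup>2"]
      by (simp add: field_simps power2_eq_square zero_le_divide_iff mult_less_0_iff)
  qed
  then show ?thesis
    unfolding a_def[symmetric] b_def[symmetric] using a
    by (intro abs_le_square_iff[THEN iffD2, of _ "a * b", simplified abs_of_nonneg[OF mult_nonneg_nonneg[OF a]]])
      (simp add: power_mult_distrib)
qed

lemma L2_inner_le: "f \<in> L2 \<Omega> \<Longrightarrow> g \<in> L2 \<Omega> \<Longrightarrow> L2_inner \<Omega> f g \<le> L2_norm \<Omega> f * L2_norm \<Omega> g"
  using L2_inner_Cauchy_Schwarz by fastforce

lemma L2_norm_triangle:
  assumes f: "f \<in> L2 \<Omega>" and g: "g \<in> L2 \<Omega>"
  shows "L2_norm \<Omega> (\<lambda>x. f x + g x) \<le> L2_norm \<Omega> f + L2_norm \<Omega> g"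
proof -
  let ?s = "\<lambda>x. f x + g x"
  have fg: "?s \<in> L2 \<Omega>" by (rule L2_add[OF f g])
  have "(L2_norm \<Omega> ?s)\<^sup>2 = L2_inner \<Omega> f ?s + L2_inner \<Omega> g ?s"
    unfolding L2_inner_self[symmetric] by (rule L2_inner_add_left[OF f g fg])
  also have "\<dots> \<le> (L2_norm \<Omega> f + L2_norm \<Omega> g) * L2_norm \<Omega> ?s"
    using L2_inner_le[OF f fg] L2_inner_le[OF g fg] by (simp add: algebra_simps)
  finally show ?thesis
    using L2_norm_nonneg[of \<Omega> ?s] L2_norm_nonneg[of \<Omega> f] L2_norm_nonneg[of \<Omega> g]
    by (cases "L2_norm \<Omega> ?s = 0") (auto simp: power2_eq_square)
qed

lemma L2_norm_diff_commute: "L2_norm \<Omega> (f - g) = L2_norm \<Omega> (g - f)"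
  by (simp add: L2_norm_def norm_minus_commute)

lemma L2_norm_triangle_sub:
  assumes "f \<in> L2 \<Omega>" "g \<in> L2 \<Omega>" "h \<in> L2 \<Omega>"
  shows "L2_norm \<Omega> (f - h) \<le> L2_norm \<Omega> (f - g) + L2_norm \<Omega> (g - h)"
  using L2_norm_triangle[OF L2_diff[OF assms(1,2)] L2_diff[OF assms(2,3)]]
  by (simp add: fun_diff_def)

lemma L2_norm_zero: "L2_norm \<Omega> (\<lambda>x. 0) = 0"
  by (simp add: L2_norm_def)

lemma L2_norm_AE_zero: "AE x in lebesgue_on \<Omega>. f x = 0 \<Longrightarrow> f \<in> L2 \<Omega> \<Longrightarrow> L2_norm \<Omega> f = 0"
  using L2_norm_cong_AE[of f \<Omega> "\<lambda>x. 0"] by (simp add: L2_zero L2_norm_zero)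

lemma L2_bounded_linear:
  fixes T :: "'a::euclidean_space \<Rightarrow> 'b::euclidean_space"
  assumes T: "bounded_linear T" "\<And>x. norm (T x) \<le> C * norm x" "C \<ge> 0" and f: "f \<in> L2 \<Omega>"
  shows "(\<lambda>x. T (f x)) \<in> L2 \<Omega>" "L2_norm \<Omega> (\<lambda>x. T (f x)) \<le> C * L2_norm \<Omega> f"
proof -
  have "(\<lambda>x. T (f x)) \<in> borel_measurable (lebesgue_on \<Omega>)"
    using f by (intro borel_measurable_continuous_on[of T] L2_measurable
        linear_continuous_on[OF T(1)])
  from L2_bounded_by[OF this f, of C]
  show "(\<lambda>x. T (f x)) \<in> L2 \<Omega>" "L2_norm \<Omega> (\<lambda>x. T (f x)) \<le> C * L2_norm \<Omega> f"
    using T by auto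
qed

lemma L2_component: "f \<in> L2 \<Omega> \<Longrightarrow> (\<lambda>x. f x $ i) \<in> L2 \<Omega>"
  "f \<in> L2 \<Omega> \<Longrightarrow> L2_norm \<Omega> (\<lambda>x. f x $ i) \<le> L2_norm \<Omega> f"
  using L2_bounded_linear[of "\<lambda>x. x $ i" 1 f \<Omega>] Finite_Cartesian_Product.norm_nth_le
  by (auto simp: bounded_linear_vec_nth)

lemma lmeasurable_open_bounded: "open \<Omega> \<Longrightarrow> bounded \<Omega> \<Longrightarrow> (\<Omega> :: (real^2) set) \<in> lmeasurable"
  using lmeasurable_open by blast

lemma L2_continuous:
  fixes f :: "real^2 \<Rightarrow> 'a::euclidean_space"
  assumes \<Omega>: "open \<Omega>" "bounded \<Omega>" and f: "continuous_on UNIV f"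
  shows "f \<in> L2 \<Omega>"
proof -
  have "compact (f ` closure \<Omega>)"
    using \<Omega> f by (intro compact_continuous_image) (auto intro: continuous_on_subset)
  then obtain B where B: "\<And>x. x \<in> closure \<Omega> \<Longrightarrow> norm (f x) \<le> B"
    using compact_imp_bounded bounded_iff by (metis imageI)
  have meas: "f \<in> borel_measurable (lebesgue_on \<Omega>)"
    using f fmeasurableD[OF lmeasurable_open_bounded[OF \<Omega>]]
    by (auto intro!: continuous_imp_measurable_on_sets_lebesgue intro: continuous_on_subset)
  have c: "(\<lambda>x. 1::real) \<in> L2 \<Omega>"
    using finite_measure.integrable_const[OF finite_measure_lebesgue_on[OF lmeasurable_open_bounded[OF \<Omega>]]]
    by (simp add: L2_def)
  show ?thesis
  proof (rule L2_bounded_by(1)[OF meas c, of B])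
    show "AE x in lebesgue_on \<Omega>. norm (f x) \<le> B * norm (1::real)"
      using B closure_subset \<Omega> by (intro AE_I2) (auto simp: space_restrict_space)
  qed
qed

section \<open>Smooth bump functions\<close>

lemma Ck_Suc_imp: "Ck (Suc m) \<phi> \<Longrightarrow> Ck m \<phi>"
proof (induction m arbitrary: \<phi>)
  case 0
  then show ?case
    by (auto simp: gderiv_def continuous_on_eq_continuous_at intro: has_derivative_continuous)
next
  case (Suc m)
  then show ?case by (metis Ck.simps(2))
qed

lemma smooth_continuous: "smooth \<phi> \<Longrightarrow> continuous_on UNIV \<phi>"
  unfolding smooth_def using Ck.simps(1) by blast

lemma Ck_const: "Ck m (\<lambda>x. c)"
proof (induction m arbitrary: c)
  case (Suc m)
  show ?case
    using Suc[of 0] by (auto intro!: exI[of _ "\<lambda>x. 0"] GDERIV_const)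
qed simp

lemma Ck_add: "Ck m f \<Longrightarrow> Ck m g \<Longrightarrow> Ck m (\<lambda>x. f x + g x)"
proof (induction m arbitrary: f g)
  case 0
  then show ?case by (auto intro: continuous_on_add)
next
  case (Suc m)
  then obtain D E where D: "\<And>x. GDERIV f x :> D x" "\<And>i. Ck m (\<lambda>x. D x $ i)"
    and E: "\<And>x. GDERIV g x :> E x" "\<And>i. Ck m (\<lambda>x. E x $ i)"
    by auto
  then show ?case
    using Suc.IH by (auto intro!: exI[of _ "\<lambda>x. D x + E x"] GDERIV_add)
qed

lemma Ck_mult: "Ck m f \<Longrightarrow> Ck m g \<Longrightarrow> Ck m (\<lambda>x. f x * g x)"
proof (induction m arbitrary: f g)
  case 0
  then show ?case by (auto intro: continuous_on_mult)
next
  case (Suc m)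
  then obtain D E where D: "\<And>x. GDERIV f x :> D x" "\<And>i. Ck m (\<lambda>x. D x $ i)"
    and E: "\<And>x. GDERIV g x :> E x" "\<And>i. Ck m (\<lambda>x. E x $ i)"
    by auto
  have "Ck m f" "Ck m g" using Suc.prems Ck_Suc_imp by blast+
  then have "Ck m (\<lambda>x. f x * E x $ i + g x * D x $ i)" for i
    using D E by (intro Ck_add Suc.IH)
  then show ?case
    using D E by (auto intro!: exI[of _ "\<lambda>x. f x *\<^sub>R E x + g x *\<^sub>R D x"] GDERIV_mult)
qed

lemma Ck_prod:
  assumes "\<And>i. i \<in> I \<Longrightarrow> Ck m (f i)"
  shows "Ck m (\<lambda>x. \<Prod>i\<in>I. f i x)"
  using assms
proof (induction I rule: infinite_finite_induct)
  case (insert i I)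
  then show ?case by (simp add: Ck_mult)
qed (simp_all add: Ck_const)

text \<open>The class of functions \<open>P(1/t) e\<^sup>-\<^sup>1\<^sup>/\<^sup>t\<close>, continued by zero to \<open>t \<le> 0\<close>, is closed under
  differentiation, which makes all of them smooth.\<close>

definition flat :: "real poly \<Rightarrow> real \<Rightarrow> real" where
  "flat P t = (if t \<le> 0 then 0 else poly P (1 / t) * exp (- 1 / t))"

lemma poly_times_exp_minus_tendsto_0: "((\<lambda>y::real. poly P y * exp (- y)) \<longlongrightarrow> 0) at_top"
proof -
  have "((\<lambda>y. \<Sum>i\<le>degree P. coeff P i * (y ^ i / exp y)) \<longlongrightarrow> (\<Sum>i\<le>degree P. coeff P i * 0)) at_top"
    by (intro tendsto_sum tendsto_mult tendsto_const tendsto_power_div_exp_0)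
  then show ?thesis
    by (simp add: poly_altdef sum_divide_distrib exp_minus divide_inverse sum_distrib_right mult.assoc)
qed

lemma flat_DERIV: "DERIV (flat P) t :> flat ([:0, 0, 1:] * (P - pderiv P)) t"
proof -
  consider "t < 0" | "t = 0" | "t > 0" by linarith
  then show ?thesis
  proof cases
    case 1
    have "DERIV (\<lambda>t. 0::real) t :> 0" by simp
    then have "DERIV (flat P) t :> 0"
      by (rule has_field_derivative_transform_within_open[of _ _ _ "{..<0}"]) (use 1 in \<open>auto simp: flat_def\<close>)
    then show ?thesis using 1 by (simp add: flat_def)
  next
    case 2
    have "((\<lambda>h. flat P h / h) \<longlongrightarrow> 0) (at_right 0)"
    proof -
      have "((\<lambda>h. poly (pCons 0 P) (inverse h) * exp (- inverse h)) \<longlongrightarrow> 0) (at_right (0::real))"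
        by (rule filterlim_compose[OF poly_times_exp_minus_tendsto_0 filterlim_inverse_at_top_right])
      then show ?thesis
        by (rule Lim_transform_eventually)
          (auto simp: flat_def eventually_at_filter field_simps)
    qed
    moreover have "((\<lambda>h. flat P h / h) \<longlongrightarrow> 0) (at_left 0)"
      by (rule Lim_transform_eventually[OF tendsto_const]) (auto simp: flat_def eventually_at_filter)
    ultimately have "((\<lambda>h. flat P h / h) \<longlongrightarrow> 0) (at 0)"
      by (simp add: filterlim_at_split)
    then show ?thesis
      using 2 by (simp add: DERIV_def flat_def)
  next
    case 3
    have "DERIV (\<lambda>t. poly P (1 / t) * exp (- 1 / t)) t :>
        poly ([:0, 0, 1:] * (P - pderiv P)) (1 / t) * exp (- 1 / t)"
      using 3 by (auto intro!: derivative_eq_intros DERIV_chain2[OF poly_DERIV] simp: field_simps power2_eq_square)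
    then have "DERIV (flat P) t :> poly ([:0, 0, 1:] * (P - pderiv P)) (1 / t) * exp (- 1 / t)"
      by (rule has_field_derivative_transform_within_open[of _ _ _ "{0<..}"]) (use 3 in \<open>auto simp: flat_def\<close>)
    then show ?thesis using 3 by (simp add: flat_def)
  qed
qed

lemma Ck_flat_affine: "Ck m (\<lambda>x::real^2. flat P (c * x $ i + d))"
proof (induction m arbitrary: P)
  case 0
  have "continuous_on UNIV (flat P)"
    by (meson flat_DERIV DERIV_isCont continuous_at_imp_continuous_on)
  then show ?case
    by (auto intro!: continuous_intros continuous_on_compose2[of UNIV "flat P"])
next
  case (Suc m)
  let ?Q = "[:0, 0, 1:] * (P - pderiv P)"
  have "GDERIV (\<lambda>x::real^2. c * x $ i + d) x :> c *\<^sub>R axis i 1" for x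
    unfolding gderiv_def
    using bounded_linear_imp_has_derivative[OF bounded_linear_vec_nth[of i], of "at x"]
    by (auto intro!: derivative_eq_intros simp: inner_axis)
  note GDERIV_DERIV_compose[OF this flat_DERIV[of P]]
  moreover have "Ck m (\<lambda>x. (flat ?Q (c * x $ i + d) *\<^sub>R c *\<^sub>R axis i 1 :: real^2) $ j)" for j
    using Ck_mult[OF Suc.IH[of ?Q] Ck_const[of m "c * (axis i 1 :: real^2) $ j"]] by (simp add: mult.assoc)
  ultimately show ?case
    unfolding Ck.simps
    by (intro exI[of _ "\<lambda>x. flat ?Q (c * x $ i + d) *\<^sub>R c *\<^sub>R axis i 1"] conjI allI)
qed

lemma flat_1_bounds: "0 \<le> flat 1 t" "flat 1 t \<le> 1"
  by (auto simp: flat_def)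

lemma flat_1_tendsto_1: "filterlim f at_top F \<Longrightarrow> ((\<lambda>n. flat 1 (f n)) \<longlongrightarrow> 1) F"
proof (rule filterlim_compose[of "flat 1"])
  have "((\<lambda>t. exp (- inverse t)) \<longlongrightarrow> exp (- 0)) (at_top :: real filter)"
    by (intro tendsto_intros tendsto_inverse_0_at_top filterlim_ident)
  then have "((\<lambda>t. exp (- inverse t)) \<longlongrightarrow> 1) (at_top :: real filter)" by simp
  then show "(flat 1 \<longlongrightarrow> 1) at_top"
    by (rule Lim_transform_eventually)
      (use eventually_gt_at_top[of 0] in eventually_elim, simp add: flat_def divide_inverse)
qed

definition box_bump :: "real^2 \<Rightarrow> real^2 \<Rightarrow> nat \<Rightarrow> real^2 \<Rightarrow> real" where
  "box_bump a b n x = (\<Prod>i\<in>UNIV. flat 1 (real n * (x $ i - a $ i)) * flat 1 (real n * (b $ i - x $ i)))"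

lemma test_function_box_bump:
  assumes "cbox a b \<subseteq> \<Omega>" shows "test_function \<Omega> (box_bump a b n)"
proof -
  have "Ck m (\<lambda>x. flat 1 (real n * (x $ i - a $ i)) * flat 1 (real n * (b $ i - x $ i)))" for m i
    using Ck_mult[OF Ck_flat_affine[of m 1 "real n" i "- real n * a $ i"]
        Ck_flat_affine[of m 1 "- real n" i "real n * b $ i"]]
    by (simp add: algebra_simps)
  then have "smooth (box_bump a b n)"
    unfolding smooth_def box_bump_def[abs_def] by (intro allI Ck_prod)
  moreover have "box_bump a b n x = 0" if "x \<notin> cbox a b" for x
  proof -
    obtain i where "x $ i < a $ i \<or> b $ i < x $ i"
      using \<open>x \<notin> cbox a b\<close> by (auto simp: mem_box_cart not_le)
    then have "real n * (x $ i - a $ i) \<le> 0 \<or> real n * (b $ i - x $ i) \<le> 0"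
      by (auto simp: mult_le_0_iff)
    then show ?thesis
      unfolding box_bump_def by (intro prod_zero bexI[of _ i]) (auto simp: flat_def)
  qed
  ultimately show ?thesis
    unfolding test_function_def using assms
    by (intro conjI exI[of _ "cbox a b"]) (auto simp del: mem_box_cart)
qed

lemma box_bump_bounds: "0 \<le> box_bump a b n x" "box_bump a b n x \<le> 1"
  unfolding box_bump_def
  by (auto intro!: prod_nonneg prod_le_1 mult_nonneg_nonneg mult_le_one flat_1_bounds)

lemma box_bump_tendsto: "(\<lambda>n. box_bump a b n x) \<longlonglongrightarrow> indicator (box a b) x"
proof (cases "x \<in> box a b")
  case True
  have lim: "(\<lambda>n. flat 1 (real n * c)) \<longlonglongrightarrow> 1" if "c > 0" for c
    by (intro flat_1_tendsto_1 filterlim_at_top_mult_tendsto_pos[OF tendsto_const that]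
        filterlim_real_sequentially)
  have "(\<lambda>n. box_bump a b n x) \<longlonglongrightarrow> (\<Prod>i\<in>(UNIV::2 set). 1 * 1)"
    unfolding box_bump_def using True
    by (intro tendsto_prod tendsto_mult lim) (auto simp: mem_box_cart)
  with True show ?thesis by simp
next
  case False
  then obtain i where "x $ i \<le> a $ i \<or> b $ i \<le> x $ i"
    by (auto simp: mem_box_cart not_less)
  then have "real n * (x $ i - a $ i) \<le> 0 \<or> real n * (b $ i - x $ i) \<le> 0" for n
    by (auto simp: mult_le_0_iff)
  then have "box_bump a b n x = 0" for n
    unfolding box_bump_def by (intro prod_zero bexI[of _ i]) (auto simp: flat_def)
  then show ?thesis using False by simp
qed

section \<open>The fundamental lemma of the calculus of variations\<close>

text \<open>Integrals over boxes determine the integrals over all Borel sets by Dynkin's lemma, and hence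
  over all Lebesgue sets.\<close>

lemma AE_zero_on_box:
  fixes F :: "real^2 \<Rightarrow> real"
  assumes F: "integrable lebesgue F"
    and box: "\<And>c d. box c d \<subseteq> box a b \<Longrightarrow> (LINT x:box c d|lebesgue. F x) = 0"
  shows "AE x in lebesgue. x \<in> box a b \<longrightarrow> F x = 0"
proof -
  define G where "G = (\<lambda>x. indicator (box a b) x *\<^sub>R F x)"
  have G: "integrable lebesgue G"
    unfolding G_def by (rule integrable_mult_indicator[OF _ F]) simp
  have setG: "set_integrable lebesgue A G" if "A \<in> sets lebesgue" for A
    unfolding set_integrable_def by (rule integrable_mult_indicator[OF that G])
  then have measG: "set_borel_measurable lebesgue A G" if "A \<in> sets lebesgue" for A
    using that unfolding set_integrable_def set_borel_measurable_def
    by (blast intro: borel_measurable_integrable)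
  have GF: "(LINT x:A|lebesgue. G x) = (LINT x:A \<inter> box a b|lebesgue. F x)" for A
    by (simp add: set_lebesgue_integral_def G_def indicator_inter_arith mult.assoc)
  have borel: "(LINT x:A|lebesgue. G x) = 0" if A: "A \<in> sets borel" for A
  proof -
    have "Int_stable (range (\<lambda>(a, b). box a b :: (real^2) set))"
      by (auto simp: Int_stable_def box_Int_box)
    moreover have "range (\<lambda>(a, b). box a b :: (real^2) set) \<subseteq> Pow UNIV" by auto
    moreover have "A \<in> sigma_sets UNIV (range (\<lambda>(a, b). box a b))"
      using A unfolding borel_eq_box by simp
    ultimately show ?thesis
    proof (induction rule: sigma_sets_induct_disjoint)
      case (basic A)
      then obtain c d where "A = box c d" by auto
      then obtain c' d' where e: "A \<inter> box a b = box c' d'"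
        by (simp add: box_Int_box)
      show ?case
        unfolding GF e by (rule box) (use e in auto)
    next
      case empty
      then show ?case by (simp add: set_lebesgue_integral_def)
    next
      case (compl A)
      then have A: "A \<in> sets lebesgue" by (simp add: borel_eq_box)
      have "(LINT x:A \<union> (UNIV - A)|lebesgue. G x) = (LINT x:A|lebesgue. G x) + (LINT x:UNIV - A|lebesgue. G x)"
        by (rule set_integral_Un) (use A in \<open>auto intro!: setG\<close>)
      moreover have "(LINT x:UNIV|lebesgue. G x) = 0"
        unfolding GF using box[of a b] by simp
      ultimately show ?case using compl by simp
    next
      case (union A)
      then have "A i \<in> sets borel" for i
        by (auto simp: borel_eq_box)
      then have A: "A i \<in> sets lebesgue" for i by simp
      then have "(LINT x:(\<Union>i. A i)|lebesgue. G x) = (\<Sum>i. LINT x:A i|lebesgue. G x)"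
        using union by (intro lebesgue_integral_countable_add setG) (auto simp: disjoint_family_on_def)
      then show ?case using union by simp
    qed
  qed
  have "AE x in lebesgue. G x = 0"
  proof (rule density_unique_real[OF G integrable_zero])
    fix A :: "(real^2) set"
    assume A: "A \<in> sets lebesgue"
    then obtain S N N' where N: "A = S \<union> N" "N \<subseteq> N'" "N' \<in> null_sets lborel" "S \<in> sets borel"
      by (auto elim: sets_completionE)
    have "AE x in lebesgue. x \<notin> N'"
      using N(3) by (intro AE_not_in null_sets_completionI)
    then have "AE x in lebesgue. x \<in> A \<longleftrightarrow> x \<in> S"
      by eventually_elim (use N in auto)
    then have "(LINT x:A|lebesgue. G x) = (LINT x:S|lebesgue. G x)"
      using A N(4) by (intro set_integral_cong_set measG) auto
    then show "(LINT x:A|lebesgue. G x) = (LINT x:A|lebesgue. 0)"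
      using borel N(4) by (simp add: set_lebesgue_integral_def)
  qed
  then show ?thesis
    by eventually_elim (auto simp: G_def)
qed

text \<open>Bump functions of a box converge boundedly to its indicator, so the integral over every closed box
  in the domain vanishes; countably many boxes exhaust the domain.\<close>

lemma fundamental_lemma:
  fixes f :: "real^2 \<Rightarrow> real"
  assumes \<Omega>: "open \<Omega>" and f: "integrable (lebesgue_on \<Omega>) f"
    and zero: "\<And>\<phi>. test_function \<Omega> \<phi> \<Longrightarrow> (LINT x|lebesgue_on \<Omega>. \<phi> x * f x) = 0"
  shows "AE x in lebesgue_on \<Omega>. f x = 0"
proof -
  define F where "F = (\<lambda>x. indicator \<Omega> x *\<^sub>R f x)"
  have \<Omega>s: "\<Omega> \<inter> space lebesgue \<in> sets lebesgue" using \<Omega> by simp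
  have F: "integrable lebesgue F"
    using f unfolding F_def integrable_restrict_space[OF \<Omega>s] .
  have box: "(LINT x:box c d|lebesgue. F x) = 0" if "cbox c d \<subseteq> \<Omega>" for c d
  proof -
    have "(\<lambda>n. LINT x|lebesgue. box_bump c d n x * F x) \<longlonglongrightarrow> (LINT x|lebesgue. indicator (box c d) x * F x)"
    proof (rule integral_dominated_convergence[where w="\<lambda>x. norm (F x)"])
      show "(\<lambda>x. indicator (box c d) x * F x) \<in> borel_measurable lebesgue"
        using F by (intro borel_measurable_times borel_measurable_indicator) auto
      have "continuous_on UNIV (box_bump c d n)" for n
        using test_function_box_bump[OF that] by (simp add: test_function_def smooth_continuous)
      then have "box_bump c d n \<in> borel_measurable lebesgue" for n
        by (intro measurable_completion) (simp add: borel_measurable_continuous_onI)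
      then show "(\<lambda>x. box_bump c d n x * F x) \<in> borel_measurable lebesgue" for n
        using F by (intro borel_measurable_times) auto
      show "AE x in lebesgue. (\<lambda>n. box_bump c d n x * F x) \<longlonglongrightarrow> indicator (box c d) x * F x"
        by (intro AE_I2 tendsto_mult box_bump_tendsto tendsto_const)
      show "AE x in lebesgue. norm (box_bump c d n x * F x) \<le> norm (F x)" for n
        using box_bump_bounds[of c d n] by (intro AE_I2) (auto simp: abs_mult mult_left_le_one_le)
    qed (use F in auto)
    moreover have "(LINT x|lebesgue. box_bump c d n x * F x) = 0" for n
      using zero[OF test_function_box_bump[OF that, of n]]
      unfolding integral_restrict_space[OF \<Omega>s] F_def by (simp add: mult.left_commute)
    ultimately show ?thesis
      by (simp add: set_lebesgue_integral_def LIMSEQ_const_iff)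
  qed
  obtain \<D> where D: "countable \<D>" "\<D> \<subseteq> Pow \<Omega>" "\<And>X. X \<in> \<D> \<Longrightarrow> \<exists>a b. X = cbox a b" "\<Union>\<D> = \<Omega>"
    using open_countable_Union_open_cbox[OF \<Omega>] by metis
  have "AE x in lebesgue. x \<in> X \<longrightarrow> F x = 0" if X: "X \<in> \<D>" for X
  proof -
    obtain a b where ab: "X = cbox a b" "cbox a b \<subseteq> \<Omega>" using D X by blast
    have "AE x in lebesgue. x \<in> box a b \<longrightarrow> F x = 0"
    proof (rule AE_zero_on_box[OF F])
      fix c d assume cd: "box c d \<subseteq> box a b"
      show "(LINT x:box c d|lebesgue. F x) = 0"
      proof (cases "box c d = {}")
        case False
        then have "cbox c d \<subseteq> cbox a b"
          using closure_mono[OF cd] cd by (metis closure_box subset_empty)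
        then show ?thesis using box ab by blast
      qed (simp add: set_lebesgue_integral_def)
    qed
    moreover have "AE x in lebesgue. x \<notin> cbox a b - box a b"
      using negligible_frontier_interval[of a b]
      by (intro AE_not_in) (simp add: negligible_iff_null_sets)
    ultimately show ?thesis unfolding ab(1) by eventually_elim auto
  qed
  then have "AE x in lebesgue. \<forall>X\<in>\<D>. x \<in> X \<longrightarrow> F x = 0"
    using D(1) by (intro AE_ball_countable[THEN iffD2]) auto
  then have "AE x in lebesgue. x \<in> \<Omega> \<longrightarrow> f x = 0"
    by eventually_elim (use D(4) in \<open>auto simp: F_def indicator_eq_0_iff\<close>)
  then show ?thesis using AE_restrict_space_iff[OF \<Omega>s] by simp
qed

section \<open>Weak gradients and divergences\<close>

lemma GDERIV_unique: "GDERIV \<phi> x :> D \<Longrightarrow> GDERIV \<phi> x :> E \<Longrightarrow> D = E"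
  unfolding gderiv_def by (metis has_derivative_unique vector_eq_ldot)

lemma smooth_gradient_continuous:
  assumes "smooth \<phi>" and D: "\<And>x. GDERIV \<phi> x :> D x"
  shows "continuous_on UNIV D"
proof -
  have "Ck (Suc 0) \<phi>" using assms by (simp only: smooth_def)
  then obtain E where E: "\<And>x. GDERIV \<phi> x :> E x" "\<And>i. continuous_on UNIV (\<lambda>x. E x $ i)"
    by auto
  then have "D = E" using D GDERIV_unique by blast
  then show ?thesis using E(2) continuous_on_vec_lambda[of UNIV "\<lambda>i x. E x $ i"] by simp
qed

lemma integrable_L2_scaleR:
  assumes "\<phi> \<in> L2 \<Omega>" "G \<in> L2 \<Omega>"
  shows "integrable (lebesgue_on \<Omega>) (\<lambda>x. \<phi> x *\<^sub>R G x)"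
proof (rule Bochner_Integration.integrable_bound)
  have "(\<lambda>x. norm (\<phi> x)) \<in> L2 \<Omega>" "(\<lambda>x. norm (G x)) \<in> L2 \<Omega>"
    using assms by (auto simp: L2_def)
  then show "integrable (lebesgue_on \<Omega>) (\<lambda>x. norm (\<phi> x) \<bullet> norm (G x))"
    by (rule integrable_L2_inner)
  show "(\<lambda>x. \<phi> x *\<^sub>R G x) \<in> borel_measurable (lebesgue_on \<Omega>)"
    by (intro borel_measurable_scaleR L2_measurable assms)
qed auto

lemma L2_test:
  assumes "open \<Omega>" "bounded \<Omega>" "test_function U \<phi>" "\<And>x. GDERIV \<phi> x :> D x"
  shows "\<phi> \<in> L2 \<Omega>" "D \<in> L2 \<Omega>"
  using assms smooth_continuous smooth_gradient_continuous
  by (auto simp: test_function_def intro!: L2_continuous)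

lemma test_function_GDERIV:
  assumes "test_function \<Omega> \<phi>" obtains D where "\<And>x. GDERIV \<phi> x :> D x"
proof -
  have "Ck (Suc 0) \<phi>" using assms by (simp only: smooth_def test_function_def)
  then show thesis using that by auto
qed

lemma AE_eq_if_test_integrals_eq:
  fixes f g :: "real^2 \<Rightarrow> real"
  assumes \<Omega>: "open \<Omega>" "bounded \<Omega>" and f: "f \<in> L2 \<Omega>" and g: "g \<in> L2 \<Omega>"
    and eq: "\<And>\<phi>. test_function \<Omega> \<phi> \<Longrightarrow> (LINT x|lebesgue_on \<Omega>. \<phi> x * f x) = (LINT x|lebesgue_on \<Omega>. \<phi> x * g x)"
  shows "AE x in lebesgue_on \<Omega>. f x = g x"
proof -
  have "(\<lambda>x. 1) \<in> L2 \<Omega>" by (rule L2_continuous[OF \<Omega>]) simp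
  from integrable_L2_inner[OF L2_diff[OF f g] this]
  have "integrable (lebesgue_on \<Omega>) (\<lambda>x. f x - g x)" by simp
  then have "AE x in lebesgue_on \<Omega>. f x - g x = 0"
  proof (rule fundamental_lemma[OF \<Omega>(1)])
    fix \<phi> assume \<phi>: "test_function \<Omega> \<phi>"
    then have "\<phi> \<in> L2 \<Omega>" using L2_test[OF \<Omega> \<phi>] test_function_GDERIV by metis
    from integrable_L2_inner[OF this f] integrable_L2_inner[OF this g]
    show "(LINT x|lebesgue_on \<Omega>. \<phi> x * (f x - g x)) = 0"
      using eq[OF \<phi>] by (simp add: right_diff_distrib)
  qed
  then show ?thesis by simp
qed

lemma AE_vec_eqI: "(\<And>i::'n::finite. AE x in M. f x $ i = g x $ i) \<Longrightarrow> AE x in M. f x = g x"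
  unfolding vec_eq_iff by (simp add: AE_all_countable)

text \<open>Weak gradients and divergences are picked by a choice operator.  Their uniqueness up to null sets
  is what makes them linear almost everywhere, and hence the norms of differences meaningful.\<close>

lemma is_weak_grad_unique:
  assumes \<Omega>: "open \<Omega>" "bounded \<Omega>" and G: "G \<in> L2 \<Omega>" "is_weak_grad \<Omega> q G"
    and H: "H \<in> L2 \<Omega>" "is_weak_grad \<Omega> q H"
  shows "AE x in lebesgue_on \<Omega>. G x = H x"
proof (rule AE_vec_eqI, rule AE_eq_if_test_integrals_eq[OF \<Omega>])
  fix i \<phi> assume \<phi>: "test_function \<Omega> \<phi>"
  then obtain D where D: "\<And>x. GDERIV \<phi> x :> D x" using test_function_GDERIV by blast
  have L: "\<phi> \<in> L2 \<Omega>" using L2_test[OF \<Omega> \<phi> D] by simp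
  have comp: "(LINT x|lebesgue_on \<Omega>. \<phi> x * K x $ i) = (LINT x|lebesgue_on \<Omega>. \<phi> x *\<^sub>R K x) $ i"
    if "K \<in> L2 \<Omega>" for K :: vector_field
    using integral_bounded_linear[OF bounded_linear_vec_nth[of i] integrable_L2_scaleR[OF L that]]
    by simp
  have "(LINT x|lebesgue_on \<Omega>. \<phi> x *\<^sub>R G x) = (LINT x|lebesgue_on \<Omega>. \<phi> x *\<^sub>R H x)"
    using G(2)[unfolded is_weak_grad_def, rule_format, of \<phi> D]
      H(2)[unfolded is_weak_grad_def, rule_format, of \<phi> D] \<phi> D by simp
  then show "(LINT x|lebesgue_on \<Omega>. \<phi> x * G x $ i) = (LINT x|lebesgue_on \<Omega>. \<phi> x * H x $ i)"
    using comp G(1) H(1) by simp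
qed (use G H L2_component in auto)

lemma is_weak_grad_diff:
  assumes \<Omega>: "open \<Omega>" "bounded \<Omega>" and p: "p \<in> L2 \<Omega>" "G \<in> L2 \<Omega>" "is_weak_grad \<Omega> p G"
    and q: "q \<in> L2 \<Omega>" "H \<in> L2 \<Omega>" "is_weak_grad \<Omega> q H"
  shows "is_weak_grad \<Omega> (p - q) (G - H)"
  unfolding is_weak_grad_def
proof safe
  fix \<phi> D assume \<phi>: "test_function \<Omega> \<phi>" and D: "\<forall>x. GDERIV \<phi> x :> D x"
  have L: "\<phi> \<in> L2 \<Omega>" "D \<in> L2 \<Omega>" using L2_test[OF \<Omega> \<phi>] D by auto
  have "(LINT x|lebesgue_on \<Omega>. (p - q) x *\<^sub>R D x)
      = (LINT x|lebesgue_on \<Omega>. p x *\<^sub>R D x) - (LINT x|lebesgue_on \<Omega>. q x *\<^sub>R D x)"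
    by (simp add: scaleR_diff_left integrable_L2_scaleR L p q)
  also have "\<dots> = - ((LINT x|lebesgue_on \<Omega>. \<phi> x *\<^sub>R G x) - (LINT x|lebesgue_on \<Omega>. \<phi> x *\<^sub>R H x))"
    using p(3) q(3) \<phi> D by (simp add: is_weak_grad_def)
  also have "\<dots> = - (LINT x|lebesgue_on \<Omega>. \<phi> x *\<^sub>R (G - H) x)"
    by (simp add: scaleR_diff_right integrable_L2_scaleR L p q)
  finally show "(LINT x|lebesgue_on \<Omega>. (p - q) x *\<^sub>R D x) = - (LINT x|lebesgue_on \<Omega>. \<phi> x *\<^sub>R (G - H) x)" .
qed

lemma wgrad:
  assumes "q \<in> H1 \<Omega>" shows "wgrad \<Omega> q \<in> L2 \<Omega>" "is_weak_grad \<Omega> q (wgrad \<Omega> q)"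
  using someI_ex[of "\<lambda>G. G \<in> L2 \<Omega> \<and> is_weak_grad \<Omega> q G"] assms
  by (auto simp: H1_def wgrad_def)

lemma H1_imp_L2: "q \<in> H1 \<Omega> \<Longrightarrow> q \<in> L2 \<Omega>"
  by (simp add: H1_def)

lemma H1_diff:
  assumes \<Omega>: "open \<Omega>" "bounded \<Omega>" and p: "p \<in> H1 \<Omega>" and q: "q \<in> H1 \<Omega>"
  shows "p - q \<in> H1 \<Omega>" "AE x in lebesgue_on \<Omega>. wgrad \<Omega> (p - q) x = wgrad \<Omega> p x - wgrad \<Omega> q x"
proof -
  have G: "wgrad \<Omega> p - wgrad \<Omega> q \<in> L2 \<Omega>" "is_weak_grad \<Omega> (p - q) (wgrad \<Omega> p - wgrad \<Omega> q)"
    by (rule L2_diff[OF wgrad(1)[OF p] wgrad(1)[OF q]],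
        rule is_weak_grad_diff[OF \<Omega> H1_imp_L2[OF p] wgrad[OF p] H1_imp_L2[OF q] wgrad[OF q]])
  then show *: "p - q \<in> H1 \<Omega>"
    using L2_diff[OF H1_imp_L2[OF p] H1_imp_L2[OF q]] unfolding H1_def by blast
  show "AE x in lebesgue_on \<Omega>. wgrad \<Omega> (p - q) x = wgrad \<Omega> p x - wgrad \<Omega> q x"
    using is_weak_grad_unique[OF \<Omega> wgrad[OF *] G] by simp
qed

lemma H1_zero:
  assumes \<Omega>: "open \<Omega>" "bounded \<Omega>"
  shows "(\<lambda>x. 0) \<in> H1 \<Omega>" "AE x in lebesgue_on \<Omega>. wgrad \<Omega> (\<lambda>x. 0) x = 0"
proof -
  have G: "is_weak_grad \<Omega> (\<lambda>x. 0) (\<lambda>x. 0)" by (simp add: is_weak_grad_def)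
  then show *: "(\<lambda>x. 0) \<in> H1 \<Omega>" by (auto simp: H1_def intro!: L2_zero)
  show "AE x in lebesgue_on \<Omega>. wgrad \<Omega> (\<lambda>x. 0) x = 0"
    by (rule is_weak_grad_unique[OF \<Omega> wgrad[OF *] L2_zero G])
qed

lemma H1_norm_nonneg: "H1_norm \<Omega> q \<ge> 0"
  by (simp add: H1_norm_def)

lemma L2_norm_le_H1_norm: "L2_norm \<Omega> q \<le> H1_norm \<Omega> q" "L2_norm \<Omega> (wgrad \<Omega> q) \<le> H1_norm \<Omega> q"
  by (auto simp: H1_norm_def intro!: real_le_rsqrt)

lemma L2_norm_wgrad_diff:
  assumes \<Omega>: "open \<Omega>" "bounded \<Omega>" and p: "p \<in> H1 \<Omega>" and q: "q \<in> H1 \<Omega>"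
  shows "L2_norm \<Omega> (wgrad \<Omega> (p - q)) = L2_norm \<Omega> (wgrad \<Omega> p - wgrad \<Omega> q)"
  using H1_diff[OF assms] wgrad[OF H1_diff(1)[OF assms]] L2_diff[OF wgrad(1)[OF p] wgrad(1)[OF q]]
  by (intro L2_norm_cong_AE) auto

lemma H1_norm_triangle_sub:
  assumes \<Omega>: "open \<Omega>" "bounded \<Omega>" and H: "p \<in> H1 \<Omega>" "q \<in> H1 \<Omega>" "r \<in> H1 \<Omega>"
  shows "H1_norm \<Omega> (p - r) \<le> H1_norm \<Omega> (p - q) + H1_norm \<Omega> (q - r)"
proof -
  have "L2_norm \<Omega> (p - r) \<le> L2_norm \<Omega> (p - q) + L2_norm \<Omega> (q - r)"
    by (intro L2_norm_triangle_sub H1_imp_L2 H)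
  moreover have "L2_norm \<Omega> (wgrad \<Omega> (p - r)) \<le> L2_norm \<Omega> (wgrad \<Omega> (p - q)) + L2_norm \<Omega> (wgrad \<Omega> (q - r))"
    by (simp add: L2_norm_wgrad_diff[OF \<Omega>] H) (intro L2_norm_triangle_sub wgrad H)
  ultimately have "H1_norm \<Omega> (p - r) \<le>
      sqrt ((L2_norm \<Omega> (p - q) + L2_norm \<Omega> (q - r))\<^sup>2
          + (L2_norm \<Omega> (wgrad \<Omega> (p - q)) + L2_norm \<Omega> (wgrad \<Omega> (q - r)))\<^sup>2)"
    unfolding H1_norm_def by (intro real_sqrt_le_mono add_mono power_mono L2_norm_nonneg)
  also have "\<dots> \<le> H1_norm \<Omega> (p - q) + H1_norm \<Omega> (q - r)"
    unfolding H1_norm_def by (rule real_sqrt_sum_squares_triangle_ineq)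
  finally show ?thesis .
qed

lemma H1_norm_diff_commute:
  assumes \<Omega>: "open \<Omega>" "bounded \<Omega>" and H: "p \<in> H1 \<Omega>" "q \<in> H1 \<Omega>"
  shows "H1_norm \<Omega> (p - q) = H1_norm \<Omega> (q - p)"
  unfolding H1_norm_def using L2_norm_wgrad_diff[OF \<Omega>] H L2_norm_diff_commute by metis

lemma is_weak_div_unique:
  assumes \<Omega>: "open \<Omega>" "bounded \<Omega>" and s: "s \<in> L2 \<Omega>" "is_weak_div \<Omega> w s"
    and t: "t \<in> L2 \<Omega>" "is_weak_div \<Omega> w t"
  shows "AE x in lebesgue_on \<Omega>. s x = t x"
proof (rule AE_eq_if_test_integrals_eq[OF \<Omega> s(1) t(1)])
  fix \<phi> assume \<phi>: "test_function \<Omega> \<phi>"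
  then obtain D where "\<And>x. GDERIV \<phi> x :> D x" using test_function_GDERIV by blast
  then show "(LINT x|lebesgue_on \<Omega>. \<phi> x * s x) = (LINT x|lebesgue_on \<Omega>. \<phi> x * t x)"
    using s(2)[unfolded is_weak_div_def, rule_format, of \<phi> D]
      t(2)[unfolded is_weak_div_def, rule_format, of \<phi> D] \<phi> by simp
qed

lemma is_tensor_div_unique:
  assumes \<Omega>: "open \<Omega>" "bounded \<Omega>" and "v \<in> L2 \<Omega>" "is_tensor_div \<Omega> \<tau> v" "w \<in> L2 \<Omega>" "is_tensor_div \<Omega> \<tau> w"
  shows "AE x in lebesgue_on \<Omega>. v x = w x"
  using assms unfolding is_tensor_div_def
  by (intro AE_vec_eqI is_weak_div_unique[OF \<Omega>]) (auto intro: L2_component)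

lemma tdiv:
  assumes "\<exists>w\<in>L2 \<Omega>. is_tensor_div \<Omega> \<tau> w"
  shows "tdiv \<Omega> \<tau> \<in> L2 \<Omega>" "is_tensor_div \<Omega> \<tau> (tdiv \<Omega> \<tau>)"
  using someI_ex[of "\<lambda>w. w \<in> L2 \<Omega> \<and> is_tensor_div \<Omega> \<tau> w"] assms
  by (auto simp: tdiv_def)

lemma is_tensor_div_diff:
  assumes \<Omega>: "open \<Omega>" "bounded \<Omega>" and \<tau>: "\<tau> \<in> L2 \<Omega>" "v \<in> L2 \<Omega>" "is_tensor_div \<Omega> \<tau> v"
    and \<sigma>: "\<sigma> \<in> L2 \<Omega>" "w \<in> L2 \<Omega>" "is_tensor_div \<Omega> \<sigma> w"
  shows "is_tensor_div \<Omega> (\<tau> - \<sigma>) (v - w)"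
  unfolding is_tensor_div_def is_weak_div_def
proof safe
  fix i \<phi> D assume \<phi>: "test_function \<Omega> \<phi>" and D: "\<forall>x. GDERIV \<phi> x :> D x"
  have L: "\<phi> \<in> L2 \<Omega>" "D \<in> L2 \<Omega>" using L2_test[OF \<Omega> \<phi>] D by auto
  have int: "integrable (lebesgue_on \<Omega>) (\<lambda>x. \<phi> x * u x $ i)" if "u \<in> L2 \<Omega>" for u :: vector_field
    using integrable_L2_inner[OF L(1) L2_component(1)[OF that]] by simp
  have "(LINT x|lebesgue_on \<Omega>. (\<tau> - \<sigma>) x $ i \<bullet> D x)
      = (LINT x|lebesgue_on \<Omega>. \<tau> x $ i \<bullet> D x) - (LINT x|lebesgue_on \<Omega>. \<sigma> x $ i \<bullet> D x)"
    by (simp add: inner_diff_left integrable_L2_inner L2_component L \<tau> \<sigma>)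
  also have "\<dots> = - ((LINT x|lebesgue_on \<Omega>. \<phi> x * v x $ i) - (LINT x|lebesgue_on \<Omega>. \<phi> x * w x $ i))"
    using \<tau>(3) \<sigma>(3) \<phi> D by (simp add: is_tensor_div_def is_weak_div_def)
  also have "\<dots> = - (LINT x|lebesgue_on \<Omega>. \<phi> x * (v - w) x $ i)"
    by (simp add: right_diff_distrib int \<tau> \<sigma>)
  finally show "(LINT x|lebesgue_on \<Omega>. (\<tau> - \<sigma>) x $ i \<bullet> D x) = - (LINT x|lebesgue_on \<Omega>. \<phi> x * (v - w) x $ i)" .
qed

lemma space_Y_D:
  assumes "\<tau> \<in> space_Y \<Omega>"
  shows "\<tau> \<in> L2_sym \<Omega>" "\<tau> \<in> L2 \<Omega>" "tdiv \<Omega> \<tau> \<in> L2 \<Omega>" "is_tensor_div \<Omega> \<tau> (tdiv \<Omega> \<tau>)"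
  using assms tdiv[of \<Omega> \<tau>] by (auto simp: space_Y_def L2_sym_def)

lemma L2_sym_diff: "\<tau> \<in> L2_sym \<Omega> \<Longrightarrow> \<sigma> \<in> L2_sym \<Omega> \<Longrightarrow> \<tau> - \<sigma> \<in> L2_sym \<Omega>"
  unfolding L2_sym_def by (auto simp: transpose_def vec_eq_iff intro: L2_diff elim!: eventually_elim2)

lemma space_Y_diff:
  assumes \<Omega>: "open \<Omega>" "bounded \<Omega>" and \<tau>: "\<tau> \<in> space_Y \<Omega>" and \<sigma>: "\<sigma> \<in> space_Y \<Omega>"
  shows "\<tau> - \<sigma> \<in> space_Y \<Omega>" "AE x in lebesgue_on \<Omega>. tdiv \<Omega> (\<tau> - \<sigma>) x = tdiv \<Omega> \<tau> x - tdiv \<Omega> \<sigma> x"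
    "L2_norm \<Omega> (tdiv \<Omega> (\<tau> - \<sigma>)) = L2_norm \<Omega> (tdiv \<Omega> \<tau> - tdiv \<Omega> \<sigma>)"
proof -
  have w: "tdiv \<Omega> \<tau> - tdiv \<Omega> \<sigma> \<in> L2 \<Omega>" "is_tensor_div \<Omega> (\<tau> - \<sigma>) (tdiv \<Omega> \<tau> - tdiv \<Omega> \<sigma>)"
    by (rule L2_diff[OF space_Y_D(3)[OF \<tau>] space_Y_D(3)[OF \<sigma>]],
        rule is_tensor_div_diff[OF \<Omega> space_Y_D(2-4)[OF \<tau>] space_Y_D(2-4)[OF \<sigma>]])
  then show Y: "\<tau> - \<sigma> \<in> space_Y \<Omega>"
    using L2_sym_diff[OF space_Y_D(1)[OF \<tau>] space_Y_D(1)[OF \<sigma>]] w unfolding space_Y_def by blast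
  show ae: "AE x in lebesgue_on \<Omega>. tdiv \<Omega> (\<tau> - \<sigma>) x = tdiv \<Omega> \<tau> x - tdiv \<Omega> \<sigma> x"
    using is_tensor_div_unique[OF \<Omega> space_Y_D(3,4)[OF Y] w] by simp
  show "L2_norm \<Omega> (tdiv \<Omega> (\<tau> - \<sigma>)) = L2_norm \<Omega> (tdiv \<Omega> \<tau> - tdiv \<Omega> \<sigma>)"
    using ae by (intro L2_norm_cong_AE space_Y_D(3)[OF Y] w(1)) simp
qed

lemma L2_subset:
  fixes f :: "real^2 \<Rightarrow> 'a::euclidean_space"
  assumes U: "open U" "open \<Omega>" "U \<subseteq> \<Omega>" and f: "f \<in> L2 \<Omega>"
  shows "f \<in> L2 U"
proof -
  have "f \<in> borel_measurable (lebesgue_on U)"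
    using L2_measurable[OF f] U(3) by (rule measurable_restrict_mono)
  moreover have "set_integrable lebesgue \<Omega> (\<lambda>x. (norm (f x))\<^sup>2)"
    using f U integrable_restrict_space[of \<Omega> lebesgue "\<lambda>x. (norm (f x))\<^sup>2"] by (simp add: L2_def set_integrable_def)
  then have "set_integrable lebesgue U (\<lambda>x. (norm (f x))\<^sup>2)"
    by (rule set_integrable_subset) (use U in auto)
  ultimately show ?thesis
    using U integrable_restrict_space[of U lebesgue "\<lambda>x. (norm (f x))\<^sup>2"] by (simp add: L2_def set_integrable_def)
qed

lemma GDERIV_zero_outside:
  assumes "compact S" "\<And>x. x \<notin> S \<Longrightarrow> \<phi> x = 0" "GDERIV \<phi> x :> D" "x \<notin> S"
  shows "D = 0"
proof -
  have "open (- S)" using assms compact_imp_closed by auto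
  have "GDERIV (\<lambda>x. 0) x :> 0" by (rule GDERIV_const)
  then have "GDERIV \<phi> x :> 0"
    unfolding gderiv_def
    by (rule has_derivative_transform_within_open[OF _ \<open>open (- S)\<close>]) (use assms in auto)
  then show ?thesis using GDERIV_unique assms(3) by blast
qed

text \<open>A test function on the smaller set is one on the larger set, and it vanishes together with its
  gradient off its support; so both integrals are unchanged.\<close>

lemma is_tensor_div_subset:
  assumes U: "open U" "open \<Omega>" "U \<subseteq> \<Omega>" and div: "is_tensor_div \<Omega> \<tau> w"
  shows "is_tensor_div U \<tau> w"
  unfolding is_tensor_div_def is_weak_div_def
proof safe
  fix i \<phi> D assume \<phi>: "test_function U \<phi>" and D: "\<forall>x. GDERIV \<phi> x :> D x"
  then obtain S where S: "compact S" "S \<subseteq> U" "\<And>x. x \<notin> S \<Longrightarrow> \<phi> x = 0"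
    by (auto simp: test_function_def)
  have \<phi>\<Omega>: "test_function \<Omega> \<phi>" using \<phi> U unfolding test_function_def by (meson order_trans)
  have D0: "D x = 0" if "x \<notin> S" for x using GDERIV_zero_outside[of S \<phi> x "D x"] S D that by auto
  have *: "(LINT x|lebesgue_on U. h x) = (LINT x|lebesgue_on \<Omega>. h x)"
    if "\<And>x. x \<notin> S \<Longrightarrow> h x = 0" for h :: scalar_field
  proof -
    have "indicator U x *\<^sub>R h x = indicator \<Omega> x *\<^sub>R h x" for x
      using that[of x] S(2) U(3) by (auto simp: indicator_def)
    then have "(LINT x|lebesgue. indicator U x *\<^sub>R h x) = (LINT x|lebesgue. indicator \<Omega> x *\<^sub>R h x)"
      by presburger
    then show ?thesis using U by (simp add: integral_restrict_space)
  qed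
  show "(LINT x|lebesgue_on U. \<tau> x $ i \<bullet> D x) = - (LINT x|lebesgue_on U. \<phi> x * w x $ i)"
    using div \<phi>\<Omega> D unfolding is_tensor_div_def is_weak_div_def
    by (subst (1 2) *) (auto simp: D0 S(3))
qed

lemma tdiv_subset:
  assumes \<Omega>: "open U" "open \<Omega>" "U \<subseteq> \<Omega>" "bounded \<Omega>" and \<tau>: "\<tau> \<in> space_Y \<Omega>"
  shows "AE x in lebesgue_on U. tdiv U \<tau> x = tdiv \<Omega> \<tau> x"
proof -
  have w: "tdiv \<Omega> \<tau> \<in> L2 U" "is_tensor_div U \<tau> (tdiv \<Omega> \<tau>)"
    using L2_subset[OF \<Omega>(1-3)] is_tensor_div_subset[OF \<Omega>(1-3)] space_Y_D[OF \<tau>] by auto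
  then have "tdiv U \<tau> \<in> L2 U" "is_tensor_div U \<tau> (tdiv U \<tau>)"
    using tdiv[of U \<tau>] by auto
  with w show ?thesis
    using \<Omega> bounded_subset by (intro is_tensor_div_unique) auto
qed

section \<open>Norms of the product spaces\<close>

lemma sqrt_sum_squares_ge: "a \<ge> 0 \<Longrightarrow> a \<le> sqrt (a\<^sup>2 + b\<^sup>2)" "b \<ge> 0 \<Longrightarrow> b \<le> sqrt (a\<^sup>2 + b\<^sup>2)"
  by (auto intro!: real_le_rsqrt)

lemma norm_X_ge: "L2_norm \<Omega> e \<le> norm_X \<Omega> (e, q)" "H1_norm \<Omega> q \<le> norm_X \<Omega> (e, q)"
  by (auto simp: norm_X_def intro!: sqrt_sum_squares_ge L2_norm_nonneg H1_norm_nonneg)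

lemma norm_X_nonneg: "norm_X \<Omega> \<epsilon> \<ge> 0"
  by (simp add: norm_X_def split: prod.split)

lemma norm_X_square: "(norm_X \<Omega> (e, q))\<^sup>2 = (L2_norm \<Omega> e)\<^sup>2 + (H1_norm \<Omega> q)\<^sup>2"
  by (simp add: norm_X_def)

lemma norm_Y_ge: "L2_norm \<Omega> \<tau> \<le> norm_Y \<Omega> \<tau>" "L2_norm \<Omega> (tdiv \<Omega> \<tau>) \<le> norm_Y \<Omega> \<tau>"
  by (auto simp: norm_Y_def intro!: sqrt_sum_squares_ge L2_norm_nonneg)

lemma norm_Y_le: "norm_Y \<Omega> \<tau> \<le> L2_norm \<Omega> \<tau> + L2_norm \<Omega> (tdiv \<Omega> \<tau>)"
  by (simp add: norm_Y_def sqrt_sum_squares_le_sum L2_norm_nonneg)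

lemma norm_Y_nonneg: "norm_Y \<Omega> \<tau> \<ge> 0"
  by (simp add: norm_Y_def)

lemma norm_XY_ge: "norm_X \<Omega> \<epsilon> \<le> norm_XY \<Omega> (\<epsilon>, \<tau>)" "norm_Y \<Omega> \<tau> \<le> norm_XY \<Omega> (\<epsilon>, \<tau>)"
  by (auto simp: norm_XY_def intro!: sqrt_sum_squares_ge norm_X_nonneg norm_Y_nonneg)

lemma norm_XYZ_ge:
  "norm_X \<Omega> \<epsilon> \<le> norm_XYZ \<Omega> ((\<epsilon>, \<tau>), v)" "norm_Y \<Omega> \<tau> \<le> norm_XYZ \<Omega> ((\<epsilon>, \<tau>), v)"
  "L2_norm \<Omega> v \<le> norm_XYZ \<Omega> ((\<epsilon>, \<tau>), v)"
  by (auto simp: norm_XYZ_def norm_Z_def intro!: real_le_rsqrt)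

lemma norm_XYZ_le: "norm_XYZ \<Omega> ((\<epsilon>, \<tau>), v) \<le> norm_X \<Omega> \<epsilon> + norm_Y \<Omega> \<tau> + L2_norm \<Omega> v"
proof -
  have "norm_XYZ \<Omega> ((\<epsilon>, \<tau>), v) \<le> sqrt ((norm_X \<Omega> \<epsilon>)\<^sup>2 + (norm_Y \<Omega> \<tau>)\<^sup>2) + L2_norm \<Omega> v"
    using sqrt_sum_squares_le_sum[of "sqrt ((norm_X \<Omega> \<epsilon>)\<^sup>2 + (norm_Y \<Omega> \<tau>)\<^sup>2)" "L2_norm \<Omega> v"]
    by (simp add: norm_XYZ_def norm_Z_def L2_norm_nonneg)
  also have "\<dots> \<le> norm_X \<Omega> \<epsilon> + norm_Y \<Omega> \<tau> + L2_norm \<Omega> v"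
    by (simp add: sqrt_sum_squares_le_sum norm_X_nonneg norm_Y_nonneg)
  finally show ?thesis .
qed

lemma norm_X_triangle_sub:
  assumes \<Omega>: "open \<Omega>" "bounded \<Omega>" and L: "d \<in> L2 \<Omega>" "e \<in> L2 \<Omega>" "c \<in> L2 \<Omega>"
    and H: "p \<in> H1 \<Omega>" "q \<in> H1 \<Omega>" "s \<in> H1 \<Omega>"
  shows "norm_X \<Omega> (d - c, p - s) \<le> norm_X \<Omega> (d - e, p - q) + norm_X \<Omega> (e - c, q - s)"
proof -
  have "norm_X \<Omega> (d - c, p - s) \<le> sqrt ((L2_norm \<Omega> (d - e) + L2_norm \<Omega> (e - c))\<^sup>2
      + (H1_norm \<Omega> (p - q) + H1_norm \<Omega> (q - s))\<^sup>2)"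
    unfolding norm_X_def prod.case
    by (intro real_sqrt_le_mono add_mono power_mono L2_norm_nonneg H1_norm_nonneg
        L2_norm_triangle_sub H1_norm_triangle_sub \<Omega> L H)
  also have "\<dots> \<le> norm_X \<Omega> (d - e, p - q) + norm_X \<Omega> (e - c, q - s)"
    unfolding norm_X_def prod.case by (rule real_sqrt_sum_squares_triangle_ineq)
  finally show ?thesis .
qed

section \<open>Boundary data\<close>

lemma two_term_Cauchy_Schwarz: "a * b + c * d \<le> sqrt (a\<^sup>2 + c\<^sup>2) * sqrt (b\<^sup>2 + d\<^sup>2)" for a b c d :: real
proof -
  have "(a * b + c * d)\<^sup>2 \<le> (a\<^sup>2 + c\<^sup>2) * (b\<^sup>2 + d\<^sup>2)"
    using zero_le_power2[of "a * d - b * c"] by (simp add: power2_eq_square algebra_simps)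
  then show ?thesis by (simp add: real_le_rsqrt flip: real_sqrt_mult)
qed

lemma smooth_diff: "smooth \<phi> \<Longrightarrow> smooth \<psi> \<Longrightarrow> smooth (\<lambda>x. \<phi> x - \<psi> x)"
  unfolding smooth_def using Ck_add[OF _ Ck_mult[OF Ck_const[of _ "-1"]]] by fastforce

lemma continuous_measurable_boundary:
  "continuous_on UNIV \<phi> \<Longrightarrow> \<phi> \<in> borel_measurable (boundary_measure \<Omega>)" for \<phi> :: scalar_field
proof -
  assume "continuous_on UNIV \<phi>"
  then have "\<phi> \<in> borel_measurable borel" by (rule borel_measurable_continuous_onI)
  moreover have "sets hausdorff1 = sets borel"
    unfolding hausdorff1_def using sets.sigma_sets_eq[of "borel :: (real^2) measure"]
    by (subst sets_measure_of) auto
  ultimately show ?thesis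
    unfolding boundary_measure_def by (intro measurable_restrict_space1) (simp cong: measurable_cong_sets)
qed

lemma is_trace_H1: "is_trace \<Omega> q \<xi> \<Longrightarrow> q \<in> H1 \<Omega>"
  by (simp add: is_trace_def)

text \<open>A function may have several traces, which agree only almost everywhere.  The difference of two of
  them is a trace of zero, on which every element of \<open>H\<^sup>-\<^sup>1\<^sup>/\<^sup>2\<close> vanishes by its bound; so the functional \<open>G\<close>
  is single-valued.\<close>

lemma is_trace_diff_zero:
  assumes \<Omega>: "open \<Omega>" "bounded \<Omega>" and \<xi>: "is_trace \<Omega> q \<xi>" and \<zeta>: "is_trace \<Omega> q \<zeta>"
  shows "is_trace \<Omega> (\<lambda>x. 0) (\<lambda>x. \<xi> x - \<zeta> x)"
proof -
  let ?b = "boundary_measure \<Omega>"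
  have q: "q \<in> H1 \<Omega>" using \<xi> by (rule is_trace_H1)
  have m: "\<xi> \<in> borel_measurable ?b" "\<zeta> \<in> borel_measurable ?b"
    using \<xi> \<zeta> by (auto simp: is_trace_def)
  obtain \<phi> D where \<phi>: "\<And>n. smooth (\<phi> n)" "\<And>n x. GDERIV (\<phi> n) x :> D n x"
    and \<phi>lim: "(\<lambda>n. L2_norm \<Omega> (\<phi> n - q)) \<longlonglongrightarrow> 0" "(\<lambda>n. L2_norm \<Omega> (D n - wgrad \<Omega> q)) \<longlonglongrightarrow> 0"
      "(\<lambda>n. \<integral>\<^sup>+x. ennreal ((\<phi> n x - \<xi> x)\<^sup>2) \<partial>?b) \<longlonglongrightarrow> 0"
    using \<xi> unfolding is_trace_def by blast
  obtain \<psi> E where \<psi>: "\<And>n. smooth (\<psi> n)" "\<And>n x. GDERIV (\<psi> n) x :> E n x"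
    and \<psi>lim: "(\<lambda>n. L2_norm \<Omega> (\<psi> n - q)) \<longlonglongrightarrow> 0" "(\<lambda>n. L2_norm \<Omega> (E n - wgrad \<Omega> q)) \<longlonglongrightarrow> 0"
      "(\<lambda>n. \<integral>\<^sup>+x. ennreal ((\<psi> n x - \<zeta> x)\<^sup>2) \<partial>?b) \<longlonglongrightarrow> 0"
    using \<zeta> unfolding is_trace_def by blast
  have L: "\<phi> n \<in> L2 \<Omega>" "D n \<in> L2 \<Omega>" "\<psi> n \<in> L2 \<Omega>" "E n \<in> L2 \<Omega>" for n
    by (intro L2_continuous[OF \<Omega>] smooth_continuous \<phi>(1) \<psi>(1)
        smooth_gradient_continuous[OF \<phi>] smooth_gradient_continuous[OF \<psi>])+
  have lim0: "(\<lambda>n. L2_norm \<Omega> ((\<lambda>x. \<phi> n x - \<psi> n x) - (\<lambda>x. 0))) \<longlonglongrightarrow> 0"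
  proof (rule tendsto_sandwich[OF _ _ tendsto_const])
    show "(\<lambda>n. L2_norm \<Omega> (\<phi> n - q) + L2_norm \<Omega> (\<psi> n - q)) \<longlonglongrightarrow> 0"
      using tendsto_add[OF \<phi>lim(1) \<psi>lim(1)] by simp
    have "L2_norm \<Omega> (\<phi> n - \<psi> n) \<le> L2_norm \<Omega> (\<phi> n - q) + L2_norm \<Omega> (\<psi> n - q)" for n
      using L2_norm_triangle_sub[OF L(1) H1_imp_L2[OF q] L(3)] by (simp add: L2_norm_diff_commute[of _ q])
    then show "\<forall>\<^sub>F n in sequentially. L2_norm \<Omega> ((\<lambda>x. \<phi> n x - \<psi> n x) - (\<lambda>x. 0))
        \<le> L2_norm \<Omega> (\<phi> n - q) + L2_norm \<Omega> (\<psi> n - q)"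
      by (simp add: fun_diff_def)
  qed (simp add: L2_norm_nonneg)
  have lim1: "(\<lambda>n. L2_norm \<Omega> ((\<lambda>x. D n x - E n x) - wgrad \<Omega> (\<lambda>x. 0))) \<longlonglongrightarrow> 0"
  proof (rule tendsto_sandwich[OF _ _ tendsto_const])
    show "(\<lambda>n. L2_norm \<Omega> (D n - wgrad \<Omega> q) + L2_norm \<Omega> (E n - wgrad \<Omega> q)) \<longlonglongrightarrow> 0"
      using tendsto_add[OF \<phi>lim(2) \<psi>lim(2)] by simp
    have "L2_norm \<Omega> ((\<lambda>x. D n x - E n x) - wgrad \<Omega> (\<lambda>x. 0)) = L2_norm \<Omega> (D n - E n)" for n
    proof (rule L2_norm_cong_AE)
      show "D n - E n \<in> L2 \<Omega>" by (intro L2_diff L)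
      then show "(\<lambda>x. D n x - E n x) - wgrad \<Omega> (\<lambda>x. 0) \<in> L2 \<Omega>"
        using L2_diff[OF _ wgrad(1)[OF H1_zero(1)[OF \<Omega>]]] by (simp add: fun_diff_def)
      show "AE x in lebesgue_on \<Omega>. ((\<lambda>x. D n x - E n x) - wgrad \<Omega> (\<lambda>x. 0)) x = (D n - E n) x"
        using H1_zero(2)[OF \<Omega>] by eventually_elim simp
    qed
    then show "\<forall>\<^sub>F n in sequentially. L2_norm \<Omega> ((\<lambda>x. D n x - E n x) - wgrad \<Omega> (\<lambda>x. 0))
        \<le> L2_norm \<Omega> (D n - wgrad \<Omega> q) + L2_norm \<Omega> (E n - wgrad \<Omega> q)"
      using L2_norm_triangle_sub[OF L(2) wgrad(1)[OF q] L(4)] by (simp add: L2_norm_diff_commute[of _ "wgrad \<Omega> q"])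
  qed (simp add: L2_norm_nonneg)
  have lim2: "(\<lambda>n. \<integral>\<^sup>+x. ennreal (((\<phi> n x - \<psi> n x) - (\<xi> x - \<zeta> x))\<^sup>2) \<partial>?b) \<longlonglongrightarrow> 0"
  proof (rule tendsto_sandwich[OF _ _ tendsto_const])
    let ?a = "\<lambda>n. \<integral>\<^sup>+x. ennreal ((\<phi> n x - \<xi> x)\<^sup>2) \<partial>?b"
    let ?c = "\<lambda>n. \<integral>\<^sup>+x. ennreal ((\<psi> n x - \<zeta> x)\<^sup>2) \<partial>?b"
    have "(\<lambda>n. 2 * ?a n + 2 * ?c n) \<longlonglongrightarrow> 2 * 0 + 2 * 0"
      by (intro tendsto_add ennreal_tendsto_cmult \<phi>lim \<psi>lim) auto
    then show "(\<lambda>n. 2 * ?a n + 2 * ?c n) \<longlonglongrightarrow> 0" by simp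
    have "(\<integral>\<^sup>+x. ennreal (((\<phi> n x - \<psi> n x) - (\<xi> x - \<zeta> x))\<^sup>2) \<partial>?b) \<le> 2 * ?a n + 2 * ?c n" for n
    proof -
      have [measurable]: "\<phi> n \<in> borel_measurable ?b" "\<psi> n \<in> borel_measurable ?b"
        "\<xi> \<in> borel_measurable ?b" "\<zeta> \<in> borel_measurable ?b"
        using \<phi>(1) \<psi>(1) m by (auto intro: continuous_measurable_boundary smooth_continuous)
      have "((s - t) - (u - w))\<^sup>2 \<le> 2 * (s - u)\<^sup>2 + 2 * (t - w)\<^sup>2" for s t u w :: real
        using zero_le_power2[of "(s - u) + (t - w)"] by (simp add: power2_eq_square algebra_simps)
      then have "(\<integral>\<^sup>+x. ennreal (((\<phi> n x - \<psi> n x) - (\<xi> x - \<zeta> x))\<^sup>2) \<partial>?b)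
          \<le> (\<integral>\<^sup>+x. 2 * ennreal ((\<phi> n x - \<xi> x)\<^sup>2) + 2 * ennreal ((\<psi> n x - \<zeta> x)\<^sup>2) \<partial>?b)"
        by (intro nn_integral_mono) (simp add: ennreal_mult[symmetric] ennreal_plus[symmetric] ennreal_leI
            flip: ennreal_numeral del: ennreal_plus)
      also have "\<dots> = 2 * ?a n + 2 * ?c n"
        by (simp add: nn_integral_add nn_integral_cmult)
      finally show ?thesis .
    qed
    then show "\<forall>\<^sub>F n in sequentially. (\<integral>\<^sup>+x. ennreal (((\<phi> n x - \<psi> n x) - (\<xi> x - \<zeta> x))\<^sup>2) \<partial>?b)
        \<le> 2 * ?a n + 2 * ?c n" by simp
  qed simp
  show ?thesis
    unfolding is_trace_def
  proof (intro conjI exI[of _ "\<lambda>n x. \<phi> n x - \<psi> n x"] exI[of _ "\<lambda>n x. D n x - E n x"] allI)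
    show "(\<lambda>x. \<xi> x - \<zeta> x) \<in> borel_measurable ?b" using m by simp
  qed (use H1_zero(1)[OF \<Omega>] lim0 lim1 lim2 \<phi> \<psi> in \<open>auto intro: smooth_diff GDERIV_diff\<close>)
qed

lemma Hhalf_norm_le: "is_trace \<Omega> q \<xi> \<Longrightarrow> Hhalf_norm \<Omega> \<xi> \<le> H1_norm \<Omega> q"
  unfolding Hhalf_norm_def by (rule cINF_lower) (auto intro!: bdd_belowI2[of _ 0] H1_norm_nonneg)

lemma Hhalf_norm_nonneg: "\<xi> \<in> Hhalf \<Omega> \<Longrightarrow> Hhalf_norm \<Omega> \<xi> \<ge> 0"
  unfolding Hhalf_norm_def Hhalf_def by (rule cINF_greatest) (auto intro: H1_norm_nonneg)

lemma Hmhalf_norm_bound: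
  assumes \<rho>: "\<rho> \<in> Hmhalf \<Omega>" and \<xi>: "\<xi> \<in> Hhalf \<Omega>"
  shows "\<bar>\<rho> \<xi>\<bar> \<le> Hmhalf_norm \<Omega> \<rho> * Hhalf_norm \<Omega> \<xi>" "Hmhalf_norm \<Omega> \<rho> \<ge> 0"
proof -
  obtain C where C: "\<And>\<zeta>. \<zeta> \<in> Hhalf \<Omega> \<Longrightarrow> \<bar>\<rho> \<zeta>\<bar> \<le> C * Hhalf_norm \<Omega> \<zeta>"
    using \<rho> unfolding Hmhalf_def by blast
  have "\<bar>\<rho> \<zeta>\<bar> / Hhalf_norm \<Omega> \<zeta> \<le> \<bar>C\<bar>" if "\<zeta> \<in> Hhalf \<Omega>" for \<zeta>
  proof (cases "Hhalf_norm \<Omega> \<zeta> = 0")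
    case False
    then have "Hhalf_norm \<Omega> \<zeta> > 0" using Hhalf_norm_nonneg[OF that] by simp
    moreover have "\<bar>\<rho> \<zeta>\<bar> \<le> \<bar>C\<bar> * Hhalf_norm \<Omega> \<zeta>"
      using C[OF that] mult_right_mono[OF abs_ge_self[of C] Hhalf_norm_nonneg[OF that]] by linarith
    ultimately show ?thesis by (simp add: field_simps)
  qed simp
  then have "bdd_above ((\<lambda>\<xi>. \<bar>\<rho> \<xi>\<bar> / Hhalf_norm \<Omega> \<xi>) ` Hhalf \<Omega>)"
    by (intro bdd_aboveI2[of _ _ "\<bar>C\<bar>"])
  then have le: "\<bar>\<rho> \<xi>\<bar> / Hhalf_norm \<Omega> \<xi> \<le> Hmhalf_norm \<Omega> \<rho>"
    unfolding Hmhalf_norm_def by (rule cSUP_upper[OF \<xi>])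
  then show "Hmhalf_norm \<Omega> \<rho> \<ge> 0"
    by (rule order_trans[rotated]) (simp add: Hhalf_norm_nonneg[OF \<xi>])
  show "\<bar>\<rho> \<xi>\<bar> \<le> Hmhalf_norm \<Omega> \<rho> * Hhalf_norm \<Omega> \<xi>"
  proof (cases "Hhalf_norm \<Omega> \<xi> = 0")
    case True
    then show ?thesis using C[OF \<xi>] by simp
  next
    case False
    then have "Hhalf_norm \<Omega> \<xi> > 0" using Hhalf_norm_nonneg[OF \<xi>] by simp
    then show ?thesis using le by (simp add: field_simps)
  qed
qed

lemma Hmhalf_trace_unique:
  assumes \<Omega>: "open \<Omega>" "bounded \<Omega>" and \<rho>: "\<rho> \<in> Hmhalf \<Omega>"
    and \<xi>: "is_trace \<Omega> q \<xi>" and \<zeta>: "is_trace \<Omega> q \<zeta>"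
  shows "\<rho> \<xi> = \<rho> \<zeta>"
proof -
  note t = is_trace_diff_zero[OF \<Omega> \<xi> \<zeta>]
  have H: "\<xi> \<in> Hhalf \<Omega>" "\<zeta> \<in> Hhalf \<Omega>" "(\<lambda>x. \<xi> x - \<zeta> x) \<in> Hhalf \<Omega>"
    using \<xi> \<zeta> t by (auto simp: Hhalf_def)
  have "\<forall>\<xi>\<in>Hhalf \<Omega>. \<forall>\<zeta>\<in>Hhalf \<Omega>. \<forall>a b.
      \<rho> (\<lambda>x. a * \<xi> x + b * \<zeta> x) = a * \<rho> \<xi> + b * \<rho> \<zeta>"
    using \<rho> unfolding Hmhalf_def mem_Collect_eq by (rule conjunct1)
  from this[rule_format, OF H(1,2), of 1 "-1"] have "\<rho> \<xi> - \<rho> \<zeta> = \<rho> (\<lambda>x. \<xi> x - \<zeta> x)" by simp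
  moreover have "H1_norm \<Omega> (\<lambda>x. 0) = 0"
    using L2_norm_AE_zero[OF H1_zero(2)[OF \<Omega>] wgrad(1)[OF H1_zero(1)[OF \<Omega>]]]
    by (simp add: H1_norm_def L2_norm_zero)
  then have "Hhalf_norm \<Omega> (\<lambda>x. \<xi> x - \<zeta> x) = 0"
    using Hhalf_norm_le[OF t] Hhalf_norm_nonneg[OF H(3)] by simp
  ultimately show ?thesis using Hmhalf_norm_bound[OF \<rho> H(3)] by simp
qed

lemma is_G_unique:
  assumes "open \<Omega>" "bounded \<Omega>" "\<rho> \<in> Hmhalf \<Omega>" "is_G \<Omega> g \<rho> \<epsilon> y" "is_G \<Omega> g \<rho> \<epsilon> z"
  shows "y = z"
proof -
  obtain e q where \<epsilon>: "\<epsilon> = (e, q)" by (cases \<epsilon>)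
  obtain \<xi> where \<xi>: "is_trace \<Omega> q \<xi>" "y = L2_inner \<Omega> g q + \<rho> \<xi>"
    using assms(4) unfolding \<epsilon> is_G_def by blast
  obtain \<zeta> where \<zeta>: "is_trace \<Omega> q \<zeta>" "z = L2_inner \<Omega> g q + \<rho> \<zeta>"
    using assms(5) unfolding \<epsilon> is_G_def by blast
  show ?thesis
    using Hmhalf_trace_unique[OF assms(1-3) \<xi>(1) \<zeta>(1)] \<xi>(2) \<zeta>(2) by simp
qed

lemma is_G_bound:
  assumes \<rho>: "\<rho> \<in> Hmhalf \<Omega>" and g: "g \<in> L2 \<Omega>" and y: "is_G \<Omega> g \<rho> (e, q) y"
  shows "q \<in> H1 \<Omega>" "\<bar>y\<bar> \<le> (L2_norm \<Omega> g + Hmhalf_norm \<Omega> \<rho>) * H1_norm \<Omega> q" "Hmhalf_norm \<Omega> \<rho> \<ge> 0"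
proof -
  obtain \<xi> where \<xi>: "is_trace \<Omega> q \<xi>" "y = L2_inner \<Omega> g q + \<rho> \<xi>"
    using y unfolding is_G_def by blast
  then have H: "\<xi> \<in> Hhalf \<Omega>" by (auto simp: Hhalf_def)
  show q: "q \<in> H1 \<Omega>" using \<xi>(1) by (rule is_trace_H1)
  show n: "Hmhalf_norm \<Omega> \<rho> \<ge> 0" using Hmhalf_norm_bound(2)[OF \<rho> H] .
  have "\<bar>\<rho> \<xi>\<bar> \<le> Hmhalf_norm \<Omega> \<rho> * H1_norm \<Omega> q"
    using Hmhalf_norm_bound(1)[OF \<rho> H] mult_left_mono[OF Hhalf_norm_le[OF \<xi>(1)] n] by linarith
  moreover have "\<bar>L2_inner \<Omega> g q\<bar> \<le> L2_norm \<Omega> g * H1_norm \<Omega> q"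
    using L2_inner_Cauchy_Schwarz[OF g H1_imp_L2[OF q]]
      mult_left_mono[OF L2_norm_le_H1_norm(1)[of \<Omega> q] L2_norm_nonneg[of \<Omega> g]] by linarith
  ultimately show "\<bar>y\<bar> \<le> (L2_norm \<Omega> g + Hmhalf_norm \<Omega> \<rho>) * H1_norm \<Omega> q"
    using \<xi>(2) by (simp add: distrib_right)
qed

lemma is_H_unique:
  assumes u: "u \<in> Hhalf_vec \<Omega>" and y: "is_H \<Omega> u \<tau> y" and z: "is_H \<Omega> u \<tau> z"
  shows "y = z"
proof -
  obtain \<eta> \<theta> where \<eta>: "is_normal_trace \<Omega> \<tau> \<eta>" "y = - (\<Sum>i\<in>UNIV. \<eta> i (\<lambda>x. u x $ i))"
    and \<theta>: "is_normal_trace \<Omega> \<tau> \<theta>" "z = - (\<Sum>i\<in>UNIV. \<theta> i (\<lambda>x. u x $ i))"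
    using y z by (auto simp: is_H_def)
  have "\<eta> i (\<lambda>x. u x $ i) = \<theta> i (\<lambda>x. u x $ i)" for i
  proof -
    obtain q where "is_trace \<Omega> q (\<lambda>x. u x $ i)" using u by (auto simp: Hhalf_vec_def Hhalf_def)
    then show ?thesis using \<eta>(1) \<theta>(1) by (simp add: is_normal_trace_def)
  qed
  then show ?thesis using \<eta>(2) \<theta>(2) by simp
qed

lemma L2_norm_square_components:
  fixes f :: "real^2 \<Rightarrow> 'a::euclidean_space^2"
  assumes "f \<in> L2 \<Omega>"
  shows "(L2_norm \<Omega> f)\<^sup>2 = (\<Sum>i\<in>UNIV. (L2_norm \<Omega> (\<lambda>x. f x $ i))\<^sup>2)"
proof -
  have "L2_inner \<Omega> f f = (\<Sum>i\<in>UNIV. L2_inner \<Omega> (\<lambda>x. f x $ i) (\<lambda>x. f x $ i))"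
    unfolding L2_inner_def inner_vec_def
    by (rule Bochner_Integration.integral_sum) (intro integrable_L2_inner L2_component assms)
  then show ?thesis by (simp add: L2_inner_self)
qed

text \<open>The pairing may be evaluated by Green's formula with any lifting of each component of the
  boundary datum; the infimum over the liftings yields the quotient norm.\<close>

lemma is_H_bound:
  assumes u: "u \<in> Hhalf_vec \<Omega>" and \<tau>: "\<tau> \<in> space_Y \<Omega>" and y: "is_H \<Omega> u \<tau> y"
  shows "\<bar>y\<bar> \<le> norm_Y \<Omega> \<tau> * Hhalf_vec_norm \<Omega> u"
proof -
  obtain \<eta> where \<eta>: "is_normal_trace \<Omega> \<tau> \<eta>" "y = - (\<Sum>i\<in>UNIV. \<eta> i (\<lambda>x. u x $ i))"
    using y by (auto simp: is_H_def)
  define h where "h i = Hhalf_norm \<Omega> (\<lambda>x. u x $ i)" for i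
  define t where "t i = sqrt ((L2_norm \<Omega> (\<lambda>x. \<tau> x $ i))\<^sup>2 + (L2_norm \<Omega> (\<lambda>x. tdiv \<Omega> \<tau> x $ i))\<^sup>2)" for i
  have t0: "t i \<ge> 0" for i by (simp add: t_def)
  have ui: "(\<lambda>x. u x $ i) \<in> Hhalf \<Omega>" for i using u by (simp add: Hhalf_vec_def)
  have h0: "h i \<ge> 0" for i unfolding h_def by (rule Hhalf_norm_nonneg[OF ui])
  note LT = space_Y_D(2,3)[OF \<tau>]
  have "\<bar>\<eta> i (\<lambda>x. u x $ i)\<bar> \<le> t i * h i" for i
  proof -
    let ?y = "\<eta> i (\<lambda>x. u x $ i)"
    have le: "\<bar>?y\<bar> \<le> t i * H1_norm \<Omega> q" if q: "is_trace \<Omega> q (\<lambda>x. u x $ i)" for q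
    proof -
      have qH: "q \<in> H1 \<Omega>" using q by (rule is_trace_H1)
      have "?y = L2_inner \<Omega> (\<lambda>x. \<tau> x $ i) (wgrad \<Omega> q) + L2_inner \<Omega> (\<lambda>x. tdiv \<Omega> \<tau> x $ i) q"
        using \<eta>(1) q by (simp add: is_normal_trace_def L2_inner_def)
      also have "\<bar>\<dots>\<bar> \<le> L2_norm \<Omega> (\<lambda>x. \<tau> x $ i) * L2_norm \<Omega> (wgrad \<Omega> q)
          + L2_norm \<Omega> (\<lambda>x. tdiv \<Omega> \<tau> x $ i) * L2_norm \<Omega> q"
        by (intro order_trans[OF abs_triangle_ineq] add_mono L2_inner_Cauchy_Schwarz L2_component LT
            wgrad(1) H1_imp_L2 qH)
      also have "\<dots> \<le> t i * H1_norm \<Omega> q"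
        using two_term_Cauchy_Schwarz unfolding t_def H1_norm_def by (subst (3) add.commute)
      finally show ?thesis .
    qed
    show ?thesis
    proof (cases "t i = 0")
      case True
      obtain q where "is_trace \<Omega> q (\<lambda>x. u x $ i)" using ui[of i] by (auto simp: Hhalf_def)
      with le True show ?thesis by fastforce
    next
      case False
      then have t1: "t i > 0" using t0[of i] by simp
      have "\<bar>?y\<bar> / t i \<le> h i"
        unfolding h_def Hhalf_norm_def using ui[of i] le t1
        by (intro cINF_greatest) (auto simp: Hhalf_def field_simps)
      then show ?thesis using t1 by (simp add: field_simps)
    qed
  qed
  then have "\<bar>y\<bar> \<le> (\<Sum>i\<in>UNIV. t i * h i)"
    unfolding \<eta>(2) by (simp add: order_trans[OF sum_abs sum_mono])
  also have "\<dots> \<le> L2_set t UNIV * L2_set h UNIV"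
    using L2_set_mult_ineq[of t h UNIV] t0 h0 by simp
  also have "L2_set t UNIV = norm_Y \<Omega> \<tau>"
    unfolding L2_set_def norm_Y_def t_def
    by (simp add: L2_norm_square_components[OF LT(1)] L2_norm_square_components[OF LT(2)] sum.distrib)
  also have "L2_set h UNIV = Hhalf_vec_norm \<Omega> u"
    by (simp add: L2_set_def Hhalf_vec_norm_def h_def)
  finally show ?thesis .
qed

section \<open>The bilinear form for a given permeability tensor\<close>

lemma trace_eq_inner: "trace A = A \<bullet> mat 1" for A :: "real^2^2"
  by (simp add: trace_def inner_vec_def mat_def sum_2)

lemma norm_mat_1: "norm (mat 1 :: real^2^2) = sqrt 2"
  by (simp add: norm_eq_sqrt_inner inner_vec_def mat_def sum_2)

lemma abs_trace_le: "\<bar>trace A\<bar> \<le> sqrt 2 * norm A" for A :: "real^2^2"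
  using Cauchy_Schwarz_ineq2[of A "mat 1"] by (simp add: trace_eq_inner norm_mat_1 mult.commute)

text \<open>Rounding the square root up keeps the constants below rational.\<close>

lemma abs_trace_le_2: "\<bar>trace A\<bar> \<le> 2 * norm A" for A :: "real^2^2"
proof -
  have "sqrt 2 \<le> (2::real)" by (rule real_le_lsqrt) auto
  then show ?thesis using abs_trace_le[of A] mult_right_mono[of "sqrt 2" 2 "norm A"] by simp
qed

lemma bounded_linear_trace: "bounded_linear (trace :: real^2^2 \<Rightarrow> real)"
  unfolding trace_eq_inner[abs_def] by (rule bounded_linear_inner_left)

lemma bounded_linear_elasticity: "bounded_linear (elasticity lam mu)"
  unfolding elasticity_def[abs_def]
  by (intro bounded_linear_add bounded_linear_scaleR_right bounded_linear_scaleR_const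
      bounded_linear_const_mult bounded_linear_trace bounded_linear_ident)

lemma norm_elasticity_le:
  assumes "lam > 0" "mu > 0"
  shows "norm (elasticity lam mu A) \<le> (2 * mu + 2 * lam) * norm A"
proof -
  have "norm (elasticity lam mu A) \<le> lam * \<bar>trace A\<bar> * sqrt 2 + 2 * mu * norm A"
    unfolding elasticity_def using assms
    by (intro order_trans[OF norm_triangle_ineq]) (simp add: norm_mat_1 abs_mult)
  also have "lam * \<bar>trace A\<bar> * sqrt 2 \<le> lam * (sqrt 2 * norm A) * sqrt 2"
    using assms abs_trace_le by (intro mult_right_mono mult_left_mono) auto
  finally show ?thesis by (simp add: algebra_simps)
qed

lemma elasticity_coercive: "lam > 0 \<Longrightarrow> 2 * mu * (norm A)\<^sup>2 \<le> elasticity lam mu A \<bullet> A"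
  unfolding elasticity_def inner_add_left
  using mult_nonneg_nonneg[of lam "trace A * trace A"]
  by (simp add: mult.assoc inner_commute[of "mat 1"] trace_eq_inner[symmetric] power2_norm_eq_inner)

lemma norm_matrix_vector_le: "norm (A *v v) \<le> norm A * norm v" for A :: "real^2^2"
proof -
  have "norm (A *v v) = L2_set (\<lambda>i. \<bar>A $ i \<bullet> v\<bar>) UNIV"
    by (simp add: norm_vec_def matrix_vector_mul_component)
  also have "\<dots> \<le> L2_set (\<lambda>i. norm (A $ i) * norm v) UNIV"
    by (intro L2_set_mono) (auto simp: Cauchy_Schwarz_ineq2)
  also have "\<dots> = norm A * norm v"
    by (simp add: norm_vec_def[of A] L2_set_left_distrib)
  finally show ?thesis .
qed

lemma LinfE:
  assumes "k \<in> Linf \<Omega>" obtains M where "M \<ge> 0" "AE x in lebesgue_on \<Omega>. norm (k x) \<le> M"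
proof -
  have "Linf_norm \<Omega> k < \<infinity>" using assms by (simp add: Linf_def)
  then obtain M where M: "Linf_norm \<Omega> k \<le> ereal M" by (cases "Linf_norm \<Omega> k") auto
  have "AE x in lebesgue_on \<Omega>. ereal (norm (k x)) \<le> Linf_norm \<Omega> k"
    unfolding Linf_norm_def by (rule esssup_AE)
  then have "AE x in lebesgue_on \<Omega>. norm (k x) \<le> max M 0"
    by eventually_elim (use M in \<open>auto dest: order_trans simp: le_max_iff_disj\<close>)
  then show thesis by (rule that[rotated]) simp
qed

lemma Linf_norm_le_AE:
  assumes "Linf_norm \<Omega> k \<le> ereal c" shows "AE x in lebesgue_on \<Omega>. norm (k x) \<le> c"
proof -
  have "AE x in lebesgue_on \<Omega>. ereal (norm (k x)) \<le> Linf_norm \<Omega> k"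
    unfolding Linf_norm_def by (rule esssup_AE)
  then show ?thesis by eventually_elim (use assms in \<open>auto dest: order_trans\<close>)
qed

lemma matrix_vector_measurable:
  fixes k :: tensor_field
  assumes "k \<in> borel_measurable M" "G \<in> borel_measurable M"
  shows "(\<lambda>x. k x *v G x) \<in> borel_measurable M"
proof (rule borel_measurable_continuous_Pair[OF assms])
  show "continuous_on UNIV (\<lambda>x. fst x *v snd x :: real^2)"
    unfolding matrix_vector_mult_def by (intro continuous_intros)
qed

lemma matrix_vector_L2:
  fixes k :: tensor_field
  assumes k: "k \<in> borel_measurable (lebesgue_on \<Omega>)" "AE x in lebesgue_on \<Omega>. norm (k x) \<le> M" "M \<ge> 0"
    and G: "G \<in> L2 \<Omega>"
  shows "(\<lambda>x. k x *v G x) \<in> L2 \<Omega>" "L2_norm \<Omega> (\<lambda>x. k x *v G x) \<le> M * L2_norm \<Omega> G"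
proof -
  have m: "(\<lambda>x. k x *v G x) \<in> borel_measurable (lebesgue_on \<Omega>)"
    by (rule matrix_vector_measurable[OF k(1) L2_measurable[OF G]])
  have "AE x in lebesgue_on \<Omega>. norm (k x *v G x) \<le> M * norm (G x)"
    using k(2) by eventually_elim
      (meson norm_matrix_vector_le mult_right_mono norm_ge_zero order_trans)
  from L2_bounded_by[OF m G this] k(3)
  show "(\<lambda>x. k x *v G x) \<in> L2 \<Omega>" "L2_norm \<Omega> (\<lambda>x. k x *v G x) \<le> M * L2_norm \<Omega> G" by auto
qed

lemma Linf_matrix_vector_L2: "k \<in> Linf \<Omega> \<Longrightarrow> G \<in> L2 \<Omega> \<Longrightarrow> (\<lambda>x. k x *v G x) \<in> L2 \<Omega>"
  by (rule LinfE, assumption, rule matrix_vector_L2(1)) (simp_all add: Linf_def)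

lemma form_a_eq_L2_inner:
  "form_a \<Omega> \<kappa> lam mu \<alpha> c0 (d, p) (e, q) =
    L2_inner \<Omega> (\<lambda>x. elasticity lam mu (d x)) e
    + L2_inner \<Omega> (\<lambda>x. \<kappa> (d, p) x *v wgrad \<Omega> p x) (wgrad \<Omega> q)
    + c0 * L2_inner \<Omega> p q + \<alpha> * L2_inner \<Omega> q (\<lambda>x. trace (d x)) - \<alpha> * L2_inner \<Omega> p (\<lambda>x. trace (e x))"
  by (simp add: form_a_def L2_inner_def)

locale biot_form =
  fixes \<Omega> :: "(real^2) set" and lam mu \<alpha> c0 :: real
  assumes \<Omega>: "open \<Omega>" "bounded \<Omega>"
    and params: "lam > 0" "mu > 0" "0 \<le> \<alpha>" "c0 > 0"
begin

text \<open>The linearised form: the tensor field \<open>k\<close> replaces the permeability of the first argument.\<close>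

abbreviation A :: "tensor_field \<Rightarrow> tensor_field \<times> scalar_field \<Rightarrow> tensor_field \<times> scalar_field \<Rightarrow> real" where
  "A k \<equiv> form_a \<Omega> (\<lambda>_. k) lam mu \<alpha> c0"

lemma form_a_eq_A: "form_a \<Omega> \<kappa> lam mu \<alpha> c0 \<delta> \<epsilon> = A (\<kappa> \<delta>) \<delta> \<epsilon>"
  by (simp add: form_a_def split: prod.split)

lemmas A_eq = form_a_eq_L2_inner[where \<kappa> = "\<lambda>_. k" for k]

lemma elasticity_L2: "d \<in> L2 \<Omega> \<Longrightarrow> (\<lambda>x. elasticity lam mu (d x)) \<in> L2 \<Omega>"
  "d \<in> L2 \<Omega> \<Longrightarrow> L2_norm \<Omega> (\<lambda>x. elasticity lam mu (d x)) \<le> (2 * mu + 2 * lam) * L2_norm \<Omega> d"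
  using L2_bounded_linear[OF bounded_linear_elasticity norm_elasticity_le] params by auto

lemma trace_L2:
  fixes d :: tensor_field
  assumes "d \<in> L2 \<Omega>"
  shows "(\<lambda>x. trace (d x)) \<in> L2 \<Omega>" "L2_norm \<Omega> (\<lambda>x. trace (d x)) \<le> 2 * L2_norm \<Omega> d"
  using L2_bounded_linear[OF bounded_linear_trace _ _ assms, of 2] abs_trace_le_2 by auto

lemma L2_inner_trace_diff:
  fixes d e :: tensor_field
  assumes "d \<in> L2 \<Omega>" "e \<in> L2 \<Omega>" "q \<in> L2 \<Omega>"
  shows "L2_inner \<Omega> q (\<lambda>x. trace ((d - e) x)) = L2_inner \<Omega> q (\<lambda>x. trace (d x)) - L2_inner \<Omega> q (\<lambda>x. trace (e x))"
  using L2_inner_diff_right[OF trace_L2(1)[OF assms(1)] trace_L2(1)[OF assms(2)] assms(3)]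
  by (simp add: fun_diff_def trace_sub)

lemma A_diff_right:
  assumes k: "k \<in> Linf \<Omega>" and d: "d \<in> L2 \<Omega>" and p: "p \<in> H1 \<Omega>"
    and e: "e \<in> L2 \<Omega>" "e' \<in> L2 \<Omega>" and q: "q \<in> H1 \<Omega>" "q' \<in> H1 \<Omega>"
  shows "A k (d, p) (e - e', q - q') = A k (d, p) (e, q) - A k (d, p) (e', q')"
proof -
  have G: "(\<lambda>x. k x *v wgrad \<Omega> p x) \<in> L2 \<Omega>" by (rule Linf_matrix_vector_L2[OF k wgrad(1)[OF p]])
  have w: "L2_inner \<Omega> (\<lambda>x. k x *v wgrad \<Omega> p x) (wgrad \<Omega> (q - q'))
      = L2_inner \<Omega> (\<lambda>x. k x *v wgrad \<Omega> p x) (wgrad \<Omega> q - wgrad \<Omega> q')"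
    unfolding L2_inner_commute[of _ "\<lambda>x. k x *v wgrad \<Omega> p x"]
    using H1_diff[OF \<Omega> q]
    by (intro L2_inner_cong_AE wgrad(1) L2_diff q G) auto
  show ?thesis
    unfolding A_eq w L2_inner_trace_diff[OF e H1_imp_L2[OF p]]
      L2_inner_diff_right[OF e elasticity_L2(1)[OF d]]
      L2_inner_diff_right[OF wgrad(1)[OF q(1)] wgrad(1)[OF q(2)] G]
      L2_inner_diff_right[OF H1_imp_L2[OF q(1)] H1_imp_L2[OF q(2)] H1_imp_L2[OF p]]
      L2_inner_diff_left[OF H1_imp_L2[OF q(1)] H1_imp_L2[OF q(2)] trace_L2(1)[OF d]]
    by (simp add: algebra_simps)
qed

lemma A_diff_left:
  assumes k: "k \<in> Linf \<Omega>" and d: "d \<in> L2 \<Omega>" "d' \<in> L2 \<Omega>" and p: "p \<in> H1 \<Omega>" "p' \<in> H1 \<Omega>"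
    and e: "e \<in> L2 \<Omega>" and q: "q \<in> H1 \<Omega>"
  shows "A k (d - d', p - p') (e, q) = A k (d, p) (e, q) - A k (d', p') (e, q)"
proof -
  have G: "(\<lambda>x. k x *v wgrad \<Omega> s x) \<in> L2 \<Omega>" if "s \<in> H1 \<Omega>" for s
    by (rule Linf_matrix_vector_L2[OF k wgrad(1)[OF that]])
  have "L2_inner \<Omega> (\<lambda>x. k x *v wgrad \<Omega> (p - p') x) (wgrad \<Omega> q)
      = L2_inner \<Omega> ((\<lambda>x. k x *v wgrad \<Omega> p x) - (\<lambda>x. k x *v wgrad \<Omega> p' x)) (wgrad \<Omega> q)"
  proof (rule L2_inner_cong_AE[OF G[OF H1_diff(1)[OF \<Omega> p]] L2_diff[OF G[OF p(1)] G[OF p(2)]] wgrad(1)[OF q]])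
    show "AE x in lebesgue_on \<Omega>. k x *v wgrad \<Omega> (p - p') x
        = ((\<lambda>x. k x *v wgrad \<Omega> p x) - (\<lambda>x. k x *v wgrad \<Omega> p' x)) x"
      using H1_diff(2)[OF \<Omega> p] by eventually_elim (simp add: matrix_vector_mult_diff_distrib)
  qed
  then have w: "L2_inner \<Omega> (\<lambda>x. k x *v wgrad \<Omega> (p - p') x) (wgrad \<Omega> q)
      = L2_inner \<Omega> (\<lambda>x. k x *v wgrad \<Omega> p x) (wgrad \<Omega> q) - L2_inner \<Omega> (\<lambda>x. k x *v wgrad \<Omega> p' x) (wgrad \<Omega> q)"
    by (simp only: L2_inner_diff_left[OF G[OF p(1)] G[OF p(2)] wgrad(1)[OF q]])
  have el: "(\<lambda>x. elasticity lam mu ((d - d') x)) = (\<lambda>x. elasticity lam mu (d x)) - (\<lambda>x. elasticity lam mu (d' x))"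
    using linear_diff[OF bounded_linear.linear[OF bounded_linear_elasticity]] by (simp add: fun_eq_iff)
  show ?thesis
    unfolding A_eq w el L2_inner_trace_diff[OF d H1_imp_L2[OF q]]
      L2_inner_diff_left[OF elasticity_L2(1)[OF d(1)] elasticity_L2(1)[OF d(2)] e]
      L2_inner_diff_left[OF H1_imp_L2[OF p(1)] H1_imp_L2[OF p(2)] H1_imp_L2[OF q]]
      L2_inner_diff_left[OF H1_imp_L2[OF p(1)] H1_imp_L2[OF p(2)] trace_L2(1)[OF e]]
    by (simp add: algebra_simps)
qed

lemma A_coercive:
  assumes k: "k \<in> Linf \<Omega>"
    and elliptic: "AE x in lebesgue_on \<Omega>. \<forall>v. v \<noteq> 0 \<longrightarrow> \<kappa>1 * (norm v)\<^sup>2 \<le> v \<bullet> (k x *v v)"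
    and d: "d \<in> L2 \<Omega>" and p: "p \<in> H1 \<Omega>"
  shows "const_ca mu c0 \<kappa>1 * (norm_X \<Omega> (d, p))\<^sup>2 \<le> A k (d, p) (d, p)"
proof -
  let ?G = "wgrad \<Omega> p" and ?c = "const_ca mu c0 \<kappa>1"
  have G: "?G \<in> L2 \<Omega>" by (rule wgrad(1)[OF p])
  have c: "?c \<le> \<kappa>1" "?c \<le> 2 * mu" "?c \<le> c0" by (auto simp: const_ca_def)
  have "2 * mu * (L2_norm \<Omega> d)\<^sup>2 \<le> L2_inner \<Omega> (\<lambda>x. elasticity lam mu (d x)) d"
    unfolding L2_inner_self[symmetric] L2_inner_def integral_mult_right_zero[symmetric]
    by (intro integral_mono integrable_mult_right integrable_L2_inner elasticity_L2 d)
      (use elasticity_coercive[of lam mu] params in \<open>simp add: power2_norm_eq_inner\<close>)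
  moreover have "\<kappa>1 * (L2_norm \<Omega> ?G)\<^sup>2 \<le> L2_inner \<Omega> (\<lambda>x. k x *v ?G x) ?G"
    unfolding L2_inner_self[symmetric] L2_inner_def integral_mult_right_zero[symmetric]
  proof (rule integral_mono_AE)
    show "AE x in lebesgue_on \<Omega>. \<kappa>1 * (?G x \<bullet> ?G x) \<le> (k x *v ?G x) \<bullet> ?G x"
      using elliptic
    proof eventually_elim
      case (elim x)
      then show ?case
        by (cases "?G x = 0") (simp_all add: power2_norm_eq_inner inner_commute)
    qed
  qed (intro integrable_mult_right integrable_L2_inner Linf_matrix_vector_L2 G k)+
  moreover have "?c * (L2_norm \<Omega> d)\<^sup>2 \<le> 2 * mu * (L2_norm \<Omega> d)\<^sup>2"
    "?c * (L2_norm \<Omega> ?G)\<^sup>2 \<le> \<kappa>1 * (L2_norm \<Omega> ?G)\<^sup>2" "?c * (L2_norm \<Omega> p)\<^sup>2 \<le> c0 * (L2_norm \<Omega> p)\<^sup>2"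
    using c by (auto intro: mult_right_mono)
  ultimately show ?thesis
    unfolding A_eq norm_X_square L2_inner_self H1_norm_def by (simp add: algebra_simps)
qed

lemma A_bound:
  assumes k: "k \<in> Linf \<Omega>" "AE x in lebesgue_on \<Omega>. norm (k x) \<le> M" "M \<ge> 0"
    and d: "d \<in> L2 \<Omega>" and p: "p \<in> H1 \<Omega>" and e: "e \<in> L2 \<Omega>" and q: "q \<in> H1 \<Omega>"
  shows "\<bar>A k (d, p) (e, q)\<bar> \<le> (2 * mu + 2 * lam + M + c0 + 4 * \<alpha>) * norm_X \<Omega> (d, p) * norm_X \<Omega> (e, q)"
proof -
  define x y where "x = norm_X \<Omega> (d, p)" and "y = norm_X \<Omega> (e, q)"
  have xy: "x \<ge> 0" "y \<ge> 0" by (auto simp: x_def y_def norm_X_nonneg)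
  have x: "L2_norm \<Omega> d \<le> x" "L2_norm \<Omega> p \<le> x" "L2_norm \<Omega> (wgrad \<Omega> p) \<le> x"
    and y: "L2_norm \<Omega> e \<le> y" "L2_norm \<Omega> q \<le> y" "L2_norm \<Omega> (wgrad \<Omega> q) \<le> y"
    unfolding x_def y_def using norm_X_ge L2_norm_le_H1_norm order_trans by blast+
  have km: "k \<in> borel_measurable (lebesgue_on \<Omega>)" using k(1) by (simp add: Linf_def)
  note kL = matrix_vector_L2[OF km k(2,3) wgrad(1)[OF p]]
  have CS: "\<bar>L2_inner \<Omega> f g\<bar> \<le> (a * x) * (b * y)"
    if "f \<in> L2 \<Omega>" "g \<in> L2 \<Omega>" "L2_norm \<Omega> f \<le> a * x" "L2_norm \<Omega> g \<le> b * y" "a \<ge> 0"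
    for f g :: "real^2 \<Rightarrow> 'b::euclidean_space" and a b
    using L2_inner_Cauchy_Schwarz[OF that(1,2)] mult_mono[OF that(3,4)] that(5) xy L2_norm_nonneg
    by (meson mult_nonneg_nonneg order_trans)
  have "L2_norm \<Omega> (\<lambda>x. elasticity lam mu (d x)) \<le> (2 * mu + 2 * lam) * x"
    by (rule order_trans[OF elasticity_L2(2)[OF d] mult_left_mono[OF x(1)]]) (use params in simp)
  then have "\<bar>L2_inner \<Omega> (\<lambda>x. elasticity lam mu (d x)) e\<bar> \<le> ((2 * mu + 2 * lam) * x) * (1 * y)"
    using elasticity_L2(1)[OF d] params y by (intro CS e) auto
  moreover have "\<bar>L2_inner \<Omega> (\<lambda>x. k x *v wgrad \<Omega> p x) (wgrad \<Omega> q)\<bar> \<le> (M * x) * (1 * y)"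
    using kL mult_left_mono[OF x(3) k(3)] y k(3) by (intro CS wgrad(1) q) auto
  moreover have "\<bar>L2_inner \<Omega> p q\<bar> \<le> (1 * x) * (1 * y)"
    using x y by (intro CS H1_imp_L2 p q) auto
  moreover have "\<bar>L2_inner \<Omega> q (\<lambda>x. trace (d x))\<bar> \<le> (2 * x) * (1 * y)"
    unfolding L2_inner_commute[of _ q] using trace_L2[OF d] x y H1_imp_L2[OF q] by (intro CS) auto
  moreover have "\<bar>L2_inner \<Omega> p (\<lambda>x. trace (e x))\<bar> \<le> (1 * x) * (2 * y)"
    using trace_L2[OF e] x y H1_imp_L2[OF p] by (intro CS) auto
  moreover have "\<bar>s1 + s2 + c0 * s3 + \<alpha> * s4 - \<alpha> * s5\<bar> \<le> \<bar>s1\<bar> + \<bar>s2\<bar> + c0 * \<bar>s3\<bar> + \<alpha> * \<bar>s4\<bar> + \<alpha> * \<bar>s5\<bar>"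
    for s1 s2 s3 s4 s5 :: real
  proof -
    have "\<bar>c0 * s3\<bar> = c0 * \<bar>s3\<bar>" "\<bar>\<alpha> * s4\<bar> = \<alpha> * \<bar>s4\<bar>" "\<bar>\<alpha> * s5\<bar> = \<alpha> * \<bar>s5\<bar>"
      using params by (auto simp: abs_mult)
    then show ?thesis by linarith
  qed
  note tri = this[of "L2_inner \<Omega> (\<lambda>x. elasticity lam mu (d x)) e"
      "L2_inner \<Omega> (\<lambda>x. k x *v wgrad \<Omega> p x) (wgrad \<Omega> q)" "L2_inner \<Omega> p q"
      "L2_inner \<Omega> q (\<lambda>x. trace (d x))" "L2_inner \<Omega> p (\<lambda>x. trace (e x))"]
  ultimately have "\<bar>A k (d, p) (e, q)\<bar> \<le> ((2 * mu + 2 * lam) * x) * (1 * y) + (M * x) * (1 * y)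
      + c0 * ((1 * x) * (1 * y)) + \<alpha> * ((2 * x) * (1 * y)) + \<alpha> * ((1 * x) * (2 * y))"
    unfolding A_eq using params by (intro order_trans[OF tri] add_mono mult_left_mono) auto
  then show ?thesis unfolding x_def[symmetric] y_def[symmetric] by (simp add: algebra_simps)
qed

lemma A_perturbation:
  assumes k: "k \<in> Linf \<Omega>" "k' \<in> Linf \<Omega>" "AE x in lebesgue_on \<Omega>. norm (k x - k' x) \<le> B" "B \<ge> 0"
    and d: "d \<in> L2 \<Omega>" and p: "p \<in> H1 \<Omega>" and e: "e \<in> L2 \<Omega>" and q: "q \<in> H1 \<Omega>"
  shows "\<bar>A k (d, p) (e, q) - A k' (d, p) (e, q)\<bar> \<le> B * norm_X \<Omega> (d, p) * norm_X \<Omega> (e, q)"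
proof -
  let ?P = "wgrad \<Omega> p" and ?Q = "wgrad \<Omega> q"
  have G: "?P \<in> L2 \<Omega>" "?Q \<in> L2 \<Omega>" using wgrad(1) p q by auto
  have le: "L2_norm \<Omega> ?P \<le> norm_X \<Omega> (d, p)" "L2_norm \<Omega> ?Q \<le> norm_X \<Omega> (e, q)"
    using L2_norm_le_H1_norm(2) norm_X_ge(2) order_trans by blast+
  have "(\<lambda>x. k x - k' x) \<in> borel_measurable (lebesgue_on \<Omega>)"
    using k(1,2) by (auto simp: Linf_def)
  note L = matrix_vector_L2[OF this k(3,4) G(1)]
  have "A k (d, p) (e, q) - A k' (d, p) (e, q)
      = L2_inner \<Omega> ((\<lambda>x. k x *v ?P x) - (\<lambda>x. k' x *v ?P x)) ?Q"
    unfolding A_eq L2_inner_diff_left[OF Linf_matrix_vector_L2[OF k(1) G(1)] Linf_matrix_vector_L2[OF k(2) G(1)] G(2)]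
    by simp
  also have "(\<lambda>x. k x *v ?P x) - (\<lambda>x. k' x *v ?P x) = (\<lambda>x. (k x - k' x) *v ?P x)"
    by (simp add: fun_eq_iff matrix_vector_mult_diff_rdistrib)
  also have "\<bar>L2_inner \<Omega> \<dots> ?Q\<bar> \<le> (B * L2_norm \<Omega> ?P) * L2_norm \<Omega> ?Q"
    using L2_inner_Cauchy_Schwarz[OF L(1) G(2)] mult_right_mono[OF L(2) L2_norm_nonneg[of \<Omega> ?Q]] by linarith
  also have "\<dots> \<le> (B * norm_X \<Omega> (d, p)) * norm_X \<Omega> (e, q)"
    using le k(4) by (intro mult_mono mult_left_mono mult_nonneg_nonneg L2_norm_nonneg norm_X_nonneg)
  finally show ?thesis .
qed

text \<open>The permeability multiplies the gradient of the pressure test function, so a pure strain does not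
  see it.\<close>

lemma A_stress:
  assumes k: "k \<in> Linf \<Omega>" and d: "d \<in> L2 \<Omega>" and p: "p \<in> H1 \<Omega>" and e: "e \<in> L2 \<Omega>"
  shows "A k (d, p) (e, \<lambda>x. 0) = L2_inner \<Omega> (\<lambda>x. elasticity lam mu (d x)) e - \<alpha> * L2_inner \<Omega> p (\<lambda>x. trace (e x))"
    "\<bar>A k (d, p) (e, \<lambda>x. 0)\<bar> \<le> (2 * mu + 2 * lam + 2 * \<alpha>) * norm_X \<Omega> (d, p) * L2_norm \<Omega> e"
proof -
  have G: "(\<lambda>x. k x *v wgrad \<Omega> p x) \<in> L2 \<Omega>" by (rule Linf_matrix_vector_L2[OF k wgrad(1)[OF p]])
  have "L2_inner \<Omega> (wgrad \<Omega> (\<lambda>x. 0)) (\<lambda>x. k x *v wgrad \<Omega> p x) = L2_inner \<Omega> (\<lambda>x. 0) (\<lambda>x. k x *v wgrad \<Omega> p x)"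
    by (intro L2_inner_cong_AE wgrad(1) H1_zero[OF \<Omega>] L2_zero G)
  then show *: "A k (d, p) (e, \<lambda>x. 0) = L2_inner \<Omega> (\<lambda>x. elasticity lam mu (d x)) e - \<alpha> * L2_inner \<Omega> p (\<lambda>x. trace (e x))"
    unfolding A_eq by (simp add: L2_inner_commute[of _ "\<lambda>x. k x *v wgrad \<Omega> p x"] L2_inner_def)
  have x: "L2_norm \<Omega> d \<le> norm_X \<Omega> (d, p)" "L2_norm \<Omega> p \<le> norm_X \<Omega> (d, p)"
    using norm_X_ge L2_norm_le_H1_norm(1) order_trans by blast+
  have "\<bar>L2_inner \<Omega> (\<lambda>x. elasticity lam mu (d x)) e\<bar> \<le> ((2 * mu + 2 * lam) * norm_X \<Omega> (d, p)) * L2_norm \<Omega> e"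
    using L2_inner_Cauchy_Schwarz[OF elasticity_L2(1)[OF d] e]
      mult_right_mono[OF order_trans[OF elasticity_L2(2)[OF d] mult_left_mono[OF x(1)]] L2_norm_nonneg[of \<Omega> e]] params
    by auto
  moreover have "\<bar>L2_inner \<Omega> p (\<lambda>x. trace (e x))\<bar> \<le> norm_X \<Omega> (d, p) * (2 * L2_norm \<Omega> e)"
    using L2_inner_Cauchy_Schwarz[OF H1_imp_L2[OF p] trace_L2(1)[OF e]]
      mult_mono[OF x(2) trace_L2(2)[OF e] norm_X_nonneg L2_norm_nonneg] by linarith
  then have "\<bar>\<alpha> * L2_inner \<Omega> p (\<lambda>x. trace (e x))\<bar> \<le> \<alpha> * (norm_X \<Omega> (d, p) * (2 * L2_norm \<Omega> e))"
    unfolding abs_mult using params by (simp add: mult_left_mono)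
  ultimately show "\<bar>A k (d, p) (e, \<lambda>x. 0)\<bar> \<le> (2 * mu + 2 * lam + 2 * \<alpha>) * norm_X \<Omega> (d, p) * L2_norm \<Omega> e"
    unfolding * by (simp add: algebra_simps)
qed

end

section \<open>Discrete spaces\<close>

lemma lipschitz_domainD:
  assumes "lipschitz_domain \<Omega>" shows "open \<Omega>" "bounded \<Omega>" "\<Omega> \<noteq> {}"
  using assms by (simp_all add: lipschitz_domain_def)

text \<open>A boundary point has points of the open subgraph, hence of the exterior, arbitrarily close
  to it; so no triangle of a partition can have a boundary point of the domain in its interior.\<close>

lemma interior_closure_lipschitz_domain:
  assumes \<Omega>: "lipschitz_domain \<Omega>" shows "interior (closure \<Omega>) \<subseteq> \<Omega>"
proof (rule subsetI, rule ccontr)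
  fix x assume x: "x \<in> interior (closure \<Omega>)" "x \<notin> \<Omega>"
  then have "x \<in> frontier \<Omega>"
    using lipschitz_domainD(1)[OF \<Omega>] interior_subset by (auto simp: frontier_def interior_open)
  then obtain \<rho> and R :: "real^2 \<Rightarrow> real^2" and \<phi> :: "real \<Rightarrow> real" and L
    where \<rho>: "\<rho> > 0" and R: "orthogonal_transformation R"
    and \<phi>: "L-lipschitz_on UNIV \<phi>"
    and eq: "\<Omega> \<inter> ball x \<rho> = {y \<in> ball x \<rho>. R (y - x) $ 2 > \<phi> (R (y - x) $ 1)}"
    using \<Omega> unfolding lipschitz_domain_def by blast
  have lin: "linear R" using R by (rule orthogonal_transformation_linear)
  have R0: "R 0 = 0" using lin by (rule linear_0)
  have "x \<notin> {y \<in> ball x \<rho>. R (y - x) $ 2 > \<phi> (R (y - x) $ 1)}"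
    using x(2) eq by blast
  then have \<phi>0: "0 \<le> \<phi> 0" using \<rho> by (simp add: R0)
  obtain w where w: "R w = axis 2 1"
    using orthogonal_transformation_surj[OF R] by (metis surjD)
  have "norm w = 1" using orthogonal_transformation_norm[OF R, of w] by (simp add: w norm_axis_1)
  obtain \<epsilon> where \<epsilon>: "\<epsilon> > 0" "ball x \<epsilon> \<subseteq> closure \<Omega>"
    using x(1) by (meson mem_interior)
  define t where "t = min \<epsilon> \<rho> / 2"
  have t: "t > 0" "t < \<epsilon>" "t < \<rho>" using \<epsilon> \<rho> by (auto simp: t_def)
  define y where "y = x - t *\<^sub>R w"
  have dist: "dist x y = t" using t \<open>norm w = 1\<close> by (simp add: y_def dist_norm)
  have "R (y - x) = - t *\<^sub>R axis 2 1"
    using w linear_scale[OF lin, of "- t" w] by (simp add: y_def)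
  then have "R (y - x) $ 2 = - t" "R (y - x) $ 1 = 0" by (simp_all add: axis_def)
  then have less: "R (y - x) $ 2 < \<phi> (R (y - x) $ 1)" using t \<phi>0 by simp
  define V where "V = ball x \<rho> \<inter> {z. R (z - x) $ 2 < \<phi> (R (z - x) $ 1)}"
  have Rc: "continuous_on UNIV (\<lambda>z. R (z - x))"
    using lin by (intro linear_continuous_on_compose[of _ _ R] continuous_intros)
  have comp: "continuous_on UNIV (\<lambda>z. R (z - x) $ i)" for i
    by (rule bounded_linear.continuous_on[OF bounded_linear_vec_nth Rc])
  have "continuous_on UNIV (\<lambda>z. \<phi> (R (z - x) $ 1))"
    by (rule continuous_on_compose2[OF lipschitz_on_continuous_on[OF \<phi>] comp subset_UNIV])
  then have "open V"
    unfolding V_def by (intro open_Int open_ball open_Collect_less comp)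
  moreover have "z \<notin> \<Omega>" if z: "z \<in> V" for z
  proof
    assume "z \<in> \<Omega>"
    then have "z \<in> {y \<in> ball x \<rho>. R (y - x) $ 2 > \<phi> (R (y - x) $ 1)}"
      unfolding eq[symmetric] using z by (simp add: V_def)
    then show False using z by (simp add: V_def)
  qed
  then have "V \<inter> \<Omega> = {}" by blast
  ultimately have "V \<inter> closure \<Omega> = {}" by (simp add: open_Int_closure_eq_empty)
  moreover have "y \<in> V" using dist t less by (simp add: V_def)
  moreover have "y \<in> closure \<Omega>" using \<epsilon> dist t by auto
  ultimately show False by blast
qed

lemma poly_deg_le_const: "(\<lambda>x. a) \<in> poly_deg_le l"
proof -
  have fin: "finite {(i, j). i + j \<le> l}"
    by (rule finite_subset[of _ "{..l} \<times> {..l}"]) auto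
  have "(\<Sum>(i, j) \<in> {(i, j). i + j \<le> l}. (if i = 0 \<and> j = 0 then a else 0) * (x $ 1) ^ i * (x $ 2) ^ j)
      = (\<Sum>p \<in> {(i, j). i + j \<le> l}. if p = (0, 0) then a else 0)" for x :: "real^2"
  proof (rule sum.cong[OF refl])
    fix p :: "nat \<times> nat"
    show "(case p of (i, j) \<Rightarrow> (if i = 0 \<and> j = 0 then a else 0) * (x $ 1) ^ i * (x $ 2) ^ j)
        = (if p = (0, 0) then a else 0)"
      by (cases p, cases "p = (0, 0)") auto
  qed
  also have "\<dots> = a" using fin by simp
  finally show ?thesis
    unfolding poly_deg_le_def by (intro CollectI exI[of _ "\<lambda>i j. if i = 0 \<and> j = 0 then a else 0"]) simp
qed

lemma poly_deg_le_diff: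
  assumes "P \<in> poly_deg_le l" "Q \<in> poly_deg_le l" shows "(\<lambda>x. P x - Q x) \<in> poly_deg_le l"
proof -
  obtain c where c: "\<And>x. P x = (\<Sum>(i, j) \<in> {(i, j). i + j \<le> l}. c i j * (x $ 1) ^ i * (x $ 2) ^ j)"
    using assms(1) unfolding poly_deg_le_def by blast
  obtain d where d: "\<And>x. Q x = (\<Sum>(i, j) \<in> {(i, j). i + j \<le> l}. d i j * (x $ 1) ^ i * (x $ 2) ^ j)"
    using assms(2) unfolding poly_deg_le_def by blast
  show ?thesis
    unfolding poly_deg_le_def
    by (intro CollectI exI[of _ "\<lambda>i j. c i j - d i j"])
      (simp add: c d sum_subtractf[symmetric] left_diff_distrib split_def)
qed

lemma poly_on_const: "poly_on l K (\<lambda>x. a)"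
  unfolding poly_on_def using poly_deg_le_const by fastforce

lemma poly_on_diff:
  assumes "poly_on l K f" "poly_on l K g" shows "poly_on l K (f - g)"
  unfolding poly_on_def
proof
  fix b :: 'a assume b: "b \<in> Basis"
  obtain P where P: "P \<in> poly_deg_le l" "AE x in lebesgue_on K. f x \<bullet> b = P x"
    using assms(1) b unfolding poly_on_def by blast
  obtain Q where Q: "Q \<in> poly_deg_le l" "AE x in lebesgue_on K. g x \<bullet> b = Q x"
    using assms(2) b unfolding poly_on_def by blast
  have "AE x in lebesgue_on K. (f - g) x \<bullet> b = P x - Q x"
    using P(2) Q(2) by eventually_elim (simp add: inner_diff_left)
  then show "\<exists>P\<in>poly_deg_le l. AE x in lebesgue_on K. (f - g) x \<bullet> b = P x"
    by (rule bexI[OF _ poly_deg_le_diff[OF P(1) Q(1)]])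
qed

lemma poly_on_cong_AE:
  assumes "poly_on l K f" and eq: "AE x in lebesgue_on K. f x = g x" shows "poly_on l K g"
  unfolding poly_on_def
proof
  fix b :: 'a assume b: "b \<in> Basis"
  obtain P where P: "P \<in> poly_deg_le l" "AE x in lebesgue_on K. f x \<bullet> b = P x"
    using assms(1) b unfolding poly_on_def by blast
  have "AE x in lebesgue_on K. g x \<bullet> b = P x"
    using P(2) eq by eventually_elim simp
  then show "\<exists>P\<in>poly_deg_le l. AE x in lebesgue_on K. g x \<bullet> b = P x"
    using P(1) by blast
qed

lemma space_Zh_diff: "v \<in> space_Zh \<Omega> \<T> k \<Longrightarrow> w \<in> space_Zh \<Omega> \<T> k \<Longrightarrow> v - w \<in> space_Zh \<Omega> \<T> k"
  unfolding space_Zh_def by (blast intro: L2_diff poly_on_diff)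

lemma tdiv_Yh_in_Zh: "\<tau> \<in> space_Yh \<Omega> \<T> k \<Longrightarrow> tdiv \<Omega> \<tau> \<in> space_Zh \<Omega> \<T> k"
  unfolding space_Zh_def space_Yh_def by (blast intro: space_Y_D)

lemma const_in_space_X2h: "(\<lambda>x. a) \<in> space_X2h \<Omega> \<T> k"
  unfolding space_X2h_def by (simp add: poly_on_const)

lemma AE_lebesgue_on_convex_interior:
  fixes K :: "(real^2) set"
  assumes K: "convex K" "closed K" and P: "AE x in lebesgue_on (interior K). P x"
  shows "AE x in lebesgue_on K. P x"
proof -
  have "AE x in lebesgue. x \<in> interior K \<longrightarrow> P x"
    using P AE_restrict_space_iff[of "interior K" lebesgue P] by simp
  moreover have "AE x in lebesgue. x \<notin> frontier K"
    using negligible_convex_frontier[OF K(1)] by (intro AE_not_in) (simp add: negligible_iff_null_sets)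
  ultimately have "AE x in lebesgue. x \<in> K \<longrightarrow> P x"
    by eventually_elim (use K in \<open>auto simp: frontier_def closure_closed\<close>)
  then show ?thesis using K AE_restrict_space_iff[of K lebesgue P] by simp
qed

text \<open>On each triangle the broken divergence agrees with the global one; so discrete stresses are
  admissible discrete strains.\<close>

lemma space_Yh_subset_X1h:
  assumes \<Omega>: "lipschitz_domain \<Omega>" and \<T>: "regular_partition \<Omega> \<T>" and \<tau>: "\<tau> \<in> space_Yh \<Omega> \<T> k"
  shows "\<tau> \<in> space_X1h \<Omega> \<T> k"
proof -
  have Y: "\<tau> \<in> space_Y \<Omega>" using \<tau> by (simp add: space_Yh_def)
  have "poly_on k K (tdiv (interior K) \<tau>)" if K: "K \<in> \<T>" for K
  proof (rule poly_on_cong_AE)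
    show "poly_on k K (tdiv \<Omega> \<tau>)" using \<tau> K by (simp add: space_Yh_def)
    have simplex: "2 simplex K" using \<T> K by (simp add: regular_partition_def)
    have "K \<subseteq> closure \<Omega>" using \<T> K by (auto simp: regular_partition_def)
    then have "interior K \<subseteq> \<Omega>"
      using interior_mono interior_closure_lipschitz_domain[OF \<Omega>] by blast
    then have "AE x in lebesgue_on (interior K). tdiv (interior K) \<tau> x = tdiv \<Omega> \<tau> x"
      by (intro tdiv_subset[OF open_interior]) (use lipschitz_domainD[OF \<Omega>] Y in auto)
    then have "AE x in lebesgue_on (interior K). tdiv \<Omega> \<tau> x = tdiv (interior K) \<tau> x"
      by eventually_elim simp
    then show "AE x in lebesgue_on K. tdiv \<Omega> \<tau> x = tdiv (interior K) \<tau> x"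
      by (rule AE_lebesgue_on_convex_interior[OF convex_simplex[OF simplex] closed_simplex[OF simplex]])
  qed
  then show ?thesis using \<tau> space_Y_D(1)[OF Y] by (simp add: space_Yh_def space_X1h_def)
qed

section \<open>Bounds for the solution\<close>

lemma L2_norm_const_pos:
  assumes \<Omega>: "open \<Omega>" "bounded \<Omega>" "\<Omega> \<noteq> {}" and a: "a \<noteq> (0 :: 'a::euclidean_space)"
  shows "L2_norm \<Omega> (\<lambda>x. a) > 0"
proof -
  have m: "\<Omega> \<in> lmeasurable" by (rule lmeasurable_open_bounded[OF \<Omega>(1,2)])
  have "\<not> negligible \<Omega>" using open_not_negligible \<Omega> by blast
  then have "measure lebesgue \<Omega> > 0"
    using m by (simp add: negligible_iff_measure0 zero_less_measure_iff)
  moreover have "(L2_norm \<Omega> (\<lambda>x. a))\<^sup>2 = measure lebesgue \<Omega> * (norm a)\<^sup>2"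
    using m fmeasurableD[OF m] by (simp add: L2_norm_def measure_restrict_space)
  ultimately have "(L2_norm \<Omega> (\<lambda>x. a))\<^sup>2 > 0" using a by simp
  then show ?thesis using L2_norm_nonneg[of \<Omega> "\<lambda>x. a"] by (simp add: zero_less_power2 order.strict_iff_order)
qed

text \<open>Dividing by the norm, a bound for \<open>b\<^sub>2\<close> bounds the supremum.  A pair of nonzero norm is required
  because the supremum of the empty set of reals is an unspecified number.\<close>

lemma inf_sup_b2_le:
  assumes inf_sup: "inf_sup_b2 \<Omega> XX YY ZZ \<beta>" and v: "v \<in> ZZ"
    and nontrivial: "w \<in> XX \<times> YY" "norm_XY \<Omega> w \<noteq> 0"
    and B: "B \<ge> 0" "\<And>\<epsilon> \<tau>. \<epsilon> \<in> XX \<Longrightarrow> \<tau> \<in> YY \<Longrightarrow> form_b2 \<Omega> (\<epsilon>, \<tau>) v \<le> B * norm_Y \<Omega> \<tau>"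
  shows "\<beta> * L2_norm \<Omega> v \<le> B"
proof -
  have "\<beta> * L2_norm \<Omega> v \<le> (SUP w \<in> {w \<in> XX \<times> YY. norm_XY \<Omega> w \<noteq> 0}. form_b2 \<Omega> w v / norm_XY \<Omega> w)"
    using inf_sup v by (simp add: inf_sup_b2_def norm_Z_def)
  also have "\<dots> \<le> B"
  proof (rule cSUP_least)
    fix w assume w: "w \<in> {w \<in> XX \<times> YY. norm_XY \<Omega> w \<noteq> 0}"
    obtain \<epsilon> \<tau> where w_eq: "w = (\<epsilon>, \<tau>)" by (cases w)
    have pos: "norm_XY \<Omega> w > 0"
      using w norm_XY_ge(1)[of \<Omega> \<epsilon> \<tau>] norm_X_nonneg[of \<Omega> \<epsilon>] by (simp add: w_eq)
    have "form_b2 \<Omega> w v \<le> B * norm_XY \<Omega> w"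
      using B(2)[of \<epsilon> \<tau>] w mult_left_mono[OF norm_XY_ge(2)[of \<Omega> \<tau> \<epsilon>] B(1)] by (simp add: w_eq)
    then show "form_b2 \<Omega> w v / norm_XY \<Omega> w \<le> B" using pos by (simp add: divide_le_eq)
  qed (use nontrivial in blast)
  finally show ?thesis .
qed

lemma le_of_square_le: "a\<^sup>2 \<le> b * a \<Longrightarrow> b \<ge> 0 \<Longrightarrow> a \<le> b" for a b :: real
  by (cases "a > 0") (auto simp: power2_eq_square)

lemma solves_problemD:
  assumes "solves_problem \<Omega> \<kappa> lam mu \<alpha> c0 f g u\<Gamma> r\<Gamma> XX YY ZZ (((d, p), \<sigma>), u)"
  shows "(d, p) \<in> XX" "\<sigma> \<in> YY" "u \<in> ZZ"
    "\<And>\<epsilon>. \<epsilon> \<in> XX \<Longrightarrow> is_G \<Omega> g r\<Gamma> \<epsilon> (form_a \<Omega> \<kappa> lam mu \<alpha> c0 (d, p) \<epsilon> - L2_inner \<Omega> \<sigma> (fst \<epsilon>))"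
    "\<And>\<tau>. \<tau> \<in> YY \<Longrightarrow> is_H \<Omega> u\<Gamma> \<tau> (- L2_inner \<Omega> \<tau> d - L2_inner \<Omega> u (tdiv \<Omega> \<tau>))"
    "\<And>v. v \<in> ZZ \<Longrightarrow> - L2_inner \<Omega> v (tdiv \<Omega> \<sigma>) = L2_inner \<Omega> f v"
proof -
  note sol = assms[unfolded solves_problem_def prod.case]
  note all = sol[THEN conjunct1] sol[THEN conjunct2, THEN conjunct1]
    sol[THEN conjunct2, THEN conjunct2, THEN conjunct1]
  note eqs = sol[THEN conjunct2, THEN conjunct2, THEN conjunct2, rule_format]
  show "(d, p) \<in> XX" "\<sigma> \<in> YY" "u \<in> ZZ" by (fact all)+
  show "is_G \<Omega> g r\<Gamma> \<epsilon> (form_a \<Omega> \<kappa> lam mu \<alpha> c0 (d, p) \<epsilon> - L2_inner \<Omega> \<sigma> (fst \<epsilon>))" if "\<epsilon> \<in> XX" for \<epsilon>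
    using eqs[OF that all(2,3)] by (cases \<epsilon>) (simp add: form_b1_def)
  show "is_H \<Omega> u\<Gamma> \<tau> (- L2_inner \<Omega> \<tau> d - L2_inner \<Omega> u (tdiv \<Omega> \<tau>))" if "\<tau> \<in> YY" for \<tau>
    using eqs[OF all(1) that all(3)] by (simp add: form_b1_def form_b2_def)
  show "- L2_inner \<Omega> v (tdiv \<Omega> \<sigma>) = L2_inner \<Omega> f v" if "v \<in> ZZ" for v
    using eqs[OF all(1,2) that] by (simp add: form_b2_def form_F_def)
qed

text \<open>The square in the numerator of \<open>\<gamma>\<^sub>1\<close> dominates \<open>\<gamma>\<^sub>2\<^sup>2\<close>, so \<open>\<gamma>\<^sub>1 \<ge> \<gamma>\<^sub>2 / \<beta>\<^sup>2\<close>.  All that the smallness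
  argument needs to know about the constants are the two bounds below.\<close>

lemma const_gamma1_lower_bounds:
  assumes ca: "ca > 0" and Ca: "Ca > 0" and \<beta>: "0 < \<beta>" "\<beta> \<le> 1"
  defines "\<gamma>1 \<equiv> const_gamma1 Ca (const_gamma2 Ca ca) \<beta>"
  shows "2 * (1 + Ca) / \<beta> \<le> ca * \<gamma>1" "2 \<le> \<gamma>1"
proof -
  define \<gamma>2 where "\<gamma>2 = const_gamma2 Ca ca"
  have eq: "ca * \<gamma>2 = (Ca + 2) * (ca + 1 + Ca)"
    using ca by (simp add: \<gamma>2_def const_gamma2_def)
  have \<gamma>2a: "2 * (1 + Ca) \<le> ca * \<gamma>2"
    unfolding eq using ca Ca by (simp add: algebra_simps)
  have "ca * 2 \<le> ca * \<gamma>2"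
    unfolding eq using ca Ca by (simp add: algebra_simps)
  then have "2 \<le> \<gamma>2" using ca by (simp only: mult_le_cancel_left_pos)
  note \<gamma>2 = \<gamma>2a this
  have "\<gamma>2\<^sup>2 \<le> (Ca + 1 + \<beta> + \<gamma>2)\<^sup>2"
    using Ca \<beta> \<gamma>2 by (intro power_mono) auto
  then have "\<gamma>2\<^sup>2 / (\<beta>\<^sup>2 * \<gamma>2) \<le> \<gamma>1"
    unfolding \<gamma>1_def \<gamma>2_def[symmetric] const_gamma1_def using \<gamma>2 by (intro divide_right_mono) auto
  moreover have "\<gamma>2 / \<beta> \<le> \<gamma>2\<^sup>2 / (\<beta>\<^sup>2 * \<gamma>2)"
    using \<beta> \<gamma>2 by (simp add: field_simps power2_eq_square)
  ultimately have le: "\<gamma>2 / \<beta> \<le> \<gamma>1" by simp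
  have "2 * (1 + Ca) / \<beta> \<le> ca * \<gamma>2 / \<beta>" using \<gamma>2(1) \<beta> by (intro divide_right_mono) auto
  also have "\<dots> \<le> ca * \<gamma>1" using mult_left_mono[OF le, of ca] ca by simp
  finally show "2 * (1 + Ca) / \<beta> \<le> ca * \<gamma>1" .
  have "\<gamma>2 \<le> \<gamma>2 / \<beta>" using \<beta> \<gamma>2 by (simp add: field_simps)
  then show "2 \<le> \<gamma>1" using le \<gamma>2 by simp
qed

text \<open>The energy inequality is quadratic in \<open>N\<close> with lower-order terms controlled by the data
  \<open>D = G + U + F\<close>, so \<open>N \<le> T D\<close> for large \<open>T\<close>.\<close>

lemma smallness_arithmetic:
  fixes ca Ca \<beta> \<gamma> \<kappa>2 G U F N :: real
  assumes ca: "ca > 0" and Ca: "Ca > 0" and \<beta>: "0 < \<beta>" "\<beta> \<le> 1"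
    and \<gamma>: "2 * (1 + Ca) / \<beta> \<le> ca * \<gamma>" "2 \<le> \<gamma>"
    and data: "G \<ge> 0" "U \<ge> 0" "F \<ge> 0" and \<kappa>2: "\<kappa>2 > 0"
    and small: "\<gamma>\<^sup>2 * \<kappa>2 * (G + U + F) < 1"
    and energy: "ca * N\<^sup>2 \<le> G * N + (2 * Ca * N + F) * U + F * ((U + N) / \<beta>)" and N: "N \<ge> 0"
  shows "\<kappa>2 * N \<le> ca / 2"
proof -
  define D where "D = G + U + F"
  \<comment> \<open>The largest factor for which \<open>\<gamma>\<^sup>2 \<kappa>\<^sub>2 D < 1\<close> turns \<open>N \<le> T D\<close> into the claim.\<close>
  define T where "T = ca * \<gamma>\<^sup>2 / 2"
  define m where "m = (1 + 2 * Ca) / \<beta>"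
  have D: "D \<ge> 0" using data by (simp add: D_def)
  have T: "T > 0" using ca \<gamma> by (simp add: T_def)
  have m1: "1 + 2 * Ca \<le> m" and m2: "1 / \<beta> \<le> m" using Ca \<beta> mult_right_mono[OF \<beta>(2), of "1 + 2 * Ca"]
    by (simp_all add: m_def field_simps)
  have E: "ca * \<gamma> \<ge> 2 / \<beta>" "ca * \<gamma> \<ge> 2" "2 / \<beta> \<ge> 2"
  proof -
    show 1: "ca * \<gamma> \<ge> 2 / \<beta>" using \<gamma>(1) divide_right_mono[of 2 "2 * (1 + Ca)" \<beta>] Ca \<beta> by simp
    show 2: "2 / \<beta> \<ge> 2" using \<beta> by (simp add: field_simps)
    show "ca * \<gamma> \<ge> 2" using 1 2 by simp
  qed
  have mT: "2 * m \<le> ca * T"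
  proof -
    have "(2 * (1 + Ca) / \<beta>) * (2 * (1 + Ca) / \<beta>) \<le> (ca * \<gamma>) * (ca * \<gamma>)"
      using \<gamma> Ca \<beta> ca by (intro mult_mono) auto
    moreover have "4 * m \<le> (2 * (1 + Ca) / \<beta>) * (2 * (1 + Ca) / \<beta>)"
    proof -
      have "(1 + 2 * Ca) * \<beta> \<le> 1 + 2 * Ca"
        using mult_left_mono[OF \<beta>(2), of "1 + 2 * Ca"] Ca by simp
      also have "\<dots> \<le> (1 + Ca) * (1 + Ca)" using Ca by (simp add: distrib_left distrib_right)
      finally have "(1 + 2 * Ca) * \<beta> \<le> (1 + Ca) * (1 + Ca)" .
      then have "4 * ((1 + 2 * Ca) * \<beta>) / (\<beta> * \<beta>) \<le> 4 * ((1 + Ca) * (1 + Ca)) / (\<beta> * \<beta>)"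
        using \<beta> by (intro divide_right_mono mult_left_mono) auto
      moreover have "4 * m = 4 * ((1 + 2 * Ca) * \<beta>) / (\<beta> * \<beta>)"
        using \<beta> by (simp add: m_def)
      moreover have "(2 * (1 + Ca) / \<beta>) * (2 * (1 + Ca) / \<beta>) = 4 * ((1 + Ca) * (1 + Ca)) / (\<beta> * \<beta>)"
        by (simp add: algebra_simps)
      ultimately show ?thesis by (simp only:)
    qed
    ultimately show ?thesis by (simp add: T_def power2_eq_square mult.assoc mult.left_commute)
  qed
  have bT: "1 \<le> \<beta> * ca * T\<^sup>2"
  proof -
    have "2 * (2 * 2) \<le> (\<beta> * (ca * \<gamma>)) * ((ca * \<gamma>) * (ca * \<gamma>))"
      using E \<beta> \<gamma> by (intro mult_mono) (auto simp: field_simps)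
    then have "8 * 2 \<le> (\<beta> * (ca * \<gamma>)) * ((ca * \<gamma>) * (ca * \<gamma>)) * \<gamma>"
      using \<gamma> by (intro mult_mono) auto
    also have "\<dots> = 4 * (\<beta> * ca * T\<^sup>2)" by (simp add: T_def power2_eq_square)
    finally show ?thesis by simp
  qed
  have FU: "F * U * (1 + 1 / \<beta>) \<le> D\<^sup>2 / (2 * \<beta>)"
  proof -
    have "4 * (F * U) \<le> (F + U)\<^sup>2" using zero_le_power2[of "F - U"] by (simp add: power2_eq_square algebra_simps)
    also have "\<dots> \<le> D\<^sup>2" using data by (intro power_mono) (auto simp: D_def)
    finally have "F * U \<le> D\<^sup>2 / 4" by simp
    moreover have "1 + 1 / \<beta> \<le> 2 / \<beta>" using \<beta> by (simp add: field_simps)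
    ultimately have "F * U * (1 + 1 / \<beta>) \<le> D\<^sup>2 / 4 * (2 / \<beta>)"
      using data \<beta> by (intro mult_mono) auto
    then show ?thesis by simp
  qed
  have lin: "G + 2 * Ca * U + F / \<beta> \<le> m * D"
  proof -
    have "1 * G \<le> m * G" "2 * Ca * U \<le> m * U" "1 / \<beta> * F \<le> m * F"
      using m1 m2 Ca data by (intro mult_right_mono; simp)+
    then show ?thesis by (simp add: D_def distrib_left)
  qed
  have quad: "ca * N\<^sup>2 \<le> m * D * N + D\<^sup>2 / (2 * \<beta>)"
  proof -
    have "ca * N\<^sup>2 \<le> (G + 2 * Ca * U + F / \<beta>) * N + F * U * (1 + 1 / \<beta>)"
      using energy by (simp add: algebra_simps add_divide_distrib)
    then show ?thesis using mult_right_mono[OF lin N] FU by linarith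
  qed
  have "N \<le> T * D"
  proof (rule ccontr)
    assume "\<not> N \<le> T * D"
    then have TD: "T * D < N" by simp
    have N0: "N > 0" using TD T D by (meson mult_nonneg_nonneg less_imp_le order.strict_trans1)
    have "T * (m * D * N) \<le> m * N * N"
      using mult_right_mono[of "T * D" N "m * N"] TD N0 m1 Ca by (simp add: algebra_simps)
    moreover have "2 * m * (N * N) \<le> ca * T * (N * N)" using mT N0 by (intro mult_right_mono) auto
    ultimately have "T * (m * D * N) \<le> T * (ca / 2 * N\<^sup>2)"
      by (simp add: power2_eq_square algebra_simps)
    then have 1: "m * D * N \<le> ca / 2 * N\<^sup>2" using T by simp
    have "T\<^sup>2 * D\<^sup>2 < N\<^sup>2"
      using power_strict_mono[OF TD, of 2] T D by (simp add: power_mult_distrib)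
    also have "N\<^sup>2 \<le> \<beta> * ca * T\<^sup>2 * N\<^sup>2" using mult_right_mono[OF bT, of "N\<^sup>2"] by simp
    finally have "T\<^sup>2 * D\<^sup>2 < T\<^sup>2 * (\<beta> * ca * N\<^sup>2)" by (simp add: algebra_simps)
    then have "D\<^sup>2 < \<beta> * ca * N\<^sup>2" using T by simp
    then have 2: "D\<^sup>2 / (2 * \<beta>) < ca / 2 * N\<^sup>2" using \<beta> by (simp add: field_simps)
    show False using quad 1 2 by simp
  qed
  then have "\<kappa>2 * N \<le> \<kappa>2 * (T * D)" using \<kappa>2 by simp
  also have "\<dots> = ca / 2 * (\<gamma>\<^sup>2 * \<kappa>2 * D)" by (simp add: T_def)
  also have "\<dots> \<le> ca / 2 * 1" using small ca by (intro mult_left_mono) (auto simp: D_def)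
  finally show ?thesis by simp
qed

locale biot_problem = biot_form +
  fixes \<kappa> :: permeability_map and \<kappa>1 \<kappa>2 :: real
    and f u\<Gamma> :: vector_field and g :: scalar_field and r\<Gamma> :: "scalar_field \<Rightarrow> real"
  assumes \<Omega>_nonempty: "\<Omega> \<noteq> {}"
    and perm: "\<kappa>1 > 0" "\<kappa>2 > 0" "permeability \<Omega> \<kappa> \<kappa>1 \<kappa>2"
    and data: "f \<in> L2 \<Omega>" "g \<in> L2 \<Omega>" "u\<Gamma> \<in> Hhalf_vec \<Omega>" "r\<Gamma> \<in> Hmhalf \<Omega>"
begin

abbreviation solves where
  "solves \<equiv> solves_problem \<Omega> \<kappa> lam mu \<alpha> c0 f g u\<Gamma> r\<Gamma>"

abbreviation ca where "ca \<equiv> const_ca mu c0 \<kappa>1"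

lemma ca_pos: "ca > 0"
  using params perm by (simp add: const_ca_def)

lemma permeabilityD:
  assumes "(d, p) \<in> space_X \<Omega>"
  shows "\<kappa> (d, p) \<in> Linf \<Omega>"
    "AE x in lebesgue_on \<Omega>. \<forall>v. v \<noteq> 0 \<longrightarrow> \<kappa>1 * (norm v)\<^sup>2 \<le> v \<bullet> (\<kappa> (d, p) x *v v)"
  using perm(3) assms unfolding permeability_def by blast+

lemma permeability_Lipschitz:
  assumes "(d, p) \<in> space_X \<Omega>" "(d', p') \<in> space_X \<Omega>"
  shows "AE x in lebesgue_on \<Omega>. norm (\<kappa> (d', p') x - \<kappa> (d, p) x) \<le> \<kappa>2 * H1_norm \<Omega> (p' - p)"
proof -
  have "Linf_norm \<Omega> (\<kappa> (d', p') - \<kappa> (d, p)) \<le> ereal (\<kappa>2 * H1_norm \<Omega> (p' - p))"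
    using perm(3) assms unfolding permeability_def space_X_def by blast
  from Linf_norm_le_AE[OF this] show ?thesis by simp
qed

lemma space_XD: "(e, q) \<in> space_X \<Omega> \<Longrightarrow> e \<in> L2_sym \<Omega>" "(e, q) \<in> space_X \<Omega> \<Longrightarrow> e \<in> L2 \<Omega>"
  "(e, q) \<in> space_X \<Omega> \<Longrightarrow> q \<in> H1 \<Omega>"
  by (auto simp: space_X_def L2_sym_def)

lemma identity_in_space_X: "(\<lambda>x. mat 1, \<lambda>x. 0) \<in> space_X \<Omega>"
  using L2_continuous[OF \<Omega>, of "\<lambda>x. mat 1 :: real^2^2"] H1_zero(1)[OF \<Omega>]
  by (simp add: space_X_def L2_sym_def transpose_mat)

lemma norm_XY_pos: "L2_norm \<Omega> e > 0 \<Longrightarrow> norm_XY \<Omega> ((e, q), \<tau>) \<noteq> 0"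
  "L2_norm \<Omega> q > 0 \<Longrightarrow> norm_XY \<Omega> ((e, q), \<tau>) \<noteq> 0"
  using norm_X_ge(1)[of \<Omega> e q] norm_X_ge(2)[of \<Omega> q e] L2_norm_le_H1_norm(1)[of \<Omega> q] norm_XY_ge(1)[of \<Omega> "(e, q)" \<tau>] by linarith+

text \<open>The divergence is bounded by the norm of \<open>Y\<close>, so no inf-sup constant exceeds one.\<close>

lemma inf_sup_constant_le_1:
  assumes inf_sup: "inf_sup_b2 \<Omega> (space_X \<Omega>) (space_Y \<Omega>) (space_Z \<Omega>) \<beta>" and \<sigma>: "\<sigma> \<in> space_Y \<Omega>"
  shows "\<beta> \<le> 1"
proof -
  let ?v = "\<lambda>x::real^2. axis 1 1 :: real^2"
  have v: "?v \<in> L2 \<Omega>" by (rule L2_continuous[OF \<Omega>]) simp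
  have "(mat 1 :: real^2^2) \<noteq> 0" using norm_mat_1 by force
  then have pos: "L2_norm \<Omega> (\<lambda>x. mat 1 :: real^2^2) > 0"
    by (rule L2_norm_const_pos[OF \<Omega> \<Omega>_nonempty])
  have "\<beta> * L2_norm \<Omega> ?v \<le> L2_norm \<Omega> ?v"
  proof (rule inf_sup_b2_le[OF inf_sup])
    show "?v \<in> space_Z \<Omega>" using v by (simp add: space_Z_def)
    show "((\<lambda>x. mat 1, \<lambda>x. 0), \<sigma>) \<in> space_X \<Omega> \<times> space_Y \<Omega>" using identity_in_space_X \<sigma> by simp
    show "norm_XY \<Omega> ((\<lambda>x. mat 1, \<lambda>x. 0), \<sigma>) \<noteq> 0" by (rule norm_XY_pos(1)[OF pos])
    show "form_b2 \<Omega> (\<epsilon>, \<tau>) ?v \<le> L2_norm \<Omega> ?v * norm_Y \<Omega> \<tau>" if "\<tau> \<in> space_Y \<Omega>" for \<epsilon> \<tau>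
      using L2_inner_Cauchy_Schwarz[OF v space_Y_D(3)[OF that]]
        mult_left_mono[OF norm_Y_ge(2)[of \<Omega> \<tau>] L2_norm_nonneg[of \<Omega> ?v]]
      by (simp add: form_b2_def abs_le_iff)
  qed (rule L2_norm_nonneg)
  moreover have "L2_norm \<Omega> ?v > 0"
    by (rule L2_norm_const_pos[OF \<Omega> \<Omega>_nonempty]) (simp add: axis_eq_0_iff)
  ultimately show ?thesis by simp
qed

text \<open>Tested with the solution itself, the three equations combine so that all saddle-point terms turn
  into data, and coercivity bounds the strain and the pressure.  The stress that appears against the
  boundary datum is bounded by testing the first equation with the strain \<open>\<sigma>\<close> and zero pressure, its
  divergence by the third equation, and the displacement by the inf-sup condition.\<close>

lemma energy_bound:
  assumes inf_sup: "inf_sup_b2 \<Omega> (space_X \<Omega>) (space_Y \<Omega>) (space_Z \<Omega>) \<beta>" and \<beta>: "\<beta> > 0"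
    and sol: "solves (space_X \<Omega>) (space_Y \<Omega>) (space_Z \<Omega>) (((d, p), \<sigma>), u)"
    and Ca: "2 * mu + 2 * lam \<le> Ca" "2 * \<alpha> \<le> Ca"
  defines "N \<equiv> norm_X \<Omega> (d, p)" and "G \<equiv> L2_norm \<Omega> g + Hmhalf_norm \<Omega> r\<Gamma>"
    and "U \<equiv> Hhalf_vec_norm \<Omega> u\<Gamma>" and "F \<equiv> L2_norm \<Omega> f"
  shows "ca * N\<^sup>2 \<le> G * N + (2 * Ca * N + F) * U + F * ((U + N) / \<beta>)" "Hmhalf_norm \<Omega> r\<Gamma> \<ge> 0"
proof -
  note S = solves_problemD[OF sol]
  have X: "(d, p) \<in> space_X \<Omega>" and Y: "\<sigma> \<in> space_Y \<Omega>" and u: "u \<in> L2 \<Omega>"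
    using S(1-3) by (auto simp: space_Z_def)
  note d = space_XD(2)[OF X] and p = space_XD(3)[OF X]
  note \<sigma> = space_Y_D(2)[OF Y] and div\<sigma> = space_Y_D(3)[OF Y]
  note k = permeabilityD[OF X]
  let ?A = "A (\<kappa> (d, p)) (d, p)"
  have S4: "is_G \<Omega> g r\<Gamma> \<epsilon> (?A \<epsilon> - L2_inner \<Omega> \<sigma> (fst \<epsilon>))" if "\<epsilon> \<in> space_X \<Omega>" for \<epsilon>
    using S(4)[OF that] by (simp only: form_a_eq_A[of \<kappa> "(d, p)"])
  have N0: "N \<ge> 0" and U0: "U \<ge> 0" and F0: "F \<ge> 0"
    by (simp_all add: N_def U_def F_def norm_X_nonneg Hhalf_vec_norm_def L2_norm_nonneg sum_nonneg)
  have dN: "L2_norm \<Omega> d \<le> N" "H1_norm \<Omega> p \<le> N" by (simp_all add: N_def norm_X_ge)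
  note G1 = is_G_bound[OF data(4,2) S4[OF X], simplified fst_conv]
  show "Hmhalf_norm \<Omega> r\<Gamma> \<ge> 0" by (rule G1(3))
  then have G0: "G \<ge> 0" by (simp add: G_def L2_norm_nonneg)
  have y: "\<bar>?A (d, p) - L2_inner \<Omega> \<sigma> d\<bar> \<le> G * N"
    using G1(2) mult_left_mono[OF dN(2) G0] by (simp add: G_def)
  have z: "\<bar>- L2_inner \<Omega> \<tau> d - L2_inner \<Omega> u (tdiv \<Omega> \<tau>)\<bar> \<le> norm_Y \<Omega> \<tau> * U" if "\<tau> \<in> space_Y \<Omega>" for \<tau>
    using is_H_bound[OF data(3) that S(5)[OF that]] by (simp add: U_def)
  \<comment> \<open>The stress is an admissible strain.\<close>
  have \<sigma>N: "L2_norm \<Omega> \<sigma> \<le> 2 * Ca * N"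
  proof (rule le_of_square_le)
    have "(\<sigma>, \<lambda>x. 0) \<in> space_X \<Omega>" using space_Y_D(1)[OF Y] H1_zero(1)[OF \<Omega>] by (simp add: space_X_def)
    then have "\<bar>?A (\<sigma>, \<lambda>x. 0) - L2_inner \<Omega> \<sigma> \<sigma>\<bar> \<le> G * H1_norm \<Omega> (\<lambda>x. 0)"
      using is_G_bound(2)[OF data(4,2) S4[of "(\<sigma>, \<lambda>x. 0)"]] by (simp add: G_def)
    also have "H1_norm \<Omega> (\<lambda>x. 0) = 0"
      using L2_norm_AE_zero[OF H1_zero(2)[OF \<Omega>] wgrad(1)[OF H1_zero(1)[OF \<Omega>]]]
      by (simp add: H1_norm_def L2_norm_zero)
    finally have "(L2_norm \<Omega> \<sigma>)\<^sup>2 = ?A (\<sigma>, \<lambda>x. 0)" by (simp add: L2_inner_self)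
    also have "\<dots> \<le> (2 * mu + 2 * lam + 2 * \<alpha>) * N * L2_norm \<Omega> \<sigma>"
      using A_stress(2)[OF k(1) d p \<sigma>] by (simp add: N_def)
    also have "\<dots> \<le> 2 * Ca * N * L2_norm \<Omega> \<sigma>"
      using Ca N0 L2_norm_nonneg by (intro mult_right_mono) auto
    finally show "(L2_norm \<Omega> \<sigma>)\<^sup>2 \<le> 2 * Ca * N * L2_norm \<Omega> \<sigma>" .
    show "0 \<le> 2 * Ca * N" using Ca params N0 by simp
  qed
  have div\<sigma>F: "L2_norm \<Omega> (tdiv \<Omega> \<sigma>) \<le> F"
  proof (rule le_of_square_le)
    have "(L2_norm \<Omega> (tdiv \<Omega> \<sigma>))\<^sup>2 = - L2_inner \<Omega> f (tdiv \<Omega> \<sigma>)"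
      using S(6)[of "tdiv \<Omega> \<sigma>"] div\<sigma> by (simp add: space_Z_def L2_inner_self)
    also have "\<dots> \<le> F * L2_norm \<Omega> (tdiv \<Omega> \<sigma>)"
      using L2_inner_Cauchy_Schwarz[OF data(1) div\<sigma>] by (simp add: F_def abs_le_iff)
    finally show "(L2_norm \<Omega> (tdiv \<Omega> \<sigma>))\<^sup>2 \<le> F * L2_norm \<Omega> (tdiv \<Omega> \<sigma>)" .
  qed (rule F0)
  have \<sigma>Y: "norm_Y \<Omega> \<sigma> \<le> 2 * Ca * N + F"
    using norm_Y_le[of \<Omega> \<sigma>] \<sigma>N div\<sigma>F by simp
  have "(mat 1 :: real^2^2) \<noteq> 0" using norm_mat_1 by force
  then have pos: "L2_norm \<Omega> (\<lambda>x. mat 1 :: real^2^2) > 0"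
    by (rule L2_norm_const_pos[OF \<Omega> \<Omega>_nonempty])
  have "\<beta> * L2_norm \<Omega> u \<le> U + N"
  proof (rule inf_sup_b2_le[OF inf_sup S(3)])
    show "((\<lambda>x. mat 1, \<lambda>x. 0), \<sigma>) \<in> space_X \<Omega> \<times> space_Y \<Omega>" using identity_in_space_X Y by simp
    show "norm_XY \<Omega> ((\<lambda>x. mat 1, \<lambda>x. 0), \<sigma>) \<noteq> 0" by (rule norm_XY_pos(1)[OF pos])
    show "0 \<le> U + N" using U0 N0 by simp
    show "form_b2 \<Omega> (\<epsilon>, \<tau>) u \<le> (U + N) * norm_Y \<Omega> \<tau>" if \<tau>: "\<tau> \<in> space_Y \<Omega>" for \<epsilon> \<tau>
    proof -
      have "\<bar>L2_inner \<Omega> \<tau> d\<bar> \<le> norm_Y \<Omega> \<tau> * N"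
        using L2_inner_Cauchy_Schwarz[OF space_Y_D(2)[OF \<tau>] d]
          mult_mono[OF norm_Y_ge(1) dN(1) norm_Y_nonneg L2_norm_nonneg] by (rule order_trans)
      then show ?thesis using z[OF \<tau>] by (simp add: form_b2_def algebra_simps abs_le_iff)
    qed
  qed
  then have uB: "L2_norm \<Omega> u \<le> (U + N) / \<beta>" using \<beta> by (simp add: field_simps)
  have "ca * N\<^sup>2 \<le> ?A (d, p)"
    unfolding N_def by (rule A_coercive[OF k d p])
  also have "?A (d, p) = (?A (d, p) - L2_inner \<Omega> \<sigma> d) - (- L2_inner \<Omega> \<sigma> d - L2_inner \<Omega> u (tdiv \<Omega> \<sigma>)) + L2_inner \<Omega> f u"
    using S(6)[OF S(3)] by simp
  also have "\<dots> \<le> G * N + norm_Y \<Omega> \<sigma> * U + F * L2_norm \<Omega> u"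
    using y z[OF Y] L2_inner_le[OF data(1) u] unfolding F_def abs_le_iff by linarith
  also have "\<dots> \<le> G * N + (2 * Ca * N + F) * U + F * ((U + N) / \<beta>)"
    using \<sigma>Y U0 uB F0 by (intro add_mono mult_right_mono mult_left_mono order_refl)
  finally show "ca * N\<^sup>2 \<le> G * N + (2 * Ca * N + F) * U + F * ((U + N) / \<beta>)" .
qed

end

section \<open>Quasi-optimality of the Galerkin approximation\<close>

lemma energy_absorption:
  fixes c E P Q \<eta> :: real
  assumes c: "c > 0" and nonneg: "E \<ge> 0" "P \<ge> 0" "Q \<ge> 0" "\<eta> \<ge> 0"
    and le: "c / 2 * \<eta>\<^sup>2 \<le> P * E * \<eta> + Q * E\<^sup>2"
  shows "\<eta> \<le> (1 + 2 * (P + Q) / c) * E"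
proof (cases "\<eta> \<le> E")
  case True
  have "1 * E \<le> (1 + 2 * (P + Q) / c) * E"
    using nonneg c by (intro mult_right_mono) auto
  then show ?thesis using True by simp
next
  case False
  then have \<eta>: "\<eta> > 0" "E \<le> \<eta>" using nonneg by auto
  have "Q * E * E \<le> Q * E * \<eta>" using \<eta> nonneg by (intro mult_left_mono) auto
  then have "(c / 2 * \<eta>) * \<eta> \<le> ((P + Q) * E) * \<eta>"
    using le by (simp add: power2_eq_square algebra_simps)
  then have "c / 2 * \<eta> \<le> (P + Q) * E" using \<eta>(1) by (simp only: mult_le_cancel_right_pos)
  then have "\<eta> \<le> 2 * (P + Q) / c * E" using c by (simp add: field_simps)
  then show ?thesis using nonneg by (simp add: distrib_right)
qed

text \<open>The parameters are a coercivity constant \<open>c\<close>, a bound \<open>s\<close> of the form tested with stresses,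
  a continuity constant \<open>K\<close> and the discrete inf-sup constant \<open>\<beta>\<close>.  The auxiliary \<open>L\<close> bounds the
  discrete part of the error in strain and pressure.\<close>

definition cea_constant :: "real \<Rightarrow> real \<Rightarrow> real \<Rightarrow> real \<Rightarrow> real" where
  "cea_constant c s K \<beta> =
     (let L = 1 + 2 * ((K + c / 2 + 1 + s + 1 / \<beta>) + (2 + s + 2 / \<beta>)) / c
      in (1 + L) + (3 + (1 + s * (1 + L))) + (1 + (2 + L) / \<beta>))"

lemma cea_constant_pos:
  assumes "c > 0" "s \<ge> 0" "K \<ge> 0" "\<beta> > 0" shows "cea_constant c s K \<beta> > 0"
proof -
  define L where "L = 1 + 2 * ((K + c / 2 + 1 + s + 1 / \<beta>) + (2 + s + 2 / \<beta>)) / c"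
  have "L \<ge> 0" using assms by (auto simp: L_def intro!: add_nonneg_nonneg divide_nonneg_pos)
  then have "s * (1 + L) \<ge> 0" "(2 + L) / \<beta> \<ge> 0" using assms by auto
  then show ?thesis using \<open>L \<ge> 0\<close> unfolding cea_constant_def L_def[symmetric] Let_def by linarith
qed

context biot_problem
begin

text \<open>The discrete spaces are abstract here.  Their structural properties are the inclusions
  \<open>div Y\<^sub>h \<subseteq> Z\<^sub>h\<close> and \<open>Y\<^sub>h \<times> 0 \<subseteq> X\<^sub>h\<close>, which allow the discrete part of the stress error to be tested as a
  strain and its divergence as a displacement.  The quadratic estimate for the discrete part \<open>\<eta>\<close> of
  the error in strain and pressure contains the perturbation of the permeability, of size
  \<open>\<kappa>\<^sub>2 \<parallel>(d,p)\<parallel> (E + \<eta>) \<eta>\<close> where \<open>E\<close> is the approximation error; it is absorbed since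
  \<open>\<kappa>\<^sub>2 \<parallel>(d,p)\<parallel> \<le> c\<^sub>a / 2\<close>.\<close>

lemma quasi_optimality:
  assumes sol: "solves (space_X \<Omega>) (space_Y \<Omega>) (space_Z \<Omega>) (((d, p), \<sigma>), u)"
    and solh: "solves XX YY ZZ (((d', p'), \<sigma>'), u')"
    and conforming: "\<And>e q. (e, q) \<in> XX \<Longrightarrow> e \<in> L2_sym \<Omega>" "YY \<subseteq> space_Y \<Omega>" "ZZ \<subseteq> L2 \<Omega>"
    and stress_strain: "\<And>\<tau>. \<tau> \<in> YY \<Longrightarrow> (\<tau>, \<lambda>x. 0) \<in> XX"
    and div: "\<And>\<tau>. \<tau> \<in> YY \<Longrightarrow> tdiv \<Omega> \<tau> \<in> ZZ"
    and ZZ_diff: "\<And>v w. v \<in> ZZ \<Longrightarrow> w \<in> ZZ \<Longrightarrow> v - w \<in> ZZ"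
    and nontrivial: "w0 \<in> XX \<times> YY" "norm_XY \<Omega> w0 \<noteq> 0"
    and inf_sup: "inf_sup_b2 \<Omega> XX YY ZZ \<beta>" and \<beta>: "\<beta> > 0"
    and M: "AE x in lebesgue_on \<Omega>. norm (\<kappa> (d, p) x) \<le> M" "M \<ge> 0"
    and r: "norm_X \<Omega> (d, p) \<le> r" "norm_X \<Omega> (d', p') \<le> r"
    and small: "\<kappa>2 * norm_X \<Omega> (d, p) \<le> ca / 2"
    and y: "(e, q) \<in> XX" "\<tau> \<in> YY" "v \<in> ZZ"
  shows "norm_XYZ \<Omega> ((((d, p), \<sigma>), u) - (((d', p'), \<sigma>'), u'))
    \<le> cea_constant ca (2 * mu + 2 * lam + 2 * \<alpha>) (2 * mu + 2 * lam + (M + \<kappa>2 * (2 * r)) + c0 + 4 * \<alpha>) \<beta>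
      * norm_XYZ \<Omega> ((((d, p), \<sigma>), u) - (((e, q), \<tau>), v))"
proof -
  note S = solves_problemD[OF sol] and T = solves_problemD[OF solh]
  define s where "s = 2 * mu + 2 * lam + 2 * \<alpha>"
  define K where "K = 2 * mu + 2 * lam + (M + \<kappa>2 * (2 * r)) + c0 + 4 * \<alpha>"
  define E where "E = norm_XYZ \<Omega> (((d - e, p - q), \<sigma> - \<tau>), u - v)"
  define \<eta> where "\<eta> = norm_X \<Omega> (e - d', q - p')"
  define N where "N = norm_X \<Omega> (d, p)"
  define \<theta> where "\<theta> = L2_norm \<Omega> (\<tau> - \<sigma>')"
  define \<omega> where "\<omega> = L2_norm \<Omega> (u - u')"
  \<comment> \<open>Discrete functions belong to the continuous spaces; for pressures this is part of the meaning
    of the right-hand side of the discrete problem.\<close>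
  have XXD: "(e, q) \<in> space_X \<Omega>" if "(e, q) \<in> XX" for e q
    using conforming(1)[OF that] is_G_bound(1)[OF data(4,2) T(4)[OF that]] by (simp add: space_X_def)
  have X: "(d, p) \<in> space_X \<Omega>" "(d', p') \<in> space_X \<Omega>" "(e, q) \<in> space_X \<Omega>"
    using S(1) T(1) y(1) XXD by auto
  have Y: "\<sigma> \<in> space_Y \<Omega>" "\<sigma>' \<in> space_Y \<Omega>" "\<tau> \<in> space_Y \<Omega>"
    using S(2) T(2) y(2) conforming(2) by auto
  have Z: "u \<in> L2 \<Omega>" "u' \<in> L2 \<Omega>" "v \<in> L2 \<Omega>"
    using S(3) T(3) y(3) conforming(3) by (auto simp: space_Z_def)
  note d = space_XD(2)[OF X(1)] and d' = space_XD(2)[OF X(2)] and e = space_XD(2)[OF X(3)]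
  note p = space_XD(3)[OF X(1)] and p' = space_XD(3)[OF X(2)] and q = space_XD(3)[OF X(3)]
  note \<sigma> = space_Y_D(2)[OF Y(1)] and \<sigma>' = space_Y_D(2)[OF Y(2)] and \<tau> = space_Y_D(2)[OF Y(3)]
  note div\<sigma> = space_Y_D(3)[OF Y(1)] and div\<sigma>' = space_Y_D(3)[OF Y(2)] and div\<tau> = space_Y_D(3)[OF Y(3)]
  let ?k = "\<kappa> (d, p)" and ?k' = "\<kappa> (d', p')"
  note k = permeabilityD[OF X(1)] and k' = permeabilityD[OF X(2)]
  note d\<^sub>2 = L2_diff[OF d d'] and p\<^sub>2 = H1_diff(1)[OF \<Omega> p p'] and \<theta>L = L2_diff[OF \<tau> \<sigma>']
  have E_ge: "norm_X \<Omega> (d - e, p - q) \<le> E" "norm_Y \<Omega> (\<sigma> - \<tau>) \<le> E" "L2_norm \<Omega> (u - v) \<le> E"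
    unfolding E_def by (rule norm_XYZ_ge)+
  have E0: "E \<ge> 0" using E_ge(1) norm_X_nonneg order_trans by blast
  have \<sigma>\<tau>: "L2_norm \<Omega> (\<sigma> - \<tau>) \<le> E" "L2_norm \<Omega> (tdiv \<Omega> \<sigma> - tdiv \<Omega> \<tau>) \<le> E"
    using norm_Y_ge[of \<Omega> "\<sigma> - \<tau>"] E_ge(2) space_Y_diff(3)[OF \<Omega> Y(1,3)] by auto
  have nonneg: "\<eta> \<ge> 0" "N \<ge> 0" "\<theta> \<ge> 0" "\<omega> \<ge> 0" "s \<ge> 0"
    using params by (simp_all add: \<eta>_def N_def \<theta>_def \<omega>_def s_def norm_X_nonneg L2_norm_nonneg)
  have \<delta>: "norm_X \<Omega> (d - d', p - p') \<le> E + \<eta>"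
    using norm_X_triangle_sub[OF \<Omega> d e d' p q p'] E_ge(1) by (simp add: \<eta>_def)
  have dd': "L2_norm \<Omega> (d - d') \<le> E + \<eta>" using norm_X_ge(1) \<delta> by (rule order_trans)
  have pp': "H1_norm \<Omega> (p' - p) \<le> E + \<eta>"
    using order_trans[OF norm_X_ge(2) \<delta>] H1_norm_diff_commute[OF \<Omega> p p'] by simp
  \<comment> \<open>Galerkin orthogonality of the three equations.\<close>
  have R1: "A ?k (d, p) \<epsilon> - A ?k' (d', p') \<epsilon> = L2_inner \<Omega> (\<sigma> - \<sigma>') (fst \<epsilon>)" if \<epsilon>: "\<epsilon> \<in> XX" for \<epsilon>
  proof -
    obtain e1 q1 where e1: "\<epsilon> = (e1, q1)" by (cases \<epsilon>)
    have \<epsilon>X: "\<epsilon> \<in> space_X \<Omega>" using XXD \<epsilon> by (simp add: e1)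
    have "form_a \<Omega> \<kappa> lam mu \<alpha> c0 (d, p) \<epsilon> - L2_inner \<Omega> \<sigma> (fst \<epsilon>)
        = form_a \<Omega> \<kappa> lam mu \<alpha> c0 (d', p') \<epsilon> - L2_inner \<Omega> \<sigma>' (fst \<epsilon>)"
      by (rule is_G_unique[OF \<Omega> data(4) S(4)[OF \<epsilon>X] T(4)[OF \<epsilon>]])
    moreover have "L2_inner \<Omega> (\<sigma> - \<sigma>') (fst \<epsilon>) = L2_inner \<Omega> \<sigma> (fst \<epsilon>) - L2_inner \<Omega> \<sigma>' (fst \<epsilon>)"
      using \<epsilon>X by (intro L2_inner_diff_left \<sigma> \<sigma>') (auto simp: e1 intro: space_XD)
    ultimately show ?thesis
      by (simp only: form_a_eq_A[of \<kappa> "(d, p)"] form_a_eq_A[of \<kappa> "(d', p')"])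
  qed
  have R2: "L2_inner \<Omega> \<tau>1 (d - d') = - L2_inner \<Omega> (u - u') (tdiv \<Omega> \<tau>1)" if "\<tau>1 \<in> YY" for \<tau>1
  proof -
    have Y1: "\<tau>1 \<in> space_Y \<Omega>" using that conforming(2) by auto
    have "- L2_inner \<Omega> \<tau>1 d - L2_inner \<Omega> u (tdiv \<Omega> \<tau>1) = - L2_inner \<Omega> \<tau>1 d' - L2_inner \<Omega> u' (tdiv \<Omega> \<tau>1)"
      by (rule is_H_unique[OF data(3) S(5)[OF Y1] T(5)[OF that]])
    then show ?thesis
      unfolding L2_inner_diff_right[OF d d' space_Y_D(2)[OF Y1]] L2_inner_diff_left[OF Z(1,2) space_Y_D(3)[OF Y1]]
      by simp
  qed
  have R3: "L2_inner \<Omega> w (tdiv \<Omega> \<sigma>) = L2_inner \<Omega> w (tdiv \<Omega> \<sigma>')" if "w \<in> ZZ" for w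
    using S(6)[of w] T(6)[OF that] that conforming(3) by (auto simp: space_Z_def)
  \<comment> \<open>The divergence of the discrete stress is a best approximation.\<close>
  define \<rho> where "\<rho> = tdiv \<Omega> \<tau> - tdiv \<Omega> \<sigma>'"
  have \<rho>L: "\<rho> \<in> L2 \<Omega>" unfolding \<rho>_def by (rule L2_diff[OF div\<tau> div\<sigma>'])
  have \<rho>E: "L2_norm \<Omega> \<rho> \<le> E"
  proof (rule le_of_square_le)
    have "\<rho> \<in> ZZ" unfolding \<rho>_def by (intro ZZ_diff div y(2) T(2))
    then have "L2_inner \<Omega> \<rho> \<rho> = L2_inner \<Omega> \<rho> (tdiv \<Omega> \<tau>) - L2_inner \<Omega> \<rho> (tdiv \<Omega> \<sigma>)"
      using L2_inner_diff_right[OF div\<tau> div\<sigma>' \<rho>L] R3 by (simp add: \<rho>_def)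
    also have "\<dots> = L2_inner \<Omega> \<rho> (tdiv \<Omega> \<tau> - tdiv \<Omega> \<sigma>)"
      by (rule L2_inner_diff_right[OF div\<tau> div\<sigma> \<rho>L, symmetric])
    also have "\<dots> \<le> L2_norm \<Omega> \<rho> * E"
      using L2_inner_le[OF \<rho>L L2_diff[OF div\<tau> div\<sigma>]] mult_left_mono[OF \<sigma>\<tau>(2) L2_norm_nonneg[of \<Omega> \<rho>]]
      by (simp add: L2_norm_diff_commute[of \<Omega> "tdiv \<Omega> \<tau>"])
    finally show "(L2_norm \<Omega> \<rho>)\<^sup>2 \<le> E * L2_norm \<Omega> \<rho>" by (simp add: L2_inner_self mult.commute)
  qed (rule E0)
  \<comment> \<open>The discrete stress, tested as a strain in the first equation.\<close>
  have \<theta>_le: "\<theta> \<le> E + s * (E + \<eta>)"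
  proof (rule le_of_square_le)
    let ?\<theta> = "\<tau> - \<sigma>'"
    have zero: "(\<lambda>x. 0) - (\<lambda>x. 0) = (\<lambda>x. 0 :: real)" by (simp add: fun_diff_def)
    have "A ?k (d, p) (?\<theta>, \<lambda>x. 0) - A ?k' (d', p') (?\<theta>, \<lambda>x. 0)
        = L2_inner \<Omega> (\<sigma> - \<sigma>') \<tau> - L2_inner \<Omega> (\<sigma> - \<sigma>') \<sigma>'"
      using R1[OF stress_strain[OF y(2)]] R1[OF stress_strain[OF T(2)]]
        A_diff_right[OF k(1) d p \<tau> \<sigma>' H1_zero(1)[OF \<Omega>] H1_zero(1)[OF \<Omega>]]
        A_diff_right[OF k'(1) d' p' \<tau> \<sigma>' H1_zero(1)[OF \<Omega>] H1_zero(1)[OF \<Omega>]]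
      by (simp add: zero)
    also have "\<dots> = L2_inner \<Omega> (\<sigma> - \<sigma>') ?\<theta>"
      by (rule L2_inner_diff_right[OF \<tau> \<sigma>' L2_diff[OF \<sigma> \<sigma>'], symmetric])
    finally have "L2_inner \<Omega> (\<sigma> - \<sigma>') ?\<theta> = A ?k (d, p) (?\<theta>, \<lambda>x. 0) - A ?k (d', p') (?\<theta>, \<lambda>x. 0)"
      unfolding A_stress(1)[OF k'(1) d' p' \<theta>L] A_stress(1)[OF k(1) d' p' \<theta>L] by simp
    also have "\<dots> = A ?k (d - d', p - p') (?\<theta>, \<lambda>x. 0)"
      by (rule A_diff_left[OF k(1) d d' p p' \<theta>L H1_zero(1)[OF \<Omega>], symmetric])
    also have "\<dots> \<le> s * norm_X \<Omega> (d - d', p - p') * \<theta>"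
      using A_stress(2)[OF k(1) d\<^sub>2 p\<^sub>2 \<theta>L] by (simp add: s_def \<theta>_def)
    also have "\<dots> \<le> s * (E + \<eta>) * \<theta>"
      using \<delta> nonneg by (intro mult_right_mono mult_left_mono)
    finally have 1: "L2_inner \<Omega> (\<sigma> - \<sigma>') ?\<theta> \<le> s * (E + \<eta>) * \<theta>" .
    have "L2_inner \<Omega> (\<tau> - \<sigma>) ?\<theta> \<le> L2_norm \<Omega> (\<tau> - \<sigma>) * \<theta>"
      unfolding \<theta>_def by (rule L2_inner_le[OF L2_diff[OF \<tau> \<sigma>] \<theta>L])
    also have "\<dots> \<le> E * \<theta>"
      using \<sigma>\<tau>(1) nonneg(3) by (simp add: L2_norm_diff_commute[of _ \<tau>] mult_right_mono)
    finally have 2: "L2_inner \<Omega> (\<tau> - \<sigma>) ?\<theta> \<le> E * \<theta>" .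
    have "\<theta>\<^sup>2 = L2_inner \<Omega> (\<tau> - \<sigma>) ?\<theta> + L2_inner \<Omega> (\<sigma> - \<sigma>') ?\<theta>"
      unfolding \<theta>_def L2_inner_self[symmetric] L2_inner_diff_left[OF \<tau> \<sigma> \<theta>L]
        L2_inner_diff_left[OF \<sigma> \<sigma>' \<theta>L] L2_inner_diff_left[OF \<tau> \<sigma>' \<theta>L] by simp
    then show "\<theta>\<^sup>2 \<le> (E + s * (E + \<eta>)) * \<theta>" using 1 2 by (simp add: algebra_simps)
    show "0 \<le> E + s * (E + \<eta>)" using E0 nonneg by simp
  qed
  \<comment> \<open>The displacement, by the discrete inf-sup condition.\<close>
  have "\<beta> * L2_norm \<Omega> (v - u') \<le> 2 * E + \<eta>"
  proof (rule inf_sup_b2_le[OF inf_sup ZZ_diff[OF y(3) T(3)] nontrivial])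
    show "0 \<le> 2 * E + \<eta>" using E0 nonneg by simp
    fix \<epsilon> \<tau>1 assume "\<epsilon> \<in> XX" and \<tau>1: "\<tau>1 \<in> YY"
    then have Y1: "\<tau>1 \<in> space_Y \<Omega>" using conforming(2) by auto
    note L1 = space_Y_D(2,3)[OF Y1]
    have "form_b2 \<Omega> (\<epsilon>, \<tau>1) (v - u') = L2_inner \<Omega> (u - v) (tdiv \<Omega> \<tau>1) - L2_inner \<Omega> (u - u') (tdiv \<Omega> \<tau>1)"
      by (simp add: form_b2_def L2_inner_diff_left Z L1)
    also have "\<dots> = L2_inner \<Omega> (u - v) (tdiv \<Omega> \<tau>1) + L2_inner \<Omega> \<tau>1 (d - d')"
      using R2[OF \<tau>1] by simp
    also have "\<dots> \<le> E * norm_Y \<Omega> \<tau>1 + norm_Y \<Omega> \<tau>1 * (E + \<eta>)"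
    proof (rule add_mono)
      show "L2_inner \<Omega> (u - v) (tdiv \<Omega> \<tau>1) \<le> E * norm_Y \<Omega> \<tau>1"
        by (rule order_trans[OF L2_inner_le[OF L2_diff[OF Z(1,3)] L1(2)]
              mult_mono[OF E_ge(3) norm_Y_ge(2) E0 L2_norm_nonneg]])
      show "L2_inner \<Omega> \<tau>1 (d - d') \<le> norm_Y \<Omega> \<tau>1 * (E + \<eta>)"
        by (rule order_trans[OF L2_inner_le[OF L1(1) d\<^sub>2]
              mult_mono[OF norm_Y_ge(1) dd' norm_Y_nonneg L2_norm_nonneg]])
    qed
    finally show "form_b2 \<Omega> (\<epsilon>, \<tau>1) (v - u') \<le> (2 * E + \<eta>) * norm_Y \<Omega> \<tau>1"
      by (simp add: algebra_simps)
  qed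
  then have "L2_norm \<Omega> (v - u') \<le> (2 * E + \<eta>) / \<beta>" using \<beta> by (simp add: field_simps)
  then have \<omega>_le: "\<omega> \<le> E + (2 * E + \<eta>) / \<beta>"
    using L2_norm_triangle_sub[OF Z(1,3,2)] E_ge(3) by (simp add: \<omega>_def)
  \<comment> \<open>Strain and pressure, by coercivity of the form at the discrete permeability.\<close>
  have k'M: "AE x in lebesgue_on \<Omega>. norm (?k' x) \<le> M + \<kappa>2 * (2 * r)"
  proof -
    have "H1_norm \<Omega> (p' - p) \<le> 2 * r"
    proof -
      have "H1_norm \<Omega> (p' - (\<lambda>x. 0)) = H1_norm \<Omega> p'" "H1_norm \<Omega> ((\<lambda>x. 0) - p) = H1_norm \<Omega> p"
        using H1_norm_diff_commute[OF \<Omega> H1_zero(1)[OF \<Omega>] p] by (simp_all add: fun_diff_def)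
      then show ?thesis
        using H1_norm_triangle_sub[OF \<Omega> p' H1_zero(1)[OF \<Omega>] p]
          order_trans[OF norm_X_ge(2) r(1)] order_trans[OF norm_X_ge(2) r(2)] by simp
    qed
    then have le: "\<kappa>2 * H1_norm \<Omega> (p' - p) \<le> \<kappa>2 * (2 * r)" using perm(2) by simp
    show ?thesis
      using permeability_Lipschitz[OF X(1,2)] M(1)
    proof eventually_elim
      case (elim x)
      then show ?case using norm_triangle_sub[of "?k' x" "?k x"] le by linarith
    qed
  qed
  have \<eta>_le: "\<eta> \<le> (1 + 2 * ((K + ca / 2 + 1 + s + 1 / \<beta>) + (2 + s + 2 / \<beta>)) / ca) * E"
  proof (rule energy_absorption)
    let ?\<eta> = "(e - d', q - p')"
    have \<eta>L: "e - d' \<in> L2 \<Omega>" "q - p' \<in> H1 \<Omega>" by (rule L2_diff[OF e d'], rule H1_diff(1)[OF \<Omega> q p'])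
    have r0: "0 \<le> \<kappa>2 * (2 * r)" using order_trans[OF norm_X_nonneg r(1)] perm(2) by simp
    have split: "e - d' = (d - d') - (d - e)" "q - p' = (p - p') - (p - q)" by (auto simp: fun_eq_iff)
    have "ca * \<eta>\<^sup>2 \<le> A ?k' ?\<eta> ?\<eta>"
      unfolding \<eta>_def by (rule A_coercive[OF k' \<eta>L])
    also have "A ?k' ?\<eta> ?\<eta> = A ?k' (d - d', p - p') ?\<eta> - A ?k' (d - e, p - q) ?\<eta>"
      using A_diff_left[OF k'(1) d\<^sub>2 L2_diff[OF d e] p\<^sub>2 H1_diff(1)[OF \<Omega> p q] \<eta>L] split by simp
    also have "A ?k' (d - d', p - p') ?\<eta> = (A ?k' (d, p) ?\<eta> - A ?k (d, p) ?\<eta>) + (A ?k (d, p) ?\<eta> - A ?k' (d', p') ?\<eta>)"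
      using A_diff_left[OF k'(1) d d' p p' \<eta>L] by simp
    also have "A ?k (d, p) ?\<eta> - A ?k' (d', p') ?\<eta> = L2_inner \<Omega> (\<sigma> - \<sigma>') (e - d')"
      using R1[OF y(1)] R1[OF T(1)] A_diff_right[OF k(1) d p e d' q p'] A_diff_right[OF k'(1) d' p' e d' q p']
        L2_inner_diff_right[OF e d' L2_diff[OF \<sigma> \<sigma>']] by simp
    also have "L2_inner \<Omega> (\<sigma> - \<sigma>') (e - d') = L2_inner \<Omega> (\<sigma> - \<tau>) (e - d') + L2_inner \<Omega> (\<tau> - \<sigma>') (e - d')"
      by (simp add: L2_inner_diff_left \<sigma> \<sigma>' \<tau> \<eta>L)
    also have "L2_inner \<Omega> (\<tau> - \<sigma>') (e - d') = L2_inner \<Omega> (\<tau> - \<sigma>') (e - d) + L2_inner \<Omega> (\<tau> - \<sigma>') (d - d')"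
      by (simp add: L2_inner_diff_right e d d' \<theta>L)
    also have "L2_inner \<Omega> (\<tau> - \<sigma>') (d - d') = - L2_inner \<Omega> (u - u') \<rho>"
      using R2[OF y(2)] R2[OF T(2)]
      by (simp add: \<rho>_def L2_inner_diff_left[OF \<tau> \<sigma>' d\<^sub>2] L2_inner_diff_right[OF div\<tau> div\<sigma>' L2_diff[OF Z(1,2)]])
    finally have ineq: "ca * \<eta>\<^sup>2 \<le> (A ?k' (d, p) ?\<eta> - A ?k (d, p) ?\<eta>)
        + (L2_inner \<Omega> (\<sigma> - \<tau>) (e - d') + (L2_inner \<Omega> (\<tau> - \<sigma>') (e - d) - L2_inner \<Omega> (u - u') \<rho>))
        - A ?k' (d - e, p - q) ?\<eta>" by (simp only: add_uminus_conv_diff)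
    have t1: "A ?k' (d, p) ?\<eta> - A ?k (d, p) ?\<eta> \<le> ca / 2 * (E + \<eta>) * \<eta>"
    proof -
      have "\<bar>A ?k' (d, p) ?\<eta> - A ?k (d, p) ?\<eta>\<bar> \<le> (\<kappa>2 * H1_norm \<Omega> (p' - p)) * N * \<eta>"
        unfolding N_def \<eta>_def using perm(2)
        by (intro A_perturbation[OF k'(1) k(1) permeability_Lipschitz[OF X(1,2)] _ d p \<eta>L])
          (simp add: H1_norm_nonneg)
      also have "\<dots> = (\<kappa>2 * N) * H1_norm \<Omega> (p' - p) * \<eta>" by simp
      also have "\<dots> \<le> ca / 2 * (E + \<eta>) * \<eta>"
        using small pp' nonneg perm(2) ca_pos unfolding N_def[symmetric]
        by (intro mult_right_mono mult_mono) (auto simp: H1_norm_nonneg)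
      finally show ?thesis by (rule order_trans[OF abs_ge_self])
    qed
    have t2: "L2_inner \<Omega> (\<sigma> - \<tau>) (e - d') \<le> E * \<eta>"
      by (rule order_trans[OF L2_inner_le[OF L2_diff[OF \<sigma> \<tau>] \<eta>L(1)]])
        (auto simp: \<eta>_def intro!: mult_mono \<sigma>\<tau> norm_X_ge E0 L2_norm_nonneg)
    have "L2_norm \<Omega> (e - d) \<le> E"
      unfolding L2_norm_diff_commute[of _ e] using norm_X_ge(1) E_ge(1) by (rule order_trans)
    then have t3: "L2_inner \<Omega> (\<tau> - \<sigma>') (e - d) \<le> \<theta> * E"
      using L2_inner_le[OF \<theta>L L2_diff[OF e d]] mult_left_mono[OF _ nonneg(3)] unfolding \<theta>_def
      by (meson order_trans)
    have t4: "- L2_inner \<Omega> (u - u') \<rho> \<le> \<omega> * E"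
      using L2_inner_Cauchy_Schwarz[OF L2_diff[OF Z(1,2)] \<rho>L] mult_left_mono[OF \<rho>E nonneg(4)]
      unfolding \<omega>_def abs_le_iff by linarith
    have t5: "- A ?k' (d - e, p - q) ?\<eta> \<le> K * E * \<eta>"
    proof -
      have "\<bar>A ?k' (d - e, p - q) ?\<eta>\<bar> \<le> K * norm_X \<Omega> (d - e, p - q) * \<eta>"
        unfolding K_def \<eta>_def using M(2) r0
        by (intro A_bound[OF k'(1) k'M _ L2_diff[OF d e] H1_diff(1)[OF \<Omega> p q] \<eta>L]) simp
      also have "\<dots> \<le> K * E * \<eta>"
        using E_ge(1) nonneg params M(2) r0 by (intro mult_right_mono mult_left_mono) (auto simp: K_def)
      finally show ?thesis by (rule order_trans[OF abs_ge_minus_self])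
    qed
    have t6: "\<theta> * E \<le> (E + s * (E + \<eta>)) * E" "\<omega> * E \<le> (E + (2 * E + \<eta>) / \<beta>) * E"
      using \<theta>_le \<omega>_le E0 by (auto intro: mult_right_mono)
    have "ca * \<eta>\<^sup>2 \<le> ca / 2 * (E + \<eta>) * \<eta> + E * \<eta> + (E + s * (E + \<eta>)) * E
        + (E + (2 * E + \<eta>) / \<beta>) * E + K * E * \<eta>"
      using ineq t1 t2 t3 t4 t5 t6 by linarith
    also have "\<dots> = ca / 2 * \<eta>\<^sup>2 + ((K + ca / 2 + 1 + s + 1 / \<beta>) * E * \<eta> + (2 + s + 2 / \<beta>) * E\<^sup>2)"
      by (simp add: power2_eq_square algebra_simps add_divide_distrib)
    finally show "ca / 2 * \<eta>\<^sup>2 \<le> (K + ca / 2 + 1 + s + 1 / \<beta>) * E * \<eta> + (2 + s + 2 / \<beta>) * E\<^sup>2"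
      by linarith
    show "0 \<le> K + ca / 2 + 1 + s + 1 / \<beta>" "0 \<le> 2 + s + 2 / \<beta>"
      using nonneg params M(2) r0 ca_pos \<beta> by (auto simp: K_def)
  qed (use ca_pos E0 nonneg in auto)
  define L where "L = 1 + 2 * ((K + ca / 2 + 1 + s + 1 / \<beta>) + (2 + s + 2 / \<beta>)) / ca"
  have \<eta>L: "\<eta> \<le> L * E" using \<eta>_le by (simp add: L_def)
  have \<theta>E: "\<theta> \<le> (1 + s * (1 + L)) * E"
    using \<theta>_le mult_left_mono[OF \<eta>L nonneg(5)] by (simp add: algebra_simps)
  have \<omega>E: "\<omega> \<le> (1 + (2 + L) / \<beta>) * E"
    using \<omega>_le divide_right_mono[OF \<eta>L, of \<beta>] \<beta> by (simp add: algebra_simps add_divide_distrib)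
  have "norm_Y \<Omega> (\<sigma> - \<sigma>') \<le> L2_norm \<Omega> (\<sigma> - \<sigma>') + L2_norm \<Omega> (tdiv \<Omega> \<sigma> - tdiv \<Omega> \<sigma>')"
    using norm_Y_le[of \<Omega> "\<sigma> - \<sigma>'"] space_Y_diff(3)[OF \<Omega> Y(1,2)] by simp
  also have "\<dots> \<le> (E + \<theta>) + (E + E)"
    using L2_norm_triangle_sub[OF \<sigma> \<tau> \<sigma>'] L2_norm_triangle_sub[OF div\<sigma> div\<tau> div\<sigma>'] \<sigma>\<tau> \<rho>E
    by (simp add: \<theta>_def \<rho>_def)
  finally have \<sigma>E: "norm_Y \<Omega> (\<sigma> - \<sigma>') \<le> (3 + (1 + s * (1 + L))) * E"
    using \<theta>E by (simp add: algebra_simps)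
  have \<delta>E: "norm_X \<Omega> (d - d', p - p') \<le> (1 + L) * E"
    using \<delta> \<eta>L by (simp add: algebra_simps)
  have "norm_XYZ \<Omega> (((d - d', p - p'), \<sigma> - \<sigma>'), u - u')
      \<le> norm_X \<Omega> (d - d', p - p') + norm_Y \<Omega> (\<sigma> - \<sigma>') + \<omega>"
    unfolding \<omega>_def by (rule norm_XYZ_le)
  also have "\<dots> \<le> cea_constant ca s K \<beta> * E"
    using \<delta>E \<sigma>E \<omega>E unfolding cea_constant_def L_def[symmetric] Let_def by (simp add: distrib_right)
  finally show ?thesis by (simp add: E_def s_def K_def)
qed

end

theorem theorem5p1:
  fixes \<Omega> :: "(real^2) set" and \<kappa> :: permeability_map
    and lam mu \<alpha> c0 \<kappa>1 \<kappa>2 \<beta>2 \<beta>2s r Ca ca \<gamma>2 \<gamma>1 \<gamma>1s D :: real and k :: nat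
    and f u\<Gamma> :: vector_field and g :: scalar_field and r\<Gamma> :: "scalar_field \<Rightarrow> real"
    and x :: "((tensor_field \<times> scalar_field) \<times> tensor_field) \<times> vector_field"
  assumes domain: "lipschitz_domain \<Omega>"
    and params: "lam > 0" "mu > 0" "0 \<le> \<alpha>" "\<alpha> \<le> 1" "c0 > 0" "k \<ge> 1" "r > 0"
    and perm: "\<kappa>1 > 0" "\<kappa>2 > 0" "permeability \<Omega> \<kappa> \<kappa>1 \<kappa>2"
    and data: "f \<in> L2 \<Omega>" "g \<in> L2 \<Omega>" "u\<Gamma> \<in> Hhalf_vec \<Omega>" "r\<Gamma> \<in> Hmhalf \<Omega>"
    and beta2: "\<beta>2 > 0" "inf_sup_b2 \<Omega> (space_X \<Omega>) (space_Y \<Omega>) (space_Z \<Omega>) \<beta>2"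
    and beta2s: "\<beta>2s > 0"
  defines "Ca \<equiv> const_Ca lam mu \<alpha> c0 \<kappa>2 r"
    and "ca \<equiv> const_ca mu c0 \<kappa>1"
    and "\<gamma>2 \<equiv> const_gamma2 Ca ca"
    and "\<gamma>1 \<equiv> const_gamma1 Ca \<gamma>2 \<beta>2"
    and "\<gamma>1s \<equiv> const_gamma1 Ca \<gamma>2 \<beta>2s"
    and "D \<equiv> L2_norm \<Omega> g + Hmhalf_norm \<Omega> r\<Gamma> + Hhalf_vec_norm \<Omega> u\<Gamma> + L2_norm \<Omega> f"
  assumes small: "\<kappa>2 * \<gamma>1s * \<gamma>1 * D \<le> 1 / 2"
      "\<gamma>1 / r * max (\<gamma>1 * \<kappa>2 * r) 1 * D < 1"
      "\<gamma>1s / r * max (\<gamma>1s * \<kappa>2 * r) 1 * D < 1"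
    and solution: "unique_solution_in_ball \<Omega> \<kappa> lam mu \<alpha> c0 f g u\<Gamma> r\<Gamma>
      (space_X \<Omega>) (space_Y \<Omega>) (space_Z \<Omega>) r x"
  shows "\<exists>C>0. \<forall>\<T> xh.
    regular_partition \<Omega> \<T> \<longrightarrow>
    inf_sup_b2 \<Omega> (space_Xh \<Omega> \<T> k) (space_Yh \<Omega> \<T> k) (space_Zh \<Omega> \<T> k) \<beta>2s \<longrightarrow>
    unique_solution_in_ball \<Omega> \<kappa> lam mu \<alpha> c0 f g u\<Gamma> r\<Gamma>
      (space_Xh \<Omega> \<T> k) (space_Yh \<Omega> \<T> k) (space_Zh \<Omega> \<T> k) r xh \<longrightarrow>
    norm_XYZ \<Omega> (x - xh) \<le>
      C * (INF y \<in> (space_Xh \<Omega> \<T> k \<times> space_Yh \<Omega> \<T> k) \<times> space_Zh \<Omega> \<T> k. norm_XYZ \<Omega> (x - y))"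
proof -
  note \<Omega> = lipschitz_domainD[OF domain] and r = \<open>r > 0\<close>
  interpret biot_problem \<Omega> lam mu \<alpha> c0 \<kappa> \<kappa>1 \<kappa>2 f u\<Gamma> g r\<Gamma>
    by unfold_locales (use \<Omega> params perm data in auto)
  obtain d p \<sigma> u where x: "x = (((d, p), \<sigma>), u)" by (cases x) auto
  have sol: "solves (space_X \<Omega>) (space_Y \<Omega>) (space_Z \<Omega>) (((d, p), \<sigma>), u)"
    and ball: "norm_X \<Omega> (d, p) \<le> r"
    using solution by (simp_all add: unique_solution_in_ball_def x Let_def ball_W_def)
  note S = solves_problemD(1-3)[OF sol]
  have ca: "ca > 0" unfolding ca_def by (rule ca_pos)
  have Ca: "2 * mu + 2 * lam \<le> Ca" "2 * \<alpha> \<le> Ca" by (auto simp: Ca_def const_Ca_def)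
  then have Ca0: "Ca > 0" using params by simp
  have b1: "\<beta>2 \<le> 1" by (rule inf_sup_constant_le_1[OF beta2(2) S(2)])
  note gam = const_gamma1_lower_bounds[OF ca Ca0 beta2(1) b1, folded \<gamma>2_def, folded \<gamma>1_def]
  note en = energy_bound[OF beta2(2,1) sol Ca, folded ca_def]
  have D0: "D \<ge> 0"
    unfolding D_def using en(2) by (simp add: L2_norm_nonneg Hhalf_vec_norm_def sum_nonneg)
  have "\<gamma>1\<^sup>2 * \<kappa>2 * D < 1"
  proof -
    have "\<gamma>1\<^sup>2 * \<kappa>2 * D = \<gamma>1 / r * (\<gamma>1 * \<kappa>2 * r) * D"
      using r by (simp add: power2_eq_square)
    also have "\<dots> \<le> \<gamma>1 / r * max (\<gamma>1 * \<kappa>2 * r) 1 * D"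
      using gam r D0 by (intro mult_right_mono mult_left_mono) auto
    finally show ?thesis using small(2) by simp
  qed
  then have sm: "\<gamma>1\<^sup>2 * \<kappa>2 * ((L2_norm \<Omega> g + Hmhalf_norm \<Omega> r\<Gamma>) + Hhalf_vec_norm \<Omega> u\<Gamma> + L2_norm \<Omega> f) < 1"
    by (simp add: D_def)
  have absorb: "\<kappa>2 * norm_X \<Omega> (d, p) \<le> ca / 2"
    by (rule smallness_arithmetic[OF ca Ca0 beta2(1) b1 gam _ _ _ perm(2) sm en(1)])
      (use en(2) in \<open>simp_all add: L2_norm_nonneg Hhalf_vec_norm_def sum_nonneg norm_X_nonneg\<close>)
  obtain M where M: "M \<ge> 0" "AE x in lebesgue_on \<Omega>. norm (\<kappa> (d, p) x) \<le> M"
    using LinfE[OF permeabilityD(1)[OF S(1)]] by blast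
  define C where "C = cea_constant ca (2 * mu + 2 * lam + 2 * \<alpha>)
    (2 * mu + 2 * lam + (M + \<kappa>2 * (2 * r)) + c0 + 4 * \<alpha>) \<beta>2s"
  have C: "C > 0"
    unfolding C_def using r params perm M by (intro cea_constant_pos ca beta2s) auto
  show ?thesis
  proof (intro exI[of _ C] conjI C allI impI)
    fix \<T> xh
    let ?XX = "space_Xh \<Omega> \<T> k" and ?YY = "space_Yh \<Omega> \<T> k" and ?ZZ = "space_Zh \<Omega> \<T> k"
    assume \<T>: "regular_partition \<Omega> \<T>" and inf_sup: "inf_sup_b2 \<Omega> ?XX ?YY ?ZZ \<beta>2s"
      and uniq: "unique_solution_in_ball \<Omega> \<kappa> lam mu \<alpha> c0 f g u\<Gamma> r\<Gamma> ?XX ?YY ?ZZ r xh"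
    obtain d' p' \<sigma>' u' where xh: "xh = (((d', p'), \<sigma>'), u')" by (cases xh) auto
    have solh: "solves ?XX ?YY ?ZZ (((d', p'), \<sigma>'), u')" and ballh: "norm_X \<Omega> (d', p') \<le> r"
      using uniq by (simp_all add: unique_solution_in_ball_def xh Let_def ball_W_def)
    note T = solves_problemD(1-3)[OF solh]
    have le: "norm_XYZ \<Omega> (x - xh) \<le> C * norm_XYZ \<Omega> (x - y)" if y: "y \<in> (?XX \<times> ?YY) \<times> ?ZZ" for y
    proof -
      obtain e q \<tau> v where y_eq: "y = (((e, q), \<tau>), v)" by (cases y) auto
      have emb: "(\<tau>, \<lambda>x. a) \<in> ?XX" if "\<tau> \<in> ?YY" for \<tau> a
        using space_Yh_subset_X1h[OF domain \<T> that] const_in_space_X2h by (simp add: space_Xh_def)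
      \<comment> \<open>With unit pressure a discrete pair of nonzero norm arises, so that the supremum in the inf-sup
        condition is taken over a nonempty set.\<close>
      have one: "((\<sigma>', \<lambda>x. 1), \<sigma>') \<in> ?XX \<times> ?YY" using emb T(2) by simp
      have "L2_norm \<Omega> (\<lambda>x. 1 :: real) > 0" by (rule L2_norm_const_pos[OF \<Omega> \<Omega>_nonempty]) simp
      then have "norm_XY \<Omega> ((\<sigma>', \<lambda>x. 1), \<sigma>') \<noteq> 0" by (rule norm_XY_pos(2))
      note nontriv = one this
      show ?thesis
        unfolding x xh y_eq C_def ca_def
      proof (rule quasi_optimality[OF sol solh _ _ _ emb tdiv_Yh_in_Zh space_Zh_diff nontriv inf_sup beta2s
            M(2,1) ball ballh absorb[unfolded ca_def]])
        show "e \<in> L2_sym \<Omega>" if "(e, q) \<in> ?XX" for e q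
          using that by (simp add: space_Xh_def space_X1h_def)
        show "?YY \<subseteq> space_Y \<Omega>" "?ZZ \<subseteq> L2 \<Omega>" by (auto simp: space_Yh_def space_Zh_def)
        show "(e, q) \<in> ?XX" "\<tau> \<in> ?YY" "v \<in> ?ZZ" using y by (simp_all add: y_eq)
      qed
    qed
    have "norm_XYZ \<Omega> (x - xh) / C \<le> (INF y \<in> (?XX \<times> ?YY) \<times> ?ZZ. norm_XYZ \<Omega> (x - y))"
    proof (rule cINF_greatest)
      show "(?XX \<times> ?YY) \<times> ?ZZ \<noteq> {}" using T by auto
      show "norm_XYZ \<Omega> (x - xh) / C \<le> norm_XYZ \<Omega> (x - y)" if "y \<in> (?XX \<times> ?YY) \<times> ?ZZ" for y
        using le[OF that] C by (simp add: field_simps)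
    qed
    then show "norm_XYZ \<Omega> (x - xh) \<le> C * (INF y \<in> (?XX \<times> ?YY) \<times> ?ZZ. norm_XYZ \<Omega> (x - y))"
      using C by (simp add: field_simps)
  qed
qed

end
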